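(* Let $H$ be the algebraic system generated by $z_{12},z_{23},\eta_1,\eta_2,\eta_3$ with set of elements $$h=z_{12}^{\beta_1}z_{23}^{\beta_2}\,\eta_1^{\gamma_1}\eta_2^{\gamma_2}\eta_3^{\gamma_3}=:(\beta_1,\beta_2,\gamma_1,\gamma_2,\gamma_3),\qquad 0\le\beta_1,\beta_2,\gamma_1,\gamma_2,\gamma_3\le2\ (\mathrm{mod}\ 3),$$ and with the product rule determined by the fundamental relations listed in the context. Then $H$ is a group of order 243. With $Z_{12}:=\langle z_{12}\rangle$, $Z_{23}:=\langle z_{23}\rangle$ and $Y_j:=\langle\eta_j\rangle$ $(1\le j\le3)$, $$Z(H)=Z_{12}\times Z_{23},\qquad [H,H]=Z_{12}\times Z_{23}\times Y_2,$$ and $$H=\big\{[(Z_{12}\times Y_1)\rtimes Y_2]\times Z_{23}\big\}\rtimes Y_3\cong\big\{[(C_3\times C_3)\rtimes C_3]\times C_3\big\}\rtimes C_3.$$ The group $H$ is a representation group $R(G_{39})$ of the group $G_{39}\cong G_{27}^{\,3}$ of order 27 presented by generators $a,b$ and relations $a^3=b^3=1$, $(ab)^3=(a^{-1}b)^3=1$, and $H$ is isomorphic to $G_{243}^{\,3}$, i.e. has GAP identity $[243,3]$.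
   Context: Write $\varphi(h)g:=hgh^{-1}$ and $[x,y]:=xyx^{-1}y^{-1}$. The fundamental relations of $H$ are: $z_{12},z_{23}$ are central with $z_{12}^3=z_{23}^3=1$; $[\eta_2,\eta_3]=z_{23}$; and $$\eta_j^3=1\ (1\le j\le3),\quad \eta_2\eta_1=z_{12}^{-1}\eta_1\eta_2,$$ $$\varphi(\eta_3)\eta_1=z_{12}\eta_1\eta_2^2,\quad \varphi(\eta_3)\eta_1^2=\eta_1^2\eta_2,\quad \varphi(\eta_3^2)\eta_1=z_{12}^2z_{23}\eta_1\eta_2,\quad \varphi(\eta_3^2)\eta_1^2=z_{23}^2\eta_1^2\eta_2^2,$$ $$\varphi(\eta_3)\eta_2=z_{23}^2\eta_2,\quad \varphi(\eta_3)\eta_2^2=z_{23}\eta_2^2,\quad \varphi(\eta_3^2)\eta_2=z_{23}\eta_2,\quad \varphi(\eta_3^2)\eta_2^2=z_{23}^2\eta_2^2.$$ Distinct quintuples are regarded as distinct elements, and products are computed by rewriting into normal form with these relations. $C_3$ is the cyclic group of order 3; $G_n^{\,k}$ denotes the group with GAP identity $[n,k]$, i.e. SmallGroup$(n,k)$ of the GAP Small Groups library. $M(G)=H^2(G,\mathbb{C}^\times)$ (trivial action) is the Schur multiplier of a finite group $G$. A group $H$ is a representation group of $G$ if it has a subgroup $A\subset Z(H)\cap[H,H]$ with $A\cong M(G)$ and $H/A\cong G$. The covering map $H\to G_{39}$ is $\eta_1\mapsto b$, $\eta_2\mapsto [b,a]$, $\eta_3\mapsto a$, $z_{12},z_{23}\mapsto1$.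 *)

theory Defs
  imports "HOL-Algebra.Algebra" Complex_Main
begin

section \<open>Groups given by generators and relations\<close>

text \<open>
  A word is a list of letters; the letter \<open>(x, True)\<close> stands for the generator \<open>x\<close> and
  \<open>(x, False)\<close> for its inverse. The generators are all elements of the type \<open>'x\<close>, and a
  relation \<open>u = v\<close> between words is written as the pair \<open>(u, v)\<close>.
\<close>

type_synonym 'x word = "('x \<times> bool) list"

definition gen :: "'x \<Rightarrow> 'x word"
  where "gen x = [(x, True)]"

definition winv :: "'x word \<Rightarrow> 'x word"
  where "winv w = rev (map (\<lambda>(x, s). (x, \<not> s)) w)"

definition wpow :: "'x word \<Rightarrow> nat \<Rightarrow> 'x word"
  where "wpow w n = concat (replicate n w)"

definition wconj :: "'x word \<Rightarrow> 'x word \<Rightarrow> 'x word"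
  where "wconj h g = h @ g @ winv h"

definition wcomm :: "'x word \<Rightarrow> 'x word \<Rightarrow> 'x word"
  where "wcomm u v = u @ v @ winv u @ winv v"

inductive word_eq :: "('x word \<times> 'x word) set \<Rightarrow> 'x word \<Rightarrow> 'x word \<Rightarrow> bool"
  for R :: "('x word \<times> 'x word) set"
where
  refl: "word_eq R u u"
| sym: "word_eq R u v \<Longrightarrow> word_eq R v u"
| trans: "word_eq R u v \<Longrightarrow> word_eq R v w \<Longrightarrow> word_eq R u w"
| cancel: "word_eq R (p @ [(x, s), (x, \<not> s)] @ q) (p @ q)"
| rel: "(u, v) \<in> R \<Longrightarrow> word_eq R (p @ u @ q) (p @ v @ q)"

definition word_class :: "('x word \<times> 'x word) set \<Rightarrow> 'x word \<Rightarrow> 'x word set"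
  where "word_class R w = {v. word_eq R w v}"

definition presented_group :: "('x word \<times> 'x word) set \<Rightarrow> 'x word set monoid"
  where "presented_group R =
    \<lparr> carrier = range (word_class R),
      monoid.mult = (\<lambda>A B. \<Union>u\<in>A. \<Union>v\<in>B. word_class R (u @ v)),
      one = word_class R [] \<rparr>"


section \<open>The algebraic system H\<close>

datatype Hgen = Z12 | Z23 | E1 | E2 | E3

definition H_rels :: "(Hgen word \<times> Hgen word) set"
  where "H_rels =
    (let z12 = gen Z12; z23 = gen Z23; e1 = gen E1; e2 = gen E2; e3 = gen E3 in
      {(gen c @ gen x, gen x @ gen c) | c x. c \<in> {Z12, Z23}}
    \<union> {(wpow z12 3, []), (wpow z23 3, []),
       (wcomm e2 e3, z23),
       (wpow e1 3, []), (wpow e2 3, []), (wpow e3 3, []),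
       (e2 @ e1, winv z12 @ e1 @ e2),
       (wconj e3 e1, z12 @ e1 @ wpow e2 2),
       (wconj e3 (wpow e1 2), wpow e1 2 @ e2),
       (wconj (wpow e3 2) e1, wpow z12 2 @ z23 @ e1 @ e2),
       (wconj (wpow e3 2) (wpow e1 2), wpow z23 2 @ wpow e1 2 @ wpow e2 2),
       (wconj e3 e2, wpow z23 2 @ e2),
       (wconj e3 (wpow e2 2), z23 @ wpow e2 2),
       (wconj (wpow e3 2) e2, z23 @ e2),
       (wconj (wpow e3 2) (wpow e2 2), wpow z23 2 @ wpow e2 2)})"

type_synonym quintuple = "nat \<times> nat \<times> nat \<times> nat \<times> nat"

definition H_set :: "quintuple set"
  where "H_set = {0..2} \<times> {0..2} \<times> {0..2} \<times> {0..2} \<times> {0..2}"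

fun normal_word :: "quintuple \<Rightarrow> Hgen word"
  where "normal_word (b1, b2, g1, g2, g3) =
    wpow (gen Z12) b1 @ wpow (gen Z23) b2 @ wpow (gen E1) g1 @ wpow (gen E2) g2 @ wpow (gen E3) g3"

text \<open>
  \<open>is_H_product h h' q\<close>: the juxtaposition of the normal words of \<open>h\<close> and \<open>h'\<close> can be rewritten,
  using the fundamental relations, into the normal word of \<open>q\<close>. Distinct quintuples are distinct
  elements of \<open>H\<close> by construction; that exactly one such \<open>q\<close> exists is not built into the
  definitions.
\<close>

definition is_H_product :: "quintuple \<Rightarrow> quintuple \<Rightarrow> quintuple \<Rightarrow> bool"
  where "is_H_product h h' q \<longleftrightarrow>
    q \<in> H_set \<and> word_eq H_rels (normal_word h @ normal_word h') (normal_word q)"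

definition H :: "quintuple monoid"
  where "H = \<lparr> carrier = H_set,
               monoid.mult = (\<lambda>h h'. THE q. is_H_product h h' q),
               one = (0, 0, 0, 0, 0) \<rparr>"

definition z12 :: quintuple where "z12 = (1, 0, 0, 0, 0)"
definition z23 :: quintuple where "z23 = (0, 1, 0, 0, 0)"
definition eta1 :: quintuple where "eta1 = (0, 0, 1, 0, 0)"
definition eta2 :: quintuple where "eta2 = (0, 0, 0, 1, 0)"
definition eta3 :: quintuple where "eta3 = (0, 0, 0, 0, 1)"

definition sub_Z12 :: "quintuple set" where "sub_Z12 = generate H {z12}"
definition sub_Z23 :: "quintuple set" where "sub_Z23 = generate H {z23}"
definition sub_Y1 :: "quintuple set" where "sub_Y1 = generate H {eta1}"
definition sub_Y2 :: "quintuple set" where "sub_Y2 = generate H {eta2}"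
definition sub_Y3 :: "quintuple set" where "sub_Y3 = generate H {eta3}"


section \<open>The group G39 and the two groups from the GAP Small Groups library\<close>

datatype Ggen = GenA | GenB

definition G39_rels :: "(Ggen word \<times> Ggen word) set"
  where "G39_rels =
    (let a = gen GenA; b = gen GenB in
      {(wpow a 3, []), (wpow b 3, []), (wpow (a @ b) 3, []), (wpow (winv a @ b) 3, [])})"

definition G39 :: "Ggen word set monoid"
  where "G39 = presented_group G39_rels"

definition G39_a :: "Ggen word set" where "G39_a = word_class G39_rels (gen GenA)"
definition G39_b :: "Ggen word set" where "G39_b = word_class G39_rels (gen GenB)"

text \<open>
  The library describes a p-group \<open>SmallGroup(n, k)\<close> by a power-conjugate presentation on
  generators \<open>F1\<close>, \<open>F2\<close>, and so on. GAP displays only the nontrivial relations, and writes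
  \<open>x^y\<close> for the conjugate of \<open>x\<close> by the inverse of \<open>y\<close>. For \<open>[27, 3]\<close> and
  \<open>[243, 3]\<close> all third powers \<open>Fi^3\<close> are trivial; the nontrivial conjugates are
  \<open>F2^F1 = F2 F3\<close> for \<open>[27, 3]\<close>, and \<open>F2^F1 = F2 F3\<close>, \<open>F3^F1 = F3 F4\<close>,
  \<open>F3^F2 = F3 F5\<close> for \<open>[243, 3]\<close>.
\<close>

datatype pc3 = F1 | F2 | F3

definition SmallGroup_27_3 :: "pc3 word set monoid"
  where "SmallGroup_27_3 = presented_group
    ({(wpow (gen f) 3, []) | f. True} \<union>
     {(wconj (winv (gen F1)) (gen F2), gen F2 @ gen F3),
      (wconj (winv (gen F1)) (gen F3), gen F3),
      (wconj (winv (gen F2)) (gen F3), gen F3)})"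

datatype pc5 = F1 | F2 | F3 | F4 | F5

definition SmallGroup_243_3 :: "pc5 word set monoid"
  where "SmallGroup_243_3 = presented_group
    ({(wpow (gen f) 3, []) | f. True} \<union>
     {(wconj (winv (gen F1)) (gen F2), gen F2 @ gen F3),
      (wconj (winv (gen F1)) (gen F3), gen F3 @ gen F4),
      (wconj (winv (gen F1)) (gen F4), gen F4),
      (wconj (winv (gen F1)) (gen F5), gen F5),
      (wconj (winv (gen F2)) (gen F3), gen F3 @ gen F5),
      (wconj (winv (gen F2)) (gen F4), gen F4),
      (wconj (winv (gen F2)) (gen F5), gen F5),
      (wconj (winv (gen F3)) (gen F4), gen F4),
      (wconj (winv (gen F3)) (gen F5), gen F5),
      (wconj (winv (gen F4)) (gen F5), gen F5)})"


section \<open>Centers, direct and semidirect products\<close>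

definition center :: "('a, 'm) monoid_scheme \<Rightarrow> 'a set"
  where "center G = {z \<in> carrier G. \<forall>g \<in> carrier G. z \<otimes>\<^bsub>G\<^esub> g = g \<otimes>\<^bsub>G\<^esub> z}"

definition subgrp :: "('a, 'm) monoid_scheme \<Rightarrow> 'a set \<Rightarrow> ('a, 'm) monoid_scheme"
  where "subgrp G L = G\<lparr>carrier := L\<rparr>"

text \<open>\<open>L = N \<rtimes> K\<close> and \<open>L = N \<times> K\<close> as internal products of subgroups of \<open>G\<close>.\<close>

definition internal_semidirect ::
    "('a, 'm) monoid_scheme \<Rightarrow> 'a set \<Rightarrow> 'a set \<Rightarrow> 'a set \<Rightarrow> bool"
  where "internal_semidirect G L N K \<longleftrightarrow>
    subgroup L G \<and> N \<lhd> subgrp G L \<and> subgroup K (subgrp G L) \<and>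
    N \<inter> K = {\<one>\<^bsub>G\<^esub>} \<and> N <#>\<^bsub>G\<^esub> K = L"

definition internal_direct ::
    "('a, 'm) monoid_scheme \<Rightarrow> 'a set \<Rightarrow> 'a set \<Rightarrow> 'a set \<Rightarrow> bool"
  where "internal_direct G L N K \<longleftrightarrow>
    internal_semidirect G L N K \<and> K \<lhd> subgrp G L"

definition semidirect ::
    "('a, 'm) monoid_scheme \<Rightarrow> ('b, 'n) monoid_scheme \<Rightarrow> ('b \<Rightarrow> 'a \<Rightarrow> 'a) \<Rightarrow> ('a \<times> 'b) monoid"
  where "semidirect N K \<theta> =
    \<lparr> carrier = carrier N \<times> carrier K,
      monoid.mult = (\<lambda>(n, k) (n', k'). (n \<otimes>\<^bsub>N\<^esub> \<theta> k n', k \<otimes>\<^bsub>K\<^esub> k')),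
      one = (\<one>\<^bsub>N\<^esub>, \<one>\<^bsub>K\<^esub>) \<rparr>"

abbreviation C3 :: "int monoid"
  where "C3 \<equiv> integer_mod_group 3"


section \<open>Schur multiplier and representation groups\<close>

text \<open>
  2-cocycles with values in \<open>\<complex>\<^sup>\<times>\<close> (trivial action), as extensional functions on
  \<open>carrier G \<times> carrier G\<close>; the Schur multiplier is the quotient by the 2-coboundaries.
\<close>

definition cocycles2 :: "('a, 'm) monoid_scheme \<Rightarrow> ('a \<times> 'a \<Rightarrow> complex) monoid"
  where "cocycles2 G =
    \<lparr> carrier = {f \<in> (carrier G \<times> carrier G) \<rightarrow>\<^sub>E (- {0}).
        \<forall>x \<in> carrier G. \<forall>y \<in> carrier G. \<forall>z \<in> carrier G.
          f (x, y) * f (x \<otimes>\<^bsub>G\<^esub> y, z) = f (y, z) * f (x, y \<otimes>\<^bsub>G\<^esub> z)},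
      monoid.mult = (\<lambda>f g. \<lambda>p \<in> carrier G \<times> carrier G. f p * g p),
      one = (\<lambda>p \<in> carrier G \<times> carrier G. 1) \<rparr>"

definition coboundaries2 :: "('a, 'm) monoid_scheme \<Rightarrow> ('a \<times> 'a \<Rightarrow> complex) set"
  where "coboundaries2 G =
    {\<lambda>(x, y) \<in> carrier G \<times> carrier G. c x * c y / c (x \<otimes>\<^bsub>G\<^esub> y) | c.
      \<forall>x \<in> carrier G. c x \<noteq> 0}"

definition schur_multiplier :: "('a, 'm) monoid_scheme \<Rightarrow> ('a \<times> 'a \<Rightarrow> complex) set monoid"
  where "schur_multiplier G = cocycles2 G Mod coboundaries2 G"

definition representation_group ::
    "('b, 'n) monoid_scheme \<Rightarrow> ('a, 'm) monoid_scheme \<Rightarrow> bool"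
  where "representation_group K G \<longleftrightarrow>
    group G \<and> finite (carrier G) \<and> group K \<and>
    (\<exists>A. subgroup A K \<and> A \<subseteq> center K \<inter> derived K (carrier K) \<and>
         subgrp K A \<cong> schur_multiplier G \<and> K Mod A \<cong> G)"

end

theory Submission
  imports Defs "HOL-Library.Numeral_Type"
begin

text \<open>
  Collection with the fundamental relations multiplies two normal forms by integer polynomials in
  the exponents (\<open>hmul\<close>). These polynomials define an associative product already over the
  integers, so the quintuples modulo 3 form a group, and this group satisfies all the relations.
  Conversely, in every group with elements that satisfy the relations used by collection, normal
  forms multiply by \<open>hmul\<close> (\<open>N_hmul\<close>). Applied to the group presented by the relations, this shows
  that a juxtaposition of normal words can be rewritten into exactly one normal word, so the
  product of \<open>H\<close> is \<open>hmul\<close>. The internal products, the center and the derived subgroup are then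
  read off in coordinates.

  What remains rests on a universal property (\<open>hom_from_H\<close>): elements \<open>x\<close>, \<open>y\<close> with
  \<open>x\<^sup>3 = y\<^sup>3 = 1\<close> such that \<open>v = x\<inverse>yxy\<inverse>\<close> has commutators \<open>[v,x]\<close> and \<open>[y,v]\<close> commuting with
  \<open>x\<close> and \<open>y\<close> are the images of \<open>\<eta>\<^sub>1\<close>, \<open>\<eta>\<^sub>3\<close> under a homomorphism from \<open>H\<close>. It yields
  epimorphisms from \<open>H\<close> to the presented groups; their kernels are the center, or trivial, because
  the defining relations hold in \<open>H\<close> modulo that subgroup (\<open>presented_as_quotient\<close>).

  For the Schur multiplier, a cocycle of \<open>G\<^sub>3\<^sub>9\<close> defines a central extension by \<open>\<complex>\<^sup>\<times>\<close>. The generators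
  lift to elements of order 3 of this extension, as \<open>\<complex>\<^sup>\<times>\<close> has cube roots, and the universal property
  extends the lifts to a homomorphism from \<open>H\<close>. Hence the cocycle becomes a coboundary on \<open>H\<close>. As
  the kernel of the covering map lies in the center and in the derived subgroup, the Schur
  multiplier is therefore the character group of that kernel
  (\<open>schur_multiplier_iso_char_group\<close>), which is isomorphic to the kernel itself.
\<close>


section \<open>Words and presented groups\<close>

text \<open>The value of a word in a group, once the generators have been given values by \<open>\<phi>\<close>.\<close>

definition word_eval :: "('a, 'm) monoid_scheme \<Rightarrow> ('x \<Rightarrow> 'a) \<Rightarrow> 'x word \<Rightarrow> 'a"
  where "word_eval G \<phi> w =
    foldr (\<lambda>(x, s) g. (if s then \<phi> x else inv\<^bsub>G\<^esub> \<phi> x) \<otimes>\<^bsub>G\<^esub> g) w \<one>\<^bsub>G\<^esub>"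

lemma word_eval_Nil [simp]: "word_eval G \<phi> [] = \<one>\<^bsub>G\<^esub>"
  by (simp add: word_eval_def)

lemma word_eval_Cons [simp]:
  "word_eval G \<phi> ((x, s) # w) = (if s then \<phi> x else inv\<^bsub>G\<^esub> \<phi> x) \<otimes>\<^bsub>G\<^esub> word_eval G \<phi> w"
  by (simp add: word_eval_def)

context group
begin

lemma word_eval_closed [simp]:
  assumes "\<And>x. \<phi> x \<in> carrier G"
  shows "word_eval G \<phi> w \<in> carrier G"
  using assms by (induction w) auto

lemma word_eval_append:
  assumes "\<And>x. \<phi> x \<in> carrier G"
  shows "word_eval G \<phi> (u @ v) = word_eval G \<phi> u \<otimes> word_eval G \<phi> v"
  using assms by (induction u) (auto simp: m_assoc)

lemma word_eval_gen:
  assumes "\<And>x. \<phi> x \<in> carrier G"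
  shows "word_eval G \<phi> (gen x) = \<phi> x"
  using assms by (simp add: gen_def)

lemma word_eval_winv:
  assumes "\<And>x. \<phi> x \<in> carrier G"
  shows "word_eval G \<phi> (winv w) = inv word_eval G \<phi> w"
  using assms by (induction w) (auto simp: winv_def word_eval_append inv_mult_group)

lemma word_eval_wpow:
  assumes "\<And>x. \<phi> x \<in> carrier G"
  shows "word_eval G \<phi> (wpow w n) = word_eval G \<phi> w [^] n"
proof (induction n)
  case (Suc n)
  have "word_eval G \<phi> (wpow w (Suc n)) = word_eval G \<phi> w \<otimes> word_eval G \<phi> w [^] n"
    using assms Suc by (simp add: wpow_def word_eval_append)
  then show ?case using assms by (metis word_eval_closed nat_pow_Suc2)
qed (simp add: wpow_def)

lemma word_eval_wconj:
  assumes "\<And>x. \<phi> x \<in> carrier G"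
  shows "word_eval G \<phi> (wconj u v)
    = word_eval G \<phi> u \<otimes> word_eval G \<phi> v \<otimes> inv word_eval G \<phi> u"
  using assms by (simp add: wconj_def word_eval_append word_eval_winv m_assoc)

lemma word_eval_wcomm:
  assumes "\<And>x. \<phi> x \<in> carrier G"
  shows "word_eval G \<phi> (wcomm u v)
    = word_eval G \<phi> u \<otimes> word_eval G \<phi> v \<otimes> inv word_eval G \<phi> u \<otimes> inv word_eval G \<phi> v"
  using assms by (simp add: wcomm_def word_eval_append word_eval_winv m_assoc)

lemmas word_eval_simps =
  word_eval_append word_eval_gen word_eval_winv word_eval_wpow word_eval_wconj word_eval_wcomm

text \<open>Von Dyck: a relation that follows from \<open>R\<close> holds wherever all of \<open>R\<close> holds.\<close>

lemma word_eq_sound: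
  assumes "word_eq R u v"
    and \<phi>: "\<And>x. \<phi> x \<in> carrier G"
    and R: "\<And>u v. (u, v) \<in> R \<Longrightarrow> word_eval G \<phi> u = word_eval G \<phi> v"
  shows "word_eval G \<phi> u = word_eval G \<phi> v"
  using assms(1)
proof induction
  case (cancel p x s q)
  then show ?case
    using \<phi> by (cases s) (simp_all add: word_eval_append m_assoc[symmetric])
next
  case (rel u v p q)
  then show ?case using \<phi> R by (simp add: word_eval_append)
qed auto

lemma range_word_eval:
  assumes "\<And>x. \<phi> x \<in> carrier G"
  shows "range (word_eval G \<phi>) = generate G (range \<phi>)"
proof
  show "range (word_eval G \<phi>) \<subseteq> generate G (range \<phi>)"
  proof clarify
    fix w show "word_eval G \<phi> w \<in> generate G (range \<phi>)"
      by (induction w) (auto simp: generate.eng generate.one generate.incl generate.inv)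
  qed
  show "generate G (range \<phi>) \<subseteq> range (word_eval G \<phi>)"
  proof
    fix h assume "h \<in> generate G (range \<phi>)"
    then show "h \<in> range (word_eval G \<phi>)"
    proof induction
      case one
      then show ?case by (metis rangeI word_eval_Nil)
    next
      case (incl h)
      then show ?case using assms word_eval_gen by (metis rangeE rangeI)
    next
      case (inv h)
      then show ?case using assms word_eval_gen word_eval_winv by (metis rangeE rangeI)
    next
      case (eng h1 h2)
      then obtain u v where "h1 = word_eval G \<phi> u" "h2 = word_eval G \<phi> v" by auto
      then have "h1 \<otimes> h2 = word_eval G \<phi> (u @ v)" using assms by (simp add: word_eval_append)
      then show ?case by blast
    qed
  qed
qed

end

lemma word_eval_hom:
  assumes "group_hom G K \<psi>" "\<And>x. \<phi> x \<in> carrier G"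
  shows "\<psi> (word_eval G \<phi> w) = word_eval K (\<psi> \<circ> \<phi>) w"
proof -
  interpret group_hom G K \<psi> by fact
  show ?thesis using assms(2) by (induction w) auto
qed

lemma word_eq_append:
  assumes "word_eq R u u'" "word_eq R v v'"
  shows "word_eq R (u @ v) (u' @ v')"
proof -
  have 1: "word_eq R (p @ u) (p @ u')" if "word_eq R u u'" for p u u' :: "'a word"
    using that
  proof induction
    case (cancel q x s r)
    show ?case using word_eq.cancel[of R "p @ q" x s r] by simp
  next
    case (rel u v q r)
    show ?case using word_eq.rel[OF rel, of "p @ q" r] by simp
  qed (blast intro: word_eq.intros)+
  have 2: "word_eq R (u @ p) (u' @ p)" if "word_eq R u u'" for p u u' :: "'a word"
    using that
  proof induction
    case (cancel q x s r)
    show ?case using word_eq.cancel[of R q x s "r @ p"] by simp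
  next
    case (rel u v q r)
    show ?case using word_eq.rel[OF rel, of q "r @ p"] by simp
  qed (blast intro: word_eq.intros)+
  show ?thesis using 1 2 assms word_eq.trans by blast
qed

lemma word_eq_winv: "word_eq R (winv w @ w) []"
proof (induction w)
  case Nil
  then show ?case by (simp add: winv_def word_eq.refl)
next
  case (Cons a w)
  obtain x s where a: "a = (x, s)" by (cases a)
  have "winv (a # w) @ a # w = winv w @ [(x, \<not> s), (x, \<not> \<not> s)] @ w"
    by (simp add: winv_def a)
  then have "word_eq R (winv (a # w) @ a # w) (winv w @ w)"
    using word_eq.cancel[of R "winv w" x "\<not> s" w] by (simp only:)
  then show ?case using Cons word_eq.trans by blast
qed

lemma word_class_eq_iff: "word_class R u = word_class R v \<longleftrightarrow> word_eq R u v"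
  unfolding word_class_def by (auto intro: word_eq.intros)

lemma word_class_rel: "(u, v) \<in> R \<Longrightarrow> word_class R u = word_class R v"
  using word_eq.rel[of u v R "[]" "[]"] by (simp add: word_class_eq_iff)

lemma presented_mult:
  "word_class R u \<otimes>\<^bsub>presented_group R\<^esub> word_class R v = word_class R (u @ v)"
proof -
  have "word_class R (u' @ v') = word_class R (u @ v)"
    if "u' \<in> word_class R u" "v' \<in> word_class R v" for u' v'
    using that word_eq_append[of R u u' v v'] word_eq.sym
    unfolding word_class_eq_iff by (fastforce simp: word_class_def)
  moreover have "u \<in> word_class R u" "v \<in> word_class R v"
    by (auto simp: word_class_def intro: word_eq.refl)
  ultimately have "(\<Union>u'\<in>word_class R u. \<Union>v'\<in>word_class R v. word_class R (u' @ v'))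
      = word_class R (u @ v)"
    by blast
  then show ?thesis by (simp add: presented_group_def)
qed

lemma word_class_closed [simp]: "word_class R w \<in> carrier (presented_group R)"
  by (simp add: presented_group_def)

lemma presented_one: "\<one>\<^bsub>presented_group R\<^esub> = word_class R []"
  by (simp add: presented_group_def)

lemma carrier_presented_group: "carrier (presented_group R) = range (word_class R)"
  by (simp add: presented_group_def)

lemma group_presented_group: "group (presented_group R)"
proof (rule groupI)
  fix A assume "A \<in> carrier (presented_group R)"
  then obtain w where w: "A = word_class R w" by (auto simp: carrier_presented_group)
  show "\<exists>B\<in>carrier (presented_group R). B \<otimes>\<^bsub>presented_group R\<^esub> A = \<one>\<^bsub>presented_group R\<^esub>"
    using word_eq_winv
    by (intro bexI[of _ "word_class R (winv w)"]) (simp_all add: w presented_mult presented_one word_class_eq_iff)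
qed (auto simp: carrier_presented_group presented_mult presented_one)

lemma word_class_winv:
  "word_class R (winv w) = inv\<^bsub>presented_group R\<^esub> word_class R w"
proof -
  interpret P: group "presented_group R" by (rule group_presented_group)
  show ?thesis
    using word_eq_winv
    by (intro P.inv_equality[symmetric])
      (simp_all add: presented_mult presented_one word_class_eq_iff)
qed

lemma word_class_eval:
  "word_class R w = word_eval (presented_group R) (\<lambda>x. word_class R (gen x)) w"
proof (induction w)
  case Nil
  then show ?case by (simp add: presented_one)
next
  case (Cons a w)
  obtain x s where a: "a = (x, s)" by (cases a)
  have 1: "word_class R (a # w) = word_class R [a] \<otimes>\<^bsub>presented_group R\<^esub> word_class R w"
    by (simp add: presented_mult)
  have "word_class R [a] = (if s then word_class R (gen x) else inv\<^bsub>presented_group R\<^esub> word_class R (gen x))"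
    using word_class_winv[of R "gen x"] by (simp add: a gen_def winv_def)
  then show ?case using 1 Cons by (simp add: a)
qed

text \<open>The relations of a presentation, read inside the presented group.\<close>

lemma presented_rel:
  assumes "(u, v) \<in> R"
  shows "word_eval (presented_group R) (\<lambda>x. word_class R (gen x)) u
    = word_eval (presented_group R) (\<lambda>x. word_class R (gen x)) v"
  using word_class_rel[OF assms] word_class_eval[of R u] word_class_eval[of R v] by argo

text \<open>
  A criterion for an epimorphism \<open>\<psi>\<close> onto a presented group to have a given kernel \<open>N\<close>: the
  relations hold modulo \<open>N\<close>, so there is a map back to the quotient by \<open>N\<close>, and it is inverse
  to the map that \<open>\<psi>\<close> induces on this quotient.
\<close>

lemma presented_as_quotient:
  fixes G :: "('a, 'm) monoid_scheme" and R :: "('x word \<times> 'x word) set"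
  assumes N: "N \<lhd> G"
    and \<phi>: "\<And>x. \<phi> x \<in> carrier G"
    and gen: "generate G (range \<phi>) = carrier G"
    and R: "\<And>u v. (u, v) \<in> R \<Longrightarrow> word_eval G \<phi> u \<in> N #>\<^bsub>G\<^esub> word_eval G \<phi> v"
    and \<psi>: "\<psi> \<in> hom G (presented_group R)"
    and \<psi>N: "\<And>n. n \<in> N \<Longrightarrow> \<psi> n = \<one>\<^bsub>presented_group R\<^esub>"
    and \<psi>\<phi>: "\<And>x. \<psi> (\<phi> x) = word_class R (gen x)"
  shows "\<psi> \<in> epi G (presented_group R)" "kernel G (presented_group R) \<psi> = N"
proof -
  let ?P = "presented_group R"
  interpret N: normal N G by fact
  interpret P: group ?P by (rule group_presented_group)
  interpret Q: group "G Mod N" by (rule N.factorgroup_is_group)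
  interpret \<psi>: group_hom G ?P \<psi>
    using \<psi> by (simp add: group_hom_def group_hom_axioms_def N.is_group P.is_group)
  interpret q: group_hom G "G Mod N" "\<lambda>x. N #>\<^bsub>G\<^esub> x"
    using N.r_coset_hom_Mod N.is_group Q.is_group by (simp add: group_hom_def group_hom_axioms_def)
  have ev: "\<psi> (word_eval G \<phi> w) = word_class R w" for w
  proof -
    have "\<psi> (word_eval G \<phi> w) = word_eval ?P (\<psi> \<circ> \<phi>) w"
      using word_eval_hom \<psi>.group_hom_axioms \<phi> by blast
    also have "\<psi> \<circ> \<phi> = (\<lambda>x. word_class R (gen x))" using \<psi>\<phi> by auto
    finally show ?thesis using word_class_eval by metis
  qed
  have words: "\<exists>w. h = word_eval G \<phi> w" if "h \<in> carrier G" for h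
    using N.range_word_eval[of \<phi>, OF \<phi>] gen that by blast
  have "carrier ?P \<subseteq> \<psi> ` carrier G"
  proof
    fix A assume "A \<in> carrier ?P"
    then obtain w where "A = word_class R w" by (auto simp: carrier_presented_group)
    then show "A \<in> \<psi> ` carrier G" using ev N.word_eval_closed[of \<phi>, OF \<phi>] by (metis imageI)
  qed
  then show "\<psi> \<in> epi G ?P" using \<psi> by (simp add: epi_iff_subset)
  \<comment> \<open>By Von Dyck for \<open>G Mod N\<close>, the coset of \<open>word_eval G \<phi> w\<close> depends only on the class of \<open>w\<close>.\<close>
  have descends: "N #>\<^bsub>G\<^esub> word_eval G \<phi> u = N #>\<^bsub>G\<^esub> word_eval G \<phi> v" if "word_eq R u v" for u v
  proof -
    let ?f = "(\<lambda>x. N #>\<^bsub>G\<^esub> x) \<circ> \<phi>"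
    have e: "word_eval (G Mod N) ?f w = N #>\<^bsub>G\<^esub> word_eval G \<phi> w" for w
      using word_eval_hom[OF q.group_hom_axioms] \<phi> by metis
    have "word_eval (G Mod N) ?f u = word_eval (G Mod N) ?f v"
    proof (rule Q.word_eq_sound[OF that])
      show "?f x \<in> carrier (G Mod N)" for x using \<phi> q.hom_closed by simp
      show "word_eval (G Mod N) ?f u = word_eval (G Mod N) ?f v" if "(u, v) \<in> R" for u v
        unfolding e using R[OF that] N.repr_independence[OF _ _ N.is_subgroup] N.word_eval_closed[of \<phi>, OF \<phi>]
        by (metis (no_types))
    qed
    then show ?thesis by (simp only: e)
  qed
  show "kernel G ?P \<psi> = N"
  proof
    show "N \<subseteq> kernel G ?P \<psi>" using \<psi>N N.subset by (auto simp: kernel_def)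
    show "kernel G ?P \<psi> \<subseteq> N"
    proof
      fix h assume "h \<in> kernel G ?P \<psi>"
      then have h: "h \<in> carrier G" "\<psi> h = \<one>\<^bsub>?P\<^esub>" by (auto simp: kernel_def)
      obtain w where w: "h = word_eval G \<phi> w" using words h(1) by blast
      then have "word_eq R w []" using h(2) by (simp add: ev presented_one word_class_eq_iff)
      then have "N #>\<^bsub>G\<^esub> h = N" using descends w N.coset_mult_one[OF N.subset] by fastforce
      then show "h \<in> N" using N.rcos_self[OF h(1)] N.is_subgroup by blast
    qed
  qed
qed

section \<open>The product of normal forms\<close>

text \<open>The residue of an integer modulo 3, as an exponent of a normal form.\<close>

definition res3 :: "int \<Rightarrow> nat"
  where "res3 i = nat (i mod 3)"

text \<open>
  The rewriting rule for two normal forms. Collection moves \<open>\<eta>\<^sub>3\<^sup>k\<close> past \<open>\<eta>\<^sub>1\<^sup>m \<eta>\<^sub>2\<^sup>n\<close> by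
  \<open>\<phi>(\<eta>\<^sub>3\<^sup>k)\<eta>\<^sub>1\<^sup>m = z\<^sub>1\<^sub>2\<^bsup>km(2-m)\<^esup> z\<^sub>2\<^sub>3\<^bsup>-k(k-1)m\<^esup> \<eta>\<^sub>1\<^sup>m \<eta>\<^sub>2\<^bsup>2km\<^esup>\<close> and \<open>\<phi>(\<eta>\<^sub>3\<^sup>k)\<eta>\<^sub>2\<^sup>n = z\<^sub>2\<^sub>3\<^bsup>-kn\<^esup> \<eta>\<^sub>2\<^sup>n\<close>,
  and \<open>\<eta>\<^sub>2\<^sup>h\<close> past \<open>\<eta>\<^sub>1\<^sup>m\<close> by \<open>\<eta>\<^sub>2\<^sup>h \<eta>\<^sub>1\<^sup>m = z\<^sub>1\<^sub>2\<^bsup>-hm\<^esup> \<eta>\<^sub>1\<^sup>m \<eta>\<^sub>2\<^sup>h\<close>.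
  The exponents are integer polynomials, and they define an associative product over the
  integers already, so reduction modulo 3 needs no case distinction.
\<close>

fun hmul :: "quintuple \<Rightarrow> quintuple \<Rightarrow> quintuple"
  where "hmul (b, c, g, h, k) (b', c', m, n, l) =
    (res3 (int b + int b' + int k * int m * (2 - int m) - int h * int m),
     res3 (int c + int c' - int k * (int k - 1) * int m - int k * int n),
     res3 (int g + int m),
     res3 (int h + int n + 2 * int k * int m),
     res3 (int k + int l))"

text \<open>The inverse, found by solving \<open>hmul x y = (0, 0, 0, 0, 0)\<close> from the last coordinate up.\<close>

fun hinv :: "quintuple \<Rightarrow> quintuple"
  where "hinv (b, c, g, h, k) =
    (res3 (int k * int g * (2 + int g) - int h * int g - int b),
     res3 (2 * int k * int k * int g - int k * (int k - 1) * int g - int k * int h - int c),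
     res3 (- int g),
     res3 (2 * int k * int g - int h),
     res3 (- int k))"

lemma int_res3 [simp]: "int (res3 i) = i mod 3"
  by (simp add: res3_def)

lemma res3_le [simp]: "res3 i \<le> 2"
  using pos_mod_bound[of 3 i] by (simp add: res3_def)

lemma res3_eq_iff: "res3 i = res3 j \<longleftrightarrow> i mod 3 = j mod 3"
  by (metis int_res3 res3_def)

lemma res3_int [simp]: "n \<le> 2 \<Longrightarrow> res3 (int n) = n"
  by (simp add: res3_def)

lemma in_H_set [simp]:
  "(b, c, g, h, k) \<in> H_set \<longleftrightarrow> b \<le> 2 \<and> c \<le> 2 \<and> g \<le> 2 \<and> h \<le> 2 \<and> k \<le> 2"
  by (simp add: H_set_def)

text \<open>
  Congruences modulo 3 between integer polynomials are turned into identities in the ring of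
  three elements, where ring normalization decides them.
\<close>

lemma of_int_mod_3 [simp]: "(of_int (i mod 3) :: 3) = of_int i"
  by (simp add: bit1.of_int_eq)

lemma three_times: "3 * (r :: 3) = 0"
proof -
  have "(3 :: 3) = of_int (3 mod 3)" by (simp only: of_int_mod_3 of_int_numeral)
  also have "\<dots> = 0" by (simp del: of_int_mod_3)
  finally show ?thesis by (simp only: mult_zero_left)
qed

lemma res3_eqI:
  assumes "(of_int i :: 3) = of_int j"
  shows "res3 i = res3 j"
proof -
  have "Abs_bit1 (i mod 3) = (Abs_bit1 (j mod 3) :: 3)"
    using assms by (simp add: bit1.of_int_eq)
  then have "i mod 3 = j mod 3"
    by (subst (asm) Abs_bit1_inject) (auto simp: )
  then show ?thesis by (simp add: res3_def)
qed

lemma hmul_closed: "hmul x y \<in> H_set"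
  by (cases x; cases y) simp

lemma hinv_closed: "hinv x \<in> H_set"
  by (cases x) simp

lemma hmul_assoc: "hmul (hmul x y) z = hmul x (hmul y z)"
proof -
  obtain b c g h k where x: "x = (b, c, g, h, k)" by (cases x)
  obtain b' c' g' h' k' where y: "y = (b', c', g', h', k')" by (cases y)
  obtain b'' c'' g'' h'' k'' where z: "z = (b'', c'', g'', h'', k'')" by (cases z)
  show ?thesis
    unfolding x y z
    by (simp only: hmul.simps prod.inject int_res3, intro conjI; rule res3_eqI)
      (simp_all add: algebra_simps)
qed

lemma hmul_one: "x \<in> H_set \<Longrightarrow> hmul (0, 0, 0, 0, 0) x = x"
  by (cases x) simp

lemma hmul_hinv: "hmul (hinv x) x = (0, 0, 0, 0, 0)"
proof -
  obtain b c g h k where x: "x = (b, c, g, h, k)" by (cases x)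
  have 0: "res3 i = 0" if "(of_int i :: 3) = of_int 0" for i
    using res3_eqI[OF that] by (simp add: res3_def)
  show ?thesis
    unfolding x
    by (simp only: hmul.simps hinv.simps prod.inject int_res3, intro conjI; rule 0)
      (simp_all add: algebra_simps)
qed

text \<open>The group of normal forms with the explicit product.\<close>

definition Hc :: "quintuple monoid"
  where "Hc = \<lparr> carrier = H_set, monoid.mult = hmul, one = (0, 0, 0, 0, 0) \<rparr>"

lemma Hc_simps [simp]:
  "carrier Hc = H_set" "x \<otimes>\<^bsub>Hc\<^esub> y = hmul x y" "\<one>\<^bsub>Hc\<^esub> = (0, 0, 0, 0, 0)"
  by (simp_all add: Hc_def)

lemma group_Hc: "group Hc"
proof (rule groupI)
  fix x assume "x \<in> carrier Hc"
  show "\<exists>y\<in>carrier Hc. y \<otimes>\<^bsub>Hc\<^esub> x = \<one>\<^bsub>Hc\<^esub>"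
    using hinv_closed hmul_hinv by (intro bexI[of _ "hinv x"]) auto
qed (use hmul_closed hmul_assoc hmul_one in auto)

lemma inv_Hc: "x \<in> H_set \<Longrightarrow> inv\<^bsub>Hc\<^esub> x = hinv x"
  using group.inv_equality[OF group_Hc, of "hinv x" x] by (simp add: hmul_hinv hinv_closed)

section \<open>Collection in a group satisfying the relations\<close>

text \<open>
  Elements \<open>p, q\<close> (for \<open>z\<^sub>1\<^sub>2, z\<^sub>2\<^sub>3\<close>) and \<open>x, u, y\<close> (for \<open>\<eta>\<^sub>1, \<eta>\<^sub>2, \<eta>\<^sub>3\<close>) of a group that satisfy
  the part of the fundamental relations that collection uses. The inverses of \<open>z\<^sub>1\<^sub>2\<close> and \<open>z\<^sub>2\<^sub>3\<close>
  are written as squares.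
\<close>

locale H_sys = group G for G (structure) +
  fixes p q x u y
  assumes cl [simp]: "p \<in> carrier G" "q \<in> carrier G" "x \<in> carrier G" "u \<in> carrier G" "y \<in> carrier G"
    and pq: "q \<otimes> p = p \<otimes> q"
    and xp: "x \<otimes> p = p \<otimes> x" and xq: "x \<otimes> q = q \<otimes> x"
    and up: "u \<otimes> p = p \<otimes> u" and uq: "u \<otimes> q = q \<otimes> u"
    and yp: "y \<otimes> p = p \<otimes> y" and yq: "y \<otimes> q = q \<otimes> y"
    and p3: "p \<otimes> (p \<otimes> p) = \<one>" and q3: "q \<otimes> (q \<otimes> q) = \<one>"
    and x3: "x \<otimes> (x \<otimes> x) = \<one>" and u3: "u \<otimes> (u \<otimes> u) = \<one>" and y3: "y \<otimes> (y \<otimes> y) = \<one>"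
    and ux: "u \<otimes> x = p \<otimes> (p \<otimes> (x \<otimes> u))"
    and yx: "y \<otimes> x = p \<otimes> (x \<otimes> (u \<otimes> (u \<otimes> y)))"
    and yu: "y \<otimes> u = q \<otimes> (q \<otimes> (u \<otimes> y))"
begin

text \<open>
  Powers of an element of order dividing 3, with exponents in the integers. With them collection
  is a computation with polynomial exponents.
\<close>

definition pw :: "'a \<Rightarrow> int \<Rightarrow> 'a"
  where "pw a i = a [^] res3 i"

lemma pw_closed [simp]: "a \<in> carrier G \<Longrightarrow> pw a i \<in> carrier G"
  by (simp add: pw_def)

lemma res3_cases: "res3 i = 0 \<or> res3 i = 1 \<or> res3 i = 2"
  using res3_le[of i] by linarith

lemma pw_0: "pw a 0 = \<one>" and pw_1: "a \<in> carrier G \<Longrightarrow> pw a 1 = a"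
  by (simp_all add: pw_def res3_def)

lemma pw_eqI: "(of_int i :: 3) = of_int j \<Longrightarrow> pw a i = pw a j"
  unfolding pw_def by (drule res3_eqI) simp

lemma pow_res3:
  assumes "a \<otimes> (a \<otimes> a) = \<one>" "a \<in> carrier G"
  shows "a [^] res3 (int n) = a [^] n"
proof -
  have "a [^] (3::nat) = \<one>" using assms by (simp add: numeral_3_eq_3 m_assoc)
  then have "a [^] (3 * (n div 3)) = \<one>" using assms(2) by (simp add: nat_pow_pow[symmetric])
  moreover have "a [^] n = a [^] (3 * (n div 3)) \<otimes> a [^] (n mod 3)"
    using assms(2) by (simp add: nat_pow_mult)
  ultimately show ?thesis using assms(2) by (simp add: res3_def nat_mod_distrib)
qed

lemma pw_add:
  assumes "a \<otimes> (a \<otimes> a) = \<one>" "a \<in> carrier G"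
  shows "pw a i \<otimes> pw a j = pw a (i + j)"
proof -
  have "pw a i \<otimes> pw a j = a [^] (res3 i + res3 j)"
    using assms(2) by (simp add: pw_def nat_pow_mult)
  also have "\<dots> = a [^] res3 (int (res3 i + res3 j))"
    by (rule pow_res3[OF assms, symmetric])
  also have "\<dots> = pw a (i + j)"
    by (simp add: pw_def res3_def mod_simps)
  finally show ?thesis .
qed

lemma pw_comm:
  assumes "a \<otimes> b = b \<otimes> a" "a \<in> carrier G" "b \<in> carrier G"
  shows "pw a i \<otimes> pw b j = pw b j \<otimes> pw a i"
  unfolding pw_def
  by (rule group_commutes_pow[OF group_commutes_pow[OF assms(1), symmetric], symmetric]) (use assms in auto)

lemma assoc_rule:
  assumes "a \<otimes> b = c" "a \<in> carrier G" "b \<in> carrier G" "d \<in> carrier G"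
  shows "a \<otimes> (b \<otimes> d) = c \<otimes> d"
  using assms m_assoc by metis

text \<open>The subgroup generated by \<open>p\<close> and \<open>q\<close> is moved to the left, with \<open>p\<close> first.\<close>

lemma comm_rules:
  "d \<in> carrier G \<Longrightarrow> pw q i \<otimes> (pw p j \<otimes> d) = pw p j \<otimes> (pw q i \<otimes> d)"
  "d \<in> carrier G \<Longrightarrow> pw x i \<otimes> (pw p j \<otimes> d) = pw p j \<otimes> (pw x i \<otimes> d)"
  "d \<in> carrier G \<Longrightarrow> pw x i \<otimes> (pw q j \<otimes> d) = pw q j \<otimes> (pw x i \<otimes> d)"
  "d \<in> carrier G \<Longrightarrow> pw u i \<otimes> (pw p j \<otimes> d) = pw p j \<otimes> (pw u i \<otimes> d)"
  "d \<in> carrier G \<Longrightarrow> pw u i \<otimes> (pw q j \<otimes> d) = pw q j \<otimes> (pw u i \<otimes> d)"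
  "d \<in> carrier G \<Longrightarrow> pw y i \<otimes> (pw p j \<otimes> d) = pw p j \<otimes> (pw y i \<otimes> d)"
  "d \<in> carrier G \<Longrightarrow> pw y i \<otimes> (pw q j \<otimes> d) = pw q j \<otimes> (pw y i \<otimes> d)"
  by (simp_all add: m_assoc[symmetric] pw_comm[OF pq] pw_comm[OF xp] pw_comm[OF xq]
      pw_comm[OF up] pw_comm[OF uq] pw_comm[OF yp] pw_comm[OF yq])

lemma add_rules:
  "d \<in> carrier G \<Longrightarrow> pw p i \<otimes> (pw p j \<otimes> d) = pw p (i + j) \<otimes> d"
  "d \<in> carrier G \<Longrightarrow> pw q i \<otimes> (pw q j \<otimes> d) = pw q (i + j) \<otimes> d"
  "d \<in> carrier G \<Longrightarrow> pw x i \<otimes> (pw x j \<otimes> d) = pw x (i + j) \<otimes> d"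
  "d \<in> carrier G \<Longrightarrow> pw u i \<otimes> (pw u j \<otimes> d) = pw u (i + j) \<otimes> d"
  "pw y i \<otimes> pw y j = pw y (i + j)"
  by (simp_all add: m_assoc[symmetric] pw_add[OF p3] pw_add[OF q3] pw_add[OF x3] pw_add[OF u3]
      pw_add[OF y3])

lemma ux_rule:
  assumes d: "d \<in> carrier G"
  shows "pw u 1 \<otimes> (pw x m \<otimes> d) = pw p (- m) \<otimes> (pw x m \<otimes> (pw u 1 \<otimes> d))"
proof -
  have 1: "u \<otimes> (x \<otimes> e) = pw p 2 \<otimes> (x \<otimes> (u \<otimes> e))" if "e \<in> carrier G" for e
    using assoc_rule[OF ux _ _ that] that by (simp add: m_assoc pw_def res3_def numeral_2_eq_2)
  have 2: "x \<otimes> (pw p j \<otimes> e) = pw p j \<otimes> (x \<otimes> e)" if "e \<in> carrier G" for e j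
    using comm_rules(2)[OF that, of 1 j] by (simp add: pw_1)
  \<comment> \<open>With the exponent \<open>2m\<close> in place of \<open>-m\<close>, each case has a nonnegative exponent to expand.\<close>
  have m3: "pw p (- m) = pw p (2 * int (res3 m))"
    by (rule pw_eqI) (simp add: three_times)
  from res3_cases[of m] show ?thesis
    unfolding m3 using d
    by (elim disjE; simp add: pw_def[of x] pw_1 pw_0 numeral_2_eq_2 m_assoc 1 2 add_rules pw_eqI[of 4 1])
qed

lemma yu_rule:
  assumes d: "d \<in> carrier G"
  shows "pw y 1 \<otimes> (pw u n \<otimes> d) = pw q (- n) \<otimes> (pw u n \<otimes> (pw y 1 \<otimes> d))"
proof -
  have 1: "y \<otimes> (u \<otimes> e) = pw q 2 \<otimes> (u \<otimes> (y \<otimes> e))" if "e \<in> carrier G" for e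
    using assoc_rule[OF yu _ _ that] that by (simp add: m_assoc pw_def res3_def numeral_2_eq_2)
  have 2: "u \<otimes> (pw q j \<otimes> e) = pw q j \<otimes> (u \<otimes> e)" if "e \<in> carrier G" for e j
    using comm_rules(5)[OF that, of 1 j] by (simp add: pw_1)
  have m3: "pw q (- n) = pw q (2 * int (res3 n))"
    by (rule pw_eqI) (simp add: three_times)
  from res3_cases[of n] show ?thesis
    unfolding m3 using d
    by (elim disjE; simp add: pw_def[of u] pw_1 pw_0 numeral_2_eq_2 m_assoc 1 2 add_rules pw_eqI[of 4 1])
qed

lemma yx_rule:
  assumes d: "d \<in> carrier G"
  shows "pw y 1 \<otimes> (pw x m \<otimes> d) = pw p (m * (2 - m)) \<otimes> (pw x m \<otimes> (pw u (2 * m) \<otimes> (pw y 1 \<otimes> d)))"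
proof -
  have *: "pw y 1 \<otimes> (pw x 1 \<otimes> e) = pw p 1 \<otimes> (pw x 1 \<otimes> (pw u 2 \<otimes> (pw y 1 \<otimes> e)))"
    if "e \<in> carrier G" for e
    using assoc_rule[OF yx _ _ that] that
    by (simp add: m_assoc pw_1) (simp add: pw_def res3_def numeral_2_eq_2 m_assoc)
  have uu: "pw u 2 \<otimes> (pw x 1 \<otimes> e) = pw p (- 2) \<otimes> (pw x 1 \<otimes> (pw u 2 \<otimes> e))"
    if "e \<in> carrier G" for e
  proof -
    have "pw u 2 \<otimes> (pw x 1 \<otimes> e) = pw u 1 \<otimes> (pw u 1 \<otimes> (pw x 1 \<otimes> e))"
      using that by (simp add: add_rules)
    then show ?thesis using that by (simp add: ux_rule comm_rules add_rules)
  qed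
  have m3: "pw p (m * (2 - m)) = pw p (int (res3 m) * (2 - int (res3 m)))"
    "pw u (2 * m) = pw u (2 * int (res3 m))" "pw x m = pw x (int (res3 m))"
    by (auto intro!: pw_eqI)
  from res3_cases[of m] show ?thesis
  proof (elim disjE)
    assume m: "res3 m = 2"
    have "pw y 1 \<otimes> (pw x 2 \<otimes> d) = pw y 1 \<otimes> (pw x 1 \<otimes> (pw x 1 \<otimes> d))"
      using d by (simp add: add_rules)
    also have "\<dots> = pw p 1 \<otimes> (pw x 1 \<otimes> (pw u 2 \<otimes> (pw p 1 \<otimes> (pw x 1 \<otimes> (pw u 2 \<otimes> (pw y 1 \<otimes> d))))))"
      using d by (simp add: * )
    also have "\<dots> = pw p 0 \<otimes> (pw x 2 \<otimes> (pw u 4 \<otimes> (pw y 1 \<otimes> d)))"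
      using d by (simp add: comm_rules add_rules uu)
    finally show ?thesis by (simp add: m3 m)
  qed (use d in \<open>simp_all add: m3 pw_0 * \<close>)
qed

text \<open>The normal form with the given exponents, evaluated in the group.\<close>

definition N :: "quintuple \<Rightarrow> 'a"
  where "N = (\<lambda>(b, c, g, h, k). p [^] b \<otimes> (q [^] c \<otimes> (x [^] g \<otimes> (u [^] h \<otimes> y [^] k))))"

lemma N_closed [simp]: "N h \<in> carrier G"
  by (cases h) (simp add: N_def)

lemma N_res3:
  "N (res3 b, res3 c, res3 g, res3 h, res3 k) = pw p b \<otimes> (pw q c \<otimes> (pw x g \<otimes> (pw u h \<otimes> pw y k)))"
  by (simp add: N_def pw_def)

text \<open>Left multiplication by each generator agrees with \<open>hmul\<close>.\<close>

lemma N_step: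
  assumes h: "h \<in> H_set"
  shows "p \<otimes> N h = N (hmul z12 h)" and "q \<otimes> N h = N (hmul z23 h)"
    and "x \<otimes> N h = N (hmul eta1 h)" and "u \<otimes> N h = N (hmul eta2 h)"
    and "y \<otimes> N h = N (hmul eta3 h)"
proof -
  obtain b c m n l where d: "h = (res3 (int b), res3 (int c), res3 (int m), res3 (int n), res3 (int l))"
    using h that[of "fst h" "fst (snd h)" "fst (snd (snd h))" "fst (snd (snd (snd h)))" "snd (snd (snd (snd h)))"]
    by (cases h) simp
  have p1: "p = pw p 1" "q = pw q 1" "x = pw x 1" "u = pw u 1" "y = pw y 1"
    by (simp_all add: pw_1)
  note rules = hmul.simps N_res3 z12_def z23_def eta1_def eta2_def eta3_def
    comm_rules add_rules ux_rule yu_rule yx_rule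
  show "p \<otimes> N h = N (hmul z12 h)" unfolding d
    by (subst p1) (simp add: rules, (intro arg_cong2[where f="(\<otimes>)"] pw_eqI HOL.refl)?; simp add: algebra_simps)
  show "q \<otimes> N h = N (hmul z23 h)" unfolding d
    by (subst p1) (simp add: rules, (intro arg_cong2[where f="(\<otimes>)"] pw_eqI HOL.refl)?; simp add: algebra_simps)
  show "x \<otimes> N h = N (hmul eta1 h)" unfolding d
    by (subst p1) (simp add: rules, (intro arg_cong2[where f="(\<otimes>)"] pw_eqI HOL.refl)?; simp add: algebra_simps)
  show "u \<otimes> N h = N (hmul eta2 h)" unfolding d
    by (subst p1) (simp add: rules, (intro arg_cong2[where f="(\<otimes>)"] pw_eqI HOL.refl)?; simp add: algebra_simps)
  show "y \<otimes> N h = N (hmul eta3 h)" unfolding d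
    by (subst p1) (simp add: rules, (intro arg_cong2[where f="(\<otimes>)"] pw_eqI HOL.refl)?; simp add: algebra_simps)
qed

end

lemma Hc_pow:
  "z12 [^]\<^bsub>Hc\<^esub> n = (res3 (int n), 0, 0, 0, 0)" "z23 [^]\<^bsub>Hc\<^esub> n = (0, res3 (int n), 0, 0, 0)"
  "eta1 [^]\<^bsub>Hc\<^esub> n = (0, 0, res3 (int n), 0, 0)" "eta2 [^]\<^bsub>Hc\<^esub> n = (0, 0, 0, res3 (int n), 0)"
  "eta3 [^]\<^bsub>Hc\<^esub> n = (0, 0, 0, 0, res3 (int n))"
proof -
  interpret group Hc by (rule group_Hc)
  have [simp]: "res3 (i mod 3 + 1) = res3 (1 + i)" "res3 0 = 0" for i
    by (simp_all add: res3_def mod_simps add.commute)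
  show
    "z12 [^]\<^bsub>Hc\<^esub> n = (res3 (int n), 0, 0, 0, 0)" "z23 [^]\<^bsub>Hc\<^esub> n = (0, res3 (int n), 0, 0, 0)"
    "eta1 [^]\<^bsub>Hc\<^esub> n = (0, 0, res3 (int n), 0, 0)" "eta2 [^]\<^bsub>Hc\<^esub> n = (0, 0, 0, res3 (int n), 0)"
    "eta3 [^]\<^bsub>Hc\<^esub> n = (0, 0, 0, 0, res3 (int n))"
    by (induction n) (simp_all add: z12_def z23_def eta1_def eta2_def eta3_def)
qed

lemma generators_in_H_set [simp]:
  "z12 \<in> H_set" "z23 \<in> H_set" "eta1 \<in> H_set" "eta2 \<in> H_set" "eta3 \<in> H_set"
  by (simp_all add: z12_def z23_def eta1_def eta2_def eta3_def)

lemma normal_form: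
  assumes "(b, c, g, h, k) \<in> H_set"
  shows "(b, c, g, h, k) = hmul (z12 [^]\<^bsub>Hc\<^esub> b) (hmul (z23 [^]\<^bsub>Hc\<^esub> c)
    (hmul (eta1 [^]\<^bsub>Hc\<^esub> g) (hmul (eta2 [^]\<^bsub>Hc\<^esub> h) (eta3 [^]\<^bsub>Hc\<^esub> k))))"
  using assms by (simp add: Hc_pow)

interpretation Hc: H_sys Hc z12 z23 eta1 eta2 eta3
  by (intro H_sys.intro group_Hc H_sys_axioms.intro)
    (simp_all add: z12_def z23_def eta1_def eta2_def eta3_def res3_def)

lemma N_Hc: "h \<in> H_set \<Longrightarrow> Hc.N h = h"
  by (cases h) (simp add: Hc.N_def Hc_pow)

context H_sys
begin

text \<open>
  The agreement extends from the generators to all normal forms, because every quintuple is the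
  \<open>hmul\<close>-product of its normal word and \<open>hmul\<close> is associative.
\<close>

theorem N_hmul:
  assumes h: "h \<in> H_set" and h': "h' \<in> H_set"
  shows "N (hmul h h') = N h \<otimes> N h'"
proof -
  have pow: "N (hmul (s [^]\<^bsub>Hc\<^esub> n) e) = t [^] n \<otimes> N e"
    if "s \<in> H_set" "t \<in> carrier G" "\<And>e. e \<in> H_set \<Longrightarrow> t \<otimes> N e = N (hmul s e)" "e \<in> H_set"
    for s t e and n :: nat
    using that(4)
  proof (induction n arbitrary: e)
    case 0
    then show ?case by (simp add: hmul_one)
  next
    case (Suc n)
    have "N (hmul (s [^]\<^bsub>Hc\<^esub> Suc n) e) = N (hmul (s [^]\<^bsub>Hc\<^esub> n) (hmul s e))"
      by (simp add: hmul_assoc)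
    also have "\<dots> = t [^] n \<otimes> (t \<otimes> N e)"
      using Suc hmul_closed that(3) by simp
    finally show ?case using that(2) by (simp add: m_assoc)
  qed
  note pows = pow[of z12 p, OF _ _ N_step(1)] pow[of z23 q, OF _ _ N_step(2)]
    pow[of eta1 x, OF _ _ N_step(3)] pow[of eta2 u, OF _ _ N_step(4)] pow[of eta3 y, OF _ _ N_step(5)]
  obtain b c g e k where d: "h = (b, c, g, e, k)" by (cases h)
  have "N (hmul h h') = p [^] b \<otimes> (q [^] c \<otimes> (x [^] g \<otimes> (u [^] e \<otimes> (y [^] k \<otimes> N h'))))"
    using h h' unfolding d
    by (subst normal_form) (simp_all add: hmul_assoc pows hmul_closed)
  also have "\<dots> = N h \<otimes> N h'"
    using N_closed[of h'] by (simp add: d N_def[THEN fun_cong, of "(b, c, g, e, k)"] m_assoc)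
  finally show ?thesis .
qed

lemma N_generators:
  "N z12 = p" "N z23 = q" "N eta1 = x" "N eta2 = u" "N eta3 = y"
  by (simp_all add: N_def z12_def z23_def eta1_def eta2_def eta3_def)

lemma N_eval:
  assumes "\<phi> Z12 = p" "\<phi> Z23 = q" "\<phi> E1 = x" "\<phi> E2 = u" "\<phi> E3 = y"
  shows "word_eval G \<phi> (normal_word h) = N h"
proof -
  have "\<phi> c \<in> carrier G" for c using assms by (cases c) simp_all
  then show ?thesis
    using assms by (cases h) (simp add: N_def word_eval_simps)
qed

end

section \<open>The system H is a group\<close>

text \<open>The generators as quintuples.\<close>

fun H_gens :: "Hgen \<Rightarrow> quintuple"
  where "H_gens Z12 = z12" | "H_gens Z23 = z23" | "H_gens E1 = eta1" | "H_gens E2 = eta2"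
  | "H_gens E3 = eta3"

lemma H_gens_closed: "H_gens c \<in> H_set"
  by (cases c) simp_all

lemma H_rels_Hc:
  assumes "(v, w) \<in> H_rels"
  shows "word_eval Hc H_gens v = word_eval Hc H_gens w"
proof -
  have cl: "\<And>c. H_gens c \<in> carrier Hc" by (simp add: H_gens_closed)
  have com: "hmul z12 (H_gens d) = hmul (H_gens d) z12" "hmul z23 (H_gens d) = hmul (H_gens d) z23" for d
    by (cases d; simp add: z12_def z23_def eta1_def eta2_def eta3_def)+
  have pow: "a [^]\<^bsub>Hc\<^esub> (2::nat) = hmul a a" "a [^]\<^bsub>Hc\<^esub> (3::nat) = hmul a (hmul a a)" if "a \<in> H_set" for a
    using that by (simp_all add: numeral_2_eq_2 numeral_3_eq_3 hmul_one hmul_assoc)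
  have central: "word_eval Hc H_gens v = word_eval Hc H_gens w"
    if "(v, w) \<in> {(gen c @ gen d, gen d @ gen c) | c d. c \<in> {Z12, Z23}}"
    using that by (auto simp: Hc.word_eval_simps[of H_gens, OF cl] com)
  show ?thesis
    using assms unfolding H_rels_def Let_def
    apply (elim UnE)
     apply (erule central)
    apply (simp only: insert_iff empty_iff prod.inject simp_thms)
    apply (elim disjE conjE)
    apply (simp_all only: Hc.word_eval_simps[of H_gens, OF cl] word_eval_Nil H_gens.simps Hc_simps)
    apply (simp_all add: z12_def z23_def eta1_def eta2_def eta3_def)
    apply (simp_all add: pow inv_Hc)
    apply (simp_all add: res3_def)
    done
qed

lemma H_rels_mem:
  "c \<in> {Z12, Z23} \<Longrightarrow> (gen c @ gen d, gen d @ gen c) \<in> H_rels"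
  "(wpow (gen d) 3, []) \<in> H_rels"
  "(gen E2 @ gen E1, winv (gen Z12) @ gen E1 @ gen E2) \<in> H_rels"
  "(wconj (gen E3) (gen E1), gen Z12 @ gen E1 @ wpow (gen E2) 2) \<in> H_rels"
  "(wconj (gen E3) (gen E2), wpow (gen Z23) 2 @ gen E2) \<in> H_rels"
      apply (unfold H_rels_def Let_def)
      apply (rule UnI1, blast)
     apply (rule UnI2, cases d; simp only: insert_iff simp_thms)
  by (rule UnI2, simp only: insert_iff simp_thms)+

lemma H_sys_presented:
  "H_sys (presented_group H_rels) (word_class H_rels (gen Z12)) (word_class H_rels (gen Z23))
    (word_class H_rels (gen E1)) (word_class H_rels (gen E2)) (word_class H_rels (gen E3))"
proof -
  let ?P = "presented_group H_rels" and ?g = "\<lambda>c. word_class H_rels (gen c)"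
  interpret P: group ?P by (rule group_presented_group)
  have cl: "\<And>c. ?g c \<in> carrier ?P" by simp
  note ev = P.word_eval_simps[of ?g, OF cl]
  have com: "?g d \<otimes>\<^bsub>?P\<^esub> ?g c = ?g c \<otimes>\<^bsub>?P\<^esub> ?g d" if "c \<in> {Z12, Z23}" for c d
    using presented_rel[OF H_rels_mem(1)[OF that]] by (simp only: ev)
  have com12: "?g d \<otimes>\<^bsub>?P\<^esub> ?g Z12 = ?g Z12 \<otimes>\<^bsub>?P\<^esub> ?g d"
    and com23: "?g d \<otimes>\<^bsub>?P\<^esub> ?g Z23 = ?g Z23 \<otimes>\<^bsub>?P\<^esub> ?g d" for d
    by (rule com, simp)+
  have cube: "?g c \<otimes>\<^bsub>?P\<^esub> (?g c \<otimes>\<^bsub>?P\<^esub> ?g c) = \<one>\<^bsub>?P\<^esub>" for c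
  proof -
    show ?thesis using presented_rel[OF H_rels_mem(2)] by (simp add: ev numeral_3_eq_3 P.m_assoc)
  qed
  have invz: "inv\<^bsub>?P\<^esub> ?g c = ?g c \<otimes>\<^bsub>?P\<^esub> ?g c" for c
    using cube P.inv_equality P.m_assoc cl P.m_closed by metis
  have conj: "a \<otimes>\<^bsub>?P\<^esub> b = c \<otimes>\<^bsub>?P\<^esub> a"
    if "a \<otimes>\<^bsub>?P\<^esub> b \<otimes>\<^bsub>?P\<^esub> inv\<^bsub>?P\<^esub> a = c" "a \<in> carrier ?P" "b \<in> carrier ?P" for a b c
    using that by (auto simp: P.m_assoc)
  have ux: "?g E2 \<otimes>\<^bsub>?P\<^esub> ?g E1 = inv\<^bsub>?P\<^esub> ?g Z12 \<otimes>\<^bsub>?P\<^esub> (?g E1 \<otimes>\<^bsub>?P\<^esub> ?g E2)"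
    using presented_rel[OF H_rels_mem(3)] by (simp only: ev)
  have yx: "?g E3 \<otimes>\<^bsub>?P\<^esub> ?g E1
      = ?g Z12 \<otimes>\<^bsub>?P\<^esub> (?g E1 \<otimes>\<^bsub>?P\<^esub> ?g E2 [^]\<^bsub>?P\<^esub> (2::nat)) \<otimes>\<^bsub>?P\<^esub> ?g E3"
    using presented_rel[OF H_rels_mem(4)] by (intro conj) (simp_all only: ev cl)
  have yu: "?g E3 \<otimes>\<^bsub>?P\<^esub> ?g E2 = ?g Z23 [^]\<^bsub>?P\<^esub> (2::nat) \<otimes>\<^bsub>?P\<^esub> ?g E2 \<otimes>\<^bsub>?P\<^esub> ?g E3"
    using presented_rel[OF H_rels_mem(5)] by (intro conj) (simp_all only: ev cl)
  show ?thesis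
    by (intro H_sys.intro P.group_axioms H_sys_axioms.intro)
      ((rule cl | rule com12 | rule com23 | rule cube |
        simp add: ux yx yu invz numeral_2_eq_2 P.m_assoc)+)
qed

text \<open>
  Existence of the rewriting is collection in the presented group; uniqueness holds because distinct
  quintuples are values of their normal words in the concrete group \<open>Hc\<close>, where the relations hold.
\<close>

lemma is_H_product_iff:
  assumes "h \<in> H_set" "h' \<in> H_set"
  shows "is_H_product h h' q \<longleftrightarrow> q = hmul h h'"
proof
  assume "q = hmul h h'"
  interpret P: H_sys "presented_group H_rels" "word_class H_rels (gen Z12)" "word_class H_rels (gen Z23)"
    "word_class H_rels (gen E1)" "word_class H_rels (gen E2)" "word_class H_rels (gen E3)"
    by (rule H_sys_presented)
  have N: "P.N e = word_class H_rels (normal_word e)" for e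
    unfolding word_class_eval[of H_rels "normal_word e"] by (rule P.N_eval[symmetric]) simp_all
  have "word_class H_rels (normal_word h @ normal_word h') = word_class H_rels (normal_word (hmul h h'))"
    using P.N_hmul[OF assms] by (simp add: N presented_mult)
  then show "is_H_product h h' q"
    using hmul_closed \<open>q = hmul h h'\<close> by (simp add: is_H_product_def word_class_eq_iff)
next
  assume q: "is_H_product h h' q"
  have cl: "\<And>c. H_gens c \<in> carrier Hc" by (simp add: H_gens_closed)
  have N: "word_eval Hc H_gens (normal_word e) = e" if "e \<in> H_set" for e
    using N_Hc[OF that] by (simp add: Hc.N_eval)
  have "word_eval Hc H_gens (normal_word h @ normal_word h') = word_eval Hc H_gens (normal_word q)"
    using q Hc.word_eq_sound[OF _ cl H_rels_Hc] unfolding is_H_product_def by blast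
  then show "q = hmul h h'"
    using q N assms by (simp add: Hc.word_eval_append[of H_gens, OF cl] is_H_product_def)
qed

lemma carrier_H [simp]: "carrier H = H_set" and one_H [simp]: "\<one>\<^bsub>H\<^esub> = (0, 0, 0, 0, 0)"
  by (simp_all add: H_def)

lemma mult_H [simp]: "h \<in> H_set \<Longrightarrow> h' \<in> H_set \<Longrightarrow> h \<otimes>\<^bsub>H\<^esub> h' = hmul h h'"
  by (simp add: H_def) (rule the_equality; simp add: is_H_product_iff)

lemma group_H: "group H"
proof (rule groupI)
  fix x assume "x \<in> carrier H"
  then show "\<exists>y\<in>carrier H. y \<otimes>\<^bsub>H\<^esub> x = \<one>\<^bsub>H\<^esub>"
    using hinv_closed hmul_hinv by (intro bexI[of _ "hinv x"]) auto
qed (auto simp: hmul_closed hmul_assoc hmul_one)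

interpretation H: group H by (rule group_H)

lemma inv_H [simp]: "x \<in> H_set \<Longrightarrow> inv\<^bsub>H\<^esub> x = hinv x"
  by (intro H.inv_equality) (simp_all add: hmul_hinv hinv_closed)

lemma order_H: "order H = 243"
  by (simp add: order_def H_set_def card_cartesian_product)

lemma finite_H_set: "finite H_set"
  by (simp add: H_set_def)

lemma (in H_sys) N_hom: "N \<in> hom H G"
  by (rule homI) (simp_all add: N_hmul)

section \<open>The universal property of H\<close>

lemma commutator_values:
  "eta1 \<otimes>\<^bsub>H\<^esub> eta3 \<otimes>\<^bsub>H\<^esub> inv\<^bsub>H\<^esub> eta1 \<otimes>\<^bsub>H\<^esub> inv\<^bsub>H\<^esub> eta3 = eta2"
  "eta1 \<otimes>\<^bsub>H\<^esub> eta2 \<otimes>\<^bsub>H\<^esub> inv\<^bsub>H\<^esub> eta1 \<otimes>\<^bsub>H\<^esub> inv\<^bsub>H\<^esub> eta2 = z12"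
  "eta2 \<otimes>\<^bsub>H\<^esub> eta3 \<otimes>\<^bsub>H\<^esub> inv\<^bsub>H\<^esub> eta2 \<otimes>\<^bsub>H\<^esub> inv\<^bsub>H\<^esub> eta3 = z23"
  by (simp_all add: hmul_closed hinv_closed)
    (simp_all add: z12_def z23_def eta1_def eta2_def eta3_def res3_def)

text \<open>A subgroup contains a normal form if it contains the generators that occur in it.\<close>

lemma generate_normal_form:
  assumes S: "subgroup S H" and "b = 0 \<or> z12 \<in> S" "c = 0 \<or> z23 \<in> S"
    and "g = 0 \<or> eta1 \<in> S" "h = 0 \<or> eta2 \<in> S" "k = 0 \<or> eta3 \<in> S"
    and le: "(b, c, g, h, k) \<in> H_set"
  shows "(b, c, g, h, k) \<in> S"
proof -
  interpret S: subgroup S H by fact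
  have pow: "e [^]\<^bsub>Hc\<^esub> n \<in> S \<and> e [^]\<^bsub>Hc\<^esub> n \<in> H_set" if "e \<in> S" for e and n :: nat
  proof (induction n)
    case (Suc n)
    have "e \<in> H_set" using that S.subset by auto
    then show ?case using Suc S.m_closed[of "e [^]\<^bsub>Hc\<^esub> n" e] that hmul_closed by auto
  qed (use S.one_closed in simp)
  have pow0: "e [^]\<^bsub>Hc\<^esub> n \<in> S \<and> e [^]\<^bsub>Hc\<^esub> n \<in> H_set" if "n = 0 \<or> e \<in> S" for e and n :: nat
    using pow[of e n] that S.one_closed by auto
  have mult: "hmul e f \<in> S \<and> hmul e f \<in> H_set" if "e \<in> S \<and> e \<in> H_set" "f \<in> S \<and> f \<in> H_set" for e f
    using S.m_closed[of e f] that hmul_closed by auto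
  show ?thesis
    unfolding normal_form[OF le] using assms pow pow0 mult by (metis (no_types))
qed

lemma generate_H: "generate H {eta1, eta3} = carrier H"
proof
  show "generate H {eta1, eta3} \<subseteq> carrier H" by (intro H.generate_incl) simp
  have S: "subgroup (generate H {eta1, eta3}) H" by (intro H.generate_is_subgroup) simp
  interpret S: subgroup "generate H {eta1, eta3}" H by fact
  have g: "eta1 \<in> generate H {eta1, eta3}" "eta3 \<in> generate H {eta1, eta3}"
    by (auto intro: generate.incl)
  then have g2: "eta2 \<in> generate H {eta1, eta3}"
    using S.m_closed S.m_inv_closed commutator_values(1) by metis
  then have "z12 \<in> generate H {eta1, eta3}" "z23 \<in> generate H {eta1, eta3}"
    using g S.m_closed S.m_inv_closed commutator_values(2,3) by metis+
  then show "carrier H \<subseteq> generate H {eta1, eta3}"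
    using generate_normal_form[OF S] g g2 by auto
qed

lemma hom_H_eqI:
  assumes "group K" "\<phi> \<in> hom H K" "\<psi> \<in> hom H K" "\<phi> eta1 = \<psi> eta1" "\<phi> eta3 = \<psi> eta3" "h \<in> H_set"
  shows "\<phi> h = \<psi> h"
proof -
  interpret \<phi>: group_hom H K \<phi>
    using assms by (simp add: group_hom_def group_hom_axioms_def group_H)
  interpret \<psi>: group_hom H K \<psi>
    using assms by (simp add: group_hom_def group_hom_axioms_def group_H)
  have sub: "generate H {eta1, eta3} \<subseteq> carrier H" using generate_H by simp
  have "h \<in> generate H {eta1, eta3}" using assms generate_H by simp
  then show ?thesis
  proof induction
    case (inv h)
    then have "h \<in> carrier H" "\<phi> h = \<psi> h" using assms by auto
    then show ?case by (metis \<phi>.hom_inv \<psi>.hom_inv)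
  next
    case (eng h1 h2)
    then have "h1 \<in> carrier H" "h2 \<in> carrier H" using sub by auto
    then show ?case using eng \<phi>.hom_mult \<psi>.hom_mult by metis
  qed (use assms \<phi>.hom_one \<psi>.hom_one in auto)
qed

lemma (in group) commute_inv:
  assumes "c \<otimes> a = a \<otimes> c" "a \<in> carrier G" "c \<in> carrier G"
  shows "c \<otimes> inv a = inv a \<otimes> c"
  using assms by (metis inv_closed inv_solve_left inv_solve_right m_assoc m_closed)

text \<open>
  For elements \<open>x, y\<close> of order dividing 3 put
  \<open>v = x\<inverse>yxy\<inverse>\<close>. If \<open>[v,x]\<close> and \<open>[y,v]\<close> commute with \<open>x\<close> and \<open>y\<close>, then their cubes vanish, and
  conjugating \<open>x\<^sup>3 = 1\<close> by \<open>y\<close> gives \<open>v\<^sup>3 = 1\<close>. Hence \<open>[v,x]\<close>, \<open>[y,v]\<close> and \<open>u = [v,x]v\<^sup>2\<close> can be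
  taken for \<open>z\<^sub>1\<^sub>2\<close>, \<open>z\<^sub>2\<^sub>3\<close> and \<open>\<eta>\<^sub>2\<close>.
\<close>

lemma (in group) H_sys_of_pair:
  fixes x y
  defines "v \<equiv> inv x \<otimes> y \<otimes> x \<otimes> inv y"
  defines "\<alpha> \<equiv> v \<otimes> x \<otimes> inv v \<otimes> inv x" and "\<beta> \<equiv> y \<otimes> v \<otimes> inv y \<otimes> inv v"
  assumes cl [simp]: "x \<in> carrier G" "y \<in> carrier G"
    and x3: "x \<otimes> (x \<otimes> x) = \<one>" and y3: "y \<otimes> (y \<otimes> y) = \<one>"
    and \<alpha>: "x \<otimes> \<alpha> = \<alpha> \<otimes> x" "y \<otimes> \<alpha> = \<alpha> \<otimes> y" and \<beta>: "x \<otimes> \<beta> = \<beta> \<otimes> x" "y \<otimes> \<beta> = \<beta> \<otimes> y"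
  shows "H_sys G \<alpha> \<beta> x (\<alpha> \<otimes> (v \<otimes> v)) y"
proof -
  have [simp]: "v \<in> carrier G" "\<alpha> \<in> carrier G" "\<beta> \<in> carrier G"
    by (simp_all add: v_def \<alpha>_def \<beta>_def)
  have assoc: "a \<otimes> (b \<otimes> d) = c \<otimes> d"
    if "a \<otimes> b = c" "a \<in> carrier G" "b \<in> carrier G" "d \<in> carrier G" for a b c d
    using that m_assoc by metis
  have cube: "a \<otimes> (a \<otimes> (a \<otimes> d)) = d"
    if "a \<otimes> (a \<otimes> a) = \<one>" "a \<in> carrier G" "d \<in> carrier G" for a d
    using that m_assoc by (metis l_one m_closed)
  have cancel: "inv a \<otimes> (a \<otimes> d) = d" if "a \<in> carrier G" "d \<in> carrier G" for a d
    using that by (simp add: m_assoc[symmetric])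
  have vcomm: "v \<otimes> c = c \<otimes> v" if "x \<otimes> c = c \<otimes> x" "y \<otimes> c = c \<otimes> y" "c \<in> carrier G" for c
  proof -
    have i: "inv x \<otimes> c = c \<otimes> inv x" "inv y \<otimes> c = c \<otimes> inv y"
      using that commute_inv by (metis cl)+
    show ?thesis
      unfolding v_def using that i assoc[OF i(1)] assoc[OF i(2)] assoc[OF that(1)] assoc[OF that(2)]
      by (simp add: m_assoc)
  qed
  note v\<alpha> = vcomm[OF \<alpha>] and v\<beta> = vcomm[OF \<beta>]
  have vx: "v \<otimes> x = \<alpha> \<otimes> (x \<otimes> v)" by (simp add: \<alpha>_def m_assoc cancel)
  have yv: "y \<otimes> v = \<beta> \<otimes> (v \<otimes> y)" by (simp add: \<beta>_def m_assoc cancel)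
  have yx: "y \<otimes> x = x \<otimes> (v \<otimes> y)"
    by (simp add: v_def m_assoc) (simp add: m_assoc[symmetric])
  have \<beta>\<alpha>: "\<beta> \<otimes> \<alpha> = \<alpha> \<otimes> \<beta>"
  proof -
    have i: "inv v \<otimes> \<alpha> = \<alpha> \<otimes> inv v" "inv y \<otimes> \<alpha> = \<alpha> \<otimes> inv y"
      using v\<alpha> \<alpha>(2) commute_inv by (metis cl \<open>v \<in> carrier G\<close> \<open>\<alpha> \<in> carrier G\<close>)+
    show ?thesis
      unfolding \<beta>_def using v\<alpha> i assoc[OF i(1)] assoc[OF i(2)] assoc[OF v\<alpha>] assoc[OF \<alpha>(2)] \<alpha>(2)
      by (simp add: m_assoc)
  qed
  note rules = \<alpha> \<beta> v\<alpha> v\<beta> vx yv yx \<beta>\<alpha> x3 y3 assoc[OF \<alpha>(1)] assoc[OF \<alpha>(2)] assoc[OF \<beta>(1)] assoc[OF \<beta>(2)]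
    assoc[OF v\<alpha>] assoc[OF v\<beta>] assoc[OF vx] assoc[OF yv] assoc[OF yx] assoc[OF \<beta>\<alpha>]
    cube[OF x3] cube[OF y3] m_assoc
  \<comment> \<open>Move \<open>v\<close> past \<open>x\<^sup>3 = 1\<close>, then \<open>y\<^sup>3 = 1\<close> past \<open>v\<close>, then \<open>y\<close> past \<open>x\<^sup>3 = 1\<close>, collecting in each case.\<close>
  have \<alpha>3: "\<alpha> \<otimes> (\<alpha> \<otimes> \<alpha>) = \<one>"
  proof -
    have "\<alpha> \<otimes> (\<alpha> \<otimes> \<alpha>) \<otimes> v = v \<otimes> (x \<otimes> (x \<otimes> x))"
      unfolding assoc[OF vx, of "x \<otimes> x", simplified] by (simp add: rules del: x3)
    then show ?thesis using x3 by (simp add: r_cancel_one)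
  qed
  have \<beta>3: "\<beta> \<otimes> (\<beta> \<otimes> \<beta>) = \<one>"
  proof -
    have "\<beta> \<otimes> (\<beta> \<otimes> \<beta>) \<otimes> v = y \<otimes> (y \<otimes> (y \<otimes> v))"
      using y3 cube[OF y3] by (simp add: yv rules)
    then show ?thesis using cube[OF y3] by (simp add: r_cancel_one)
  qed
  have v3: "v \<otimes> (v \<otimes> v) = \<one>"
  proof -
    have "v \<otimes> (v \<otimes> v) \<otimes> y = y \<otimes> (x \<otimes> (x \<otimes> x))"
      unfolding assoc[OF yx, of "x \<otimes> x", simplified] by (simp add: rules cube[OF \<alpha>3])
    then show ?thesis using x3 by (simp add: r_cancel_one)
  qed
  show ?thesis
    by (intro H_sys.intro is_group H_sys_axioms.intro)
      (simp_all add: rules \<alpha>3 \<beta>3 v3 cube[OF \<alpha>3] cube[OF \<beta>3] cube[OF v3])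
qed

text \<open>
  In \<open>H\<close> itself, \<open>\<eta>\<^sub>1\<close> and \<open>\<eta>\<^sub>3\<close> are such a pair, so \<open>H\<close> is the largest group generated by one.
\<close>

theorem (in group) hom_from_H:
  fixes x y
  defines "v \<equiv> inv x \<otimes> y \<otimes> x \<otimes> inv y"
  defines "\<alpha> \<equiv> v \<otimes> x \<otimes> inv v \<otimes> inv x" and "\<beta> \<equiv> y \<otimes> v \<otimes> inv y \<otimes> inv v"
  assumes cl: "x \<in> carrier G" "y \<in> carrier G"
    and 3: "x [^] (3::nat) = \<one>" "y [^] (3::nat) = \<one>"
    and \<alpha>: "x \<otimes> \<alpha> = \<alpha> \<otimes> x" "y \<otimes> \<alpha> = \<alpha> \<otimes> y" and \<beta>: "x \<otimes> \<beta> = \<beta> \<otimes> x" "y \<otimes> \<beta> = \<beta> \<otimes> y"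
  shows "\<exists>\<Phi> \<in> hom H G. \<Phi> eta1 = x \<and> \<Phi> eta3 = y \<and> \<Phi> z12 = \<alpha> \<and> \<Phi> z23 = \<beta>"
proof -
  have x3: "x \<otimes> (x \<otimes> x) = \<one>" and y3: "y \<otimes> (y \<otimes> y) = \<one>"
    using 3 cl by (simp_all add: numeral_3_eq_3 m_assoc)
  interpret S: H_sys G \<alpha> \<beta> x "\<alpha> \<otimes> (v \<otimes> v)" y
    unfolding \<alpha>_def \<beta>_def v_def
    by (rule H_sys_of_pair[OF cl x3 y3 \<alpha>[unfolded \<alpha>_def v_def] \<beta>[unfolded \<beta>_def v_def]])
  show ?thesis using S.N_hom S.N_generators by blast
qed

section \<open>Subgroups and internal products of H\<close>

text \<open>The quintuples below given bounds; every subgroup in question is of this form, with bounds 0 and 2.\<close>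

definition hbox :: "nat \<Rightarrow> nat \<Rightarrow> nat \<Rightarrow> nat \<Rightarrow> nat \<Rightarrow> quintuple set"
  where "hbox b c g h k = {..b} \<times> {..c} \<times> {..g} \<times> {..h} \<times> {..k}"

lemma in_hbox [simp]:
  "(b', c', g', h', k') \<in> hbox b c g h k \<longleftrightarrow> b' \<le> b \<and> c' \<le> c \<and> g' \<le> g \<and> h' \<le> h \<and> k' \<le> k"
  by (simp add: hbox_def)

lemma H_set_hbox: "H_set = hbox 2 2 2 2 2"
  by (auto simp: H_set_def hbox_def)

lemma hbox_subset: "b \<le> 2 \<Longrightarrow> c \<le> 2 \<Longrightarrow> g \<le> 2 \<Longrightarrow> h \<le> 2 \<Longrightarrow> k \<le> 2 \<Longrightarrow> hbox b c g h k \<subseteq> H_set"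
  by (auto simp: hbox_def)

lemma res3_0 [simp]: "res3 0 = 0"
  by (simp add: res3_def)

lemma res3_eq_0I: "(of_int i :: 3) = 0 \<Longrightarrow> res3 i = 0"
  using res3_eqI[of i 0] by simp

lemma subgroup_hboxI:
  assumes "S \<subseteq> H_set" "(0, 0, 0, 0, 0) \<in> S"
    and "\<And>x y. x \<in> S \<Longrightarrow> y \<in> S \<Longrightarrow> hmul x y \<in> S" "\<And>x. x \<in> S \<Longrightarrow> hinv x \<in> S"
  shows "subgroup S H"
proof
  fix x y assume "x \<in> S" "y \<in> S"
  then show "x \<otimes>\<^bsub>H\<^esub> y \<in> S" using assms by (metis mult_H subsetD)
next
  fix x assume "x \<in> S"
  then show "inv\<^bsub>H\<^esub> x \<in> S" using assms by (metis inv_H subsetD)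
qed (use assms in auto)

lemma subgroup_hbox:
  "subgroup (hbox 2 0 0 0 0) H" "subgroup (hbox 0 2 0 0 0) H" "subgroup (hbox 0 0 2 0 0) H"
  "subgroup (hbox 0 0 0 2 0) H" "subgroup (hbox 0 0 0 0 2) H" "subgroup (hbox 2 2 0 0 0) H"
  "subgroup (hbox 2 2 0 2 0) H" "subgroup (hbox 2 0 2 0 0) H" "subgroup (hbox 2 0 2 2 0) H"
  "subgroup (hbox 2 2 2 2 0) H" "subgroup (hbox 2 2 2 2 2) H"
  by (rule subgroup_hboxI; force simp: hbox_def)+

lemma generate_hbox:
  assumes "subgroup (hbox b c g h k) H" "S \<subseteq> hbox b c g h k"
    and "b = 0 \<or> z12 \<in> generate H S" "c = 0 \<or> z23 \<in> generate H S" "g = 0 \<or> eta1 \<in> generate H S"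
      "h = 0 \<or> eta2 \<in> generate H S" "k = 0 \<or> eta3 \<in> generate H S"
  shows "generate H S = hbox b c g h k"
proof
  have sub: "hbox b c g h k \<subseteq> H_set" using subgroup.subset[OF assms(1)] by simp
  show "generate H S \<subseteq> hbox b c g h k"
    using assms(1,2) H.generate_subgroup_incl by blast
  have S: "subgroup (generate H S) H"
    using sub assms(2) by (intro H.generate_is_subgroup) auto
  show "hbox b c g h k \<subseteq> generate H S"
  proof
    fix e assume e: "e \<in> hbox b c g h k"
    obtain b' c' g' h' k' where d: "e = (b', c', g', h', k')" by (cases e)
    show "e \<in> generate H S"
      unfolding d
    proof (rule generate_normal_form[OF S])
      show "(b', c', g', h', k') \<in> H_set" using e sub unfolding d by blast
    qed (use e assms(3-) in \<open>auto simp: d\<close>)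
  qed
qed

lemma sub_hbox:
  "sub_Z12 = hbox 2 0 0 0 0" "sub_Z23 = hbox 0 2 0 0 0" "sub_Y1 = hbox 0 0 2 0 0"
  "sub_Y2 = hbox 0 0 0 2 0" "sub_Y3 = hbox 0 0 0 0 2"
  unfolding sub_Z12_def sub_Z23_def sub_Y1_def sub_Y2_def sub_Y3_def
  by (rule generate_hbox, rule subgroup_hbox,
      simp_all add: z12_def z23_def eta1_def eta2_def eta3_def generate.incl)+

lemma derived_H: "derived H (carrier H) = hbox 2 2 0 2 0"
  unfolding derived_def
proof (rule generate_hbox)
  let ?D = "derived_set H (carrier H)"
  show "subgroup (hbox 2 2 0 2 0) H" by (rule subgroup_hbox)
  show "?D \<subseteq> hbox 2 2 0 2 0"
  proof
    fix e assume "e \<in> ?D"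
    then obtain x y where xy: "x \<in> H_set" "y \<in> H_set"
      and e: "e = x \<otimes>\<^bsub>H\<^esub> y \<otimes>\<^bsub>H\<^esub> inv\<^bsub>H\<^esub> x \<otimes>\<^bsub>H\<^esub> inv\<^bsub>H\<^esub> y"
      by (simp only: carrier_H) blast
    have "e = hmul (hmul (hmul x y) (hinv x)) (hinv y)"
      using xy by (simp only: e mult_H inv_H hmul_closed hinv_closed)
    moreover have "hmul (hmul (hmul x y) (hinv x)) (hinv y) \<in> hbox 2 2 0 2 0"
      by (cases x; cases y; simp only: hmul.simps hinv.simps in_hbox int_res3; intro conjI;
          (rule res3_le eq_refl[OF res3_eq_0I])?; simp)
    ultimately show "e \<in> hbox 2 2 0 2 0" by simp
  qed
  have comm: "x \<otimes>\<^bsub>H\<^esub> y \<otimes>\<^bsub>H\<^esub> inv\<^bsub>H\<^esub> x \<otimes>\<^bsub>H\<^esub> inv\<^bsub>H\<^esub> y \<in> generate H ?D" if "x \<in> H_set" "y \<in> H_set" for x y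
    using that by (intro generate.incl) (simp only: carrier_H, blast)
  show "2 = 0 \<or> z12 \<in> generate H ?D" "2 = 0 \<or> z23 \<in> generate H ?D" "2 = 0 \<or> eta2 \<in> generate H ?D"
    using comm[of eta1 eta2] comm[of eta2 eta3] comm[of eta1 eta3] unfolding commutator_values
    by (blast intro: generators_in_H_set)+
qed simp_all

lemma center_H: "center H = hbox 2 2 0 0 0"
proof
  show "hbox 2 2 0 0 0 \<subseteq> center H"
    by (auto simp: hbox_def center_def add.commute)
  show "center H \<subseteq> hbox 2 2 0 0 0"
  proof
    fix e assume e: "e \<in> center H"
    obtain b c g h k where d: "e = (b, c, g, h, k)" by (cases e)
    have le: "b \<le> 2" "c \<le> 2" "g \<le> 2" "h \<le> 2" "k \<le> 2"
      using e by (auto simp: center_def d)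
    have com: "hmul e x = hmul x e" if "x \<in> H_set" for x
      using e that by (auto simp: center_def)
    \<comment> \<open>Commuting with \<open>\<eta>\<^sub>2\<close> excludes \<open>\<eta>\<^sub>1\<close> and \<open>\<eta>\<^sub>3\<close>; commuting with \<open>\<eta>\<^sub>1\<close> then excludes \<open>\<eta>\<^sub>2\<close>.\<close>
    have "res3 (int b) = res3 (int b - int g)" "res3 (int c - int k) = res3 (int c)"
      using com[of eta2] by (simp_all add: d eta2_def)
    then have "(3::int) dvd int g" "(3::int) dvd int k"
      unfolding res3_eq_iff mod_eq_dvd_iff by simp_all
    then have "g = 0" "k = 0" using le by presburger+
    then have "res3 (int b - int h) = res3 (int b)"
      using com[of eta1] by (simp add: d eta1_def)
    then have "(3::int) dvd int h" unfolding res3_eq_iff mod_eq_dvd_iff by simp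
    then have "h = 0" using le by presburger
    then show "e \<in> hbox 2 2 0 0 0" using le \<open>g = 0\<close> \<open>k = 0\<close> by (simp add: d)
  qed
qed

text \<open>
  When no generator on the left has to be moved past one on the right with which it does not
  commute, exponents just add.
\<close>

lemma set_mult_hbox:
  assumes "b = 0 \<or> b' = 0" "c = 0 \<or> c' = 0" "g = 0 \<or> g' = 0" "h = 0 \<or> h' = 0" "k = 0 \<or> k' = 0"
    and "k = 0 \<or> g' = 0" "k = 0 \<or> h' = 0" "h = 0 \<or> g' = 0"
    and le: "b + b' \<le> 2" "c + c' \<le> 2" "g + g' \<le> 2" "h + h' \<le> 2" "k + k' \<le> 2"
  shows "hbox b c g h k <#>\<^bsub>H\<^esub> hbox b' c' g' h' k' = hbox (b + b') (c + c') (g + g') (h + h') (k + k')"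
proof -
  have mult: "x \<otimes>\<^bsub>H\<^esub> y = (x1 + y1, x2 + y2, x3 + y3, x4 + y4, x5 + y5)"
    if "x = (x1, x2, x3, x4, x5)" "y = (y1, y2, y3, y4, y5)" "x \<in> hbox b c g h k" "y \<in> hbox b' c' g' h' k'"
    for x y x1 x2 x3 x4 x5 y1 y2 y3 y4 y5
  proof -
    have [simp]: "int x5 * int y3 = 0" "int x5 * int y4 = 0" "int x4 * int y3 = 0"
      using that assms by auto
    have "x5 = 0 \<or> y3 = 0" using that assms by auto
    moreover have "x \<in> H_set" "y \<in> H_set" using that le by auto
    moreover have "x1 + y1 \<le> 2" "x2 + y2 \<le> 2" "x3 + y3 \<le> 2" "x4 + y4 \<le> 2" "x5 + y5 \<le> 2"
      using that le by auto
    ultimately show ?thesis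
      using that(1,2) by (auto simp: of_nat_add[symmetric] simp del: of_nat_add)
  qed
  show ?thesis
  proof
    show "hbox b c g h k <#>\<^bsub>H\<^esub> hbox b' c' g' h' k' \<subseteq> hbox (b + b') (c + c') (g + g') (h + h') (k + k')"
    proof (clarsimp simp: set_mult_def)
      fix x1 x2 x3 x4 x5 y1 y2 y3 y4 y5
      assume "x1 \<le> b" "x2 \<le> c" "x3 \<le> g" "x4 \<le> h" "x5 \<le> k" "y1 \<le> b'" "y2 \<le> c'" "y3 \<le> g'" "y4 \<le> h'" "y5 \<le> k'"
      then show "(x1, x2, x3, x4, x5) \<otimes>\<^bsub>H\<^esub> (y1, y2, y3, y4, y5) \<in> hbox (b + b') (c + c') (g + g') (h + h') (k + k')"
        by (subst mult[OF HOL.refl HOL.refl]) auto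
    qed
    show "hbox (b + b') (c + c') (g + g') (h + h') (k + k') \<subseteq> hbox b c g h k <#>\<^bsub>H\<^esub> hbox b' c' g' h' k'"
    proof
      fix e assume e: "e \<in> hbox (b + b') (c + c') (g + g') (h + h') (k + k')"
      obtain e1 e2 e3 e4 e5 where d: "e = (e1, e2, e3, e4, e5)" by (cases e)
      let ?x = "(min e1 b, min e2 c, min e3 g, min e4 h, min e5 k)"
      let ?y = "(e1 - min e1 b, e2 - min e2 c, e3 - min e3 g, e4 - min e4 h, e5 - min e5 k)"
      have "?x \<in> hbox b c g h k" "?y \<in> hbox b' c' g' h' k'"
        using e by (auto simp: d)
      moreover from this have "e = ?x \<otimes>\<^bsub>H\<^esub> ?y"
        by (subst mult[OF HOL.refl HOL.refl]) (auto simp: d)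
      ultimately show "e \<in> hbox b c g h k <#>\<^bsub>H\<^esub> hbox b' c' g' h' k'"
        unfolding set_mult_def by blast
    qed
  qed
qed

lemma normal_subgrpI:
  assumes L: "subgroup L H" and N: "subgroup N H" and "N \<subseteq> L"
    and conj: "\<And>x n. x \<in> L \<Longrightarrow> n \<in> N \<Longrightarrow> hmul (hmul x n) (hinv x) \<in> N"
  shows "N \<lhd> subgrp H L"
proof -
  interpret L: group "subgrp H L"
    unfolding subgrp_def using L by (rule H.subgroup_imp_group)
  have sub: "L \<subseteq> H_set" using subgroup.subset[OF L] by simp
  show ?thesis
  proof (rule L.normal_invI)
    show "subgroup N (subgrp H L)"
      unfolding subgrp_def by (rule H.subgroup_incl[OF N L \<open>N \<subseteq> L\<close>])
    fix x n assume "x \<in> carrier (subgrp H L)" "n \<in> N"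
    then have x: "x \<in> L" and "n \<in> N" by (simp_all add: subgrp_def)
    then have mem: "x \<in> H_set" "n \<in> H_set" using sub \<open>N \<subseteq> L\<close> by auto
    have "inv\<^bsub>subgrp H L\<^esub> x = hinv x"
      unfolding subgrp_def using H.m_inv_consistent[OF L x] mem by simp
    then show "x \<otimes>\<^bsub>subgrp H L\<^esub> n \<otimes>\<^bsub>subgrp H L\<^esub> inv\<^bsub>subgrp H L\<^esub> x \<in> N"
      using conj[OF x \<open>n \<in> N\<close>] mem by (simp add: subgrp_def hmul_closed hinv_closed)
  qed
qed

lemma internal_semidirectI:
  assumes L: "subgroup L H" and N: "subgroup N H" and K: "subgroup K H"
    and LNK: "N <#>\<^bsub>H\<^esub> K = L" and "N \<inter> K = {(0, 0, 0, 0, 0)}"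
    and "N \<subseteq> L" "K \<subseteq> L"
    and "\<And>x n. x \<in> L \<Longrightarrow> n \<in> N \<Longrightarrow> hmul (hmul x n) (hinv x) \<in> N"
  shows "internal_semidirect H L N K"
  unfolding internal_semidirect_def
  using assms normal_subgrpI[OF L N] H.subgroup_incl[OF K L] by (simp add: subgrp_def)

lemma internal_directI:
  assumes "internal_semidirect H L N K" and "subgroup K H" "K \<subseteq> L"
    and "\<And>x n. x \<in> L \<Longrightarrow> n \<in> K \<Longrightarrow> hmul (hmul x n) (hinv x) \<in> K"
  shows "internal_direct H L N K"
  using assms normal_subgrpI[of L K] by (simp add: internal_direct_def internal_semidirect_def)

lemma hbox_products:
  "hbox 2 0 0 0 0 <#>\<^bsub>H\<^esub> hbox 0 2 0 0 0 = hbox 2 2 0 0 0"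
  "hbox 2 2 0 0 0 <#>\<^bsub>H\<^esub> hbox 0 0 0 2 0 = hbox 2 2 0 2 0"
  "hbox 2 0 0 0 0 <#>\<^bsub>H\<^esub> hbox 0 0 2 0 0 = hbox 2 0 2 0 0"
  "hbox 2 0 2 0 0 <#>\<^bsub>H\<^esub> hbox 0 0 0 2 0 = hbox 2 0 2 2 0"
  "hbox 2 0 2 2 0 <#>\<^bsub>H\<^esub> hbox 0 2 0 0 0 = hbox 2 2 2 2 0"
  "hbox 2 2 2 2 0 <#>\<^bsub>H\<^esub> hbox 0 0 0 0 2 = hbox 2 2 2 2 2"
  by (rule set_mult_hbox[THEN HOL.trans]; simp add: numeral_2_eq_2)+

lemma H_internal_products:
  "internal_direct H (center H) sub_Z12 sub_Z23"
  "internal_direct H (derived H (carrier H)) (sub_Z12 <#>\<^bsub>H\<^esub> sub_Z23) sub_Y2"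
  "internal_direct H (sub_Z12 <#>\<^bsub>H\<^esub> sub_Y1) sub_Z12 sub_Y1"
  "internal_semidirect H (sub_Z12 <#>\<^bsub>H\<^esub> sub_Y1 <#>\<^bsub>H\<^esub> sub_Y2) (sub_Z12 <#>\<^bsub>H\<^esub> sub_Y1) sub_Y2"
  "internal_direct H (sub_Z12 <#>\<^bsub>H\<^esub> sub_Y1 <#>\<^bsub>H\<^esub> sub_Y2 <#>\<^bsub>H\<^esub> sub_Z23)
     (sub_Z12 <#>\<^bsub>H\<^esub> sub_Y1 <#>\<^bsub>H\<^esub> sub_Y2) sub_Z23"
  "internal_semidirect H (carrier H) (sub_Z12 <#>\<^bsub>H\<^esub> sub_Y1 <#>\<^bsub>H\<^esub> sub_Y2 <#>\<^bsub>H\<^esub> sub_Z23) sub_Y3"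
  unfolding derived_H center_H sub_hbox hbox_products
  unfolding carrier_H H_set_hbox
  by ((intro internal_directI internal_semidirectI subgroup_hbox hbox_products;
      force simp: hbox_def intro!: res3_eq_0I)+)

text \<open>Each of the five cyclic factors is read off from its only nonzero coordinate.\<close>

lemma subgrp_iso_C3:
  assumes "Y \<in> {sub_Z12, sub_Z23, sub_Y1, sub_Y2, sub_Y3}"
  shows "subgrp H Y \<cong> C3"
proof -
  let ?f = "\<lambda>(b, c, g, h, k). int (b + c + g + h + k)"
  have "?f \<in> iso (subgrp H Y) C3"
  proof (rule isoI)
    show "?f \<in> hom (subgrp H Y) C3"
      using assms unfolding sub_hbox
      by (auto simp: hom_def subgrp_def hbox_def integer_mod_group_def)
    have "inj_on ?f Y" using assms unfolding sub_hbox
      by (auto simp: inj_on_def hbox_def)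
    moreover have "?f ` Y = {0..<3}"
    proof
      show "?f ` Y \<subseteq> {0..<3}" using assms unfolding sub_hbox by (auto simp: hbox_def)
      show "{0..<3} \<subseteq> ?f ` Y"
      proof
        fix i :: int assume "i \<in> {0..<3}"
        then have i: "int (nat i) = i" "nat i \<le> 2" by auto
        have "(nat i, 0, 0, 0, 0) \<in> Y \<or> (0, nat i, 0, 0, 0) \<in> Y \<or> (0, 0, nat i, 0, 0) \<in> Y
          \<or> (0, 0, 0, nat i, 0) \<in> Y \<or> (0, 0, 0, 0, nat i) \<in> Y"
          using assms i(2) unfolding sub_hbox by auto
        then show "i \<in> ?f ` Y" using i(1) by (auto intro: rev_image_eqI)
      qed
    qed
    ultimately show "bij_betw ?f (carrier (subgrp H Y)) (carrier C3)"
      by (simp add: bij_betw_def subgrp_def integer_mod_group_def)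
  qed
  then show ?thesis by (auto simp: is_iso_def)
qed

section \<open>H as an iterated semidirect product of cyclic groups\<close>

lemma carrier_C3: "carrier C3 = {0..<3}"
  by (simp add: integer_mod_group_def)

lemma mult_C3: "i \<otimes>\<^bsub>C3\<^esub> j = (i + j) mod 3"
  by (simp add: integer_mod_group_def)

lemma one_C3: "\<one>\<^bsub>C3\<^esub> = 0"
  by (simp add: integer_mod_group_def)

lemmas C3_simps = carrier_C3 mult_C3 one_C3

lemma mod3_eqI:
  assumes "(of_int i :: 3) = of_int j"
  shows "i mod 3 = j mod 3"
  using res3_eqI[OF assms] by (simp add: res3_eq_iff)

text \<open>An action of \<open>C\<^sub>3\<close> on a group by automorphisms, in the extensional form of \<open>AutoGroup\<close>.\<close>

lemma hom_C3_AutoGroupI: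
  assumes ext: "\<And>k. k \<in> carrier C3 \<Longrightarrow> \<alpha> k \<in> extensional (carrier K)"
    and hom: "\<And>k. k \<in> carrier C3 \<Longrightarrow> \<alpha> k \<in> hom K K"
    and zero: "\<And>a. a \<in> carrier K \<Longrightarrow> \<alpha> 0 a = a"
    and comp: "\<And>k l a. k \<in> carrier C3 \<Longrightarrow> l \<in> carrier C3 \<Longrightarrow> a \<in> carrier K \<Longrightarrow>
      \<alpha> ((k + l) mod 3) a = \<alpha> k (\<alpha> l a)"
  shows "\<alpha> \<in> hom C3 (AutoGroup K)"
proof -
  have cl: "\<alpha> k a \<in> carrier K" if "k \<in> carrier C3" "a \<in> carrier K" for k a
    using hom_in_carrier[OF hom] that by blast
  have bij: "bij_betw (\<alpha> k) (carrier K) (carrier K)" if k: "k \<in> carrier C3" for k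
  proof (rule bij_betw_byWitness[where f' = "\<alpha> ((- k) mod 3)"])
    have l: "(- k) mod 3 \<in> carrier C3" by (simp add: carrier_C3)
    have "(k + (- k) mod 3) mod 3 = 0" "((- k) mod 3 + k) mod 3 = 0" by (simp_all add: mod_simps)
    then show "\<forall>a\<in>carrier K. \<alpha> ((- k) mod 3) (\<alpha> k a) = a" "\<forall>a\<in>carrier K. \<alpha> k (\<alpha> ((- k) mod 3) a) = a"
      using comp[OF k l] comp[OF l k] zero by metis+
    show "\<alpha> k ` carrier K \<subseteq> carrier K" "\<alpha> ((- k) mod 3) ` carrier K \<subseteq> carrier K"
      using cl k l by auto
  qed
  show ?thesis
  proof (rule homI)
    show auto: "\<alpha> k \<in> carrier (AutoGroup K)" if "k \<in> carrier C3" for k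
      using ext hom bij that by (simp add: AutoGroup_def auto_def Bij_def)
    show "\<alpha> (k \<otimes>\<^bsub>C3\<^esub> l) = \<alpha> k \<otimes>\<^bsub>AutoGroup K\<^esub> \<alpha> l" if "k \<in> carrier C3" "l \<in> carrier C3" for k l
    proof -
      have kl: "(k + l) mod 3 \<in> carrier C3" by (simp add: carrier_C3)
      have "\<alpha> ((k + l) mod 3) = compose (carrier K) (\<alpha> k) (\<alpha> l)"
      proof
        fix a show "\<alpha> ((k + l) mod 3) a = compose (carrier K) (\<alpha> k) (\<alpha> l) a"
          using comp[OF that] ext[OF kl] by (cases "a \<in> carrier K") (auto simp: compose_def extensional_def)
      qed
      then show ?thesis
        using ext bij that by (simp add: AutoGroup_def BijGroup_def Bij_def mult_C3)
    qed
  qed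
qed

text \<open>
  Conjugation by \<open>\<eta>\<^sub>2\<^sup>k\<close> on \<open>z\<^sub>1\<^sub>2\<^sup>b \<eta>\<^sub>1\<^sup>m\<close>, written \<open>(b, m)\<close>, with the exponents of \<open>hmul\<close>.
\<close>

definition act2 :: "int \<Rightarrow> int \<times> int \<Rightarrow> int \<times> int"
  where "act2 k = (\<lambda>(b, m) \<in> carrier (C3 \<times>\<times> C3). ((b - k * m) mod 3, m))"

text \<open>The group \<open>(Z\<^sub>1\<^sub>2 \<times> Y\<^sub>1) \<rtimes> Y\<^sub>2\<close> in these coordinates.\<close>

abbreviation N2 :: "((int \<times> int) \<times> int) monoid"
  where "N2 \<equiv> semidirect (C3 \<times>\<times> C3) C3 act2"

text \<open>
  Conjugation by \<open>\<eta>\<^sub>3\<^sup>k\<close> on \<open>z\<^sub>1\<^sub>2\<^sup>b \<eta>\<^sub>1\<^sup>m \<eta>\<^sub>2\<^sup>n z\<^sub>2\<^sub>3\<^sup>c\<close>, written \<open>(((b, m), n), c)\<close>.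
\<close>

definition act3 :: "int \<Rightarrow> ((int \<times> int) \<times> int) \<times> int \<Rightarrow> ((int \<times> int) \<times> int) \<times> int"
  where "act3 k = (\<lambda>(((b, m), n), c) \<in> carrier (N2 \<times>\<times> C3).
    ((((b + k * m * (2 - m)) mod 3, m), (n + 2 * k * m) mod 3), (c - k * (k - 1) * m - k * n) mod 3))"

lemma act2_hom: "act2 \<in> hom C3 (AutoGroup (C3 \<times>\<times> C3))"
proof (rule hom_C3_AutoGroupI)
  fix k l :: int assume k: "k \<in> carrier C3"
  show "act2 k \<in> hom (C3 \<times>\<times> C3) (C3 \<times>\<times> C3)"
    by (auto simp: hom_def act2_def C3_simps intro!: mod3_eqI) (simp add: algebra_simps)
qed (auto simp: act2_def C3_simps intro!: mod3_eqI, simp_all add: algebra_simps)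

lemma carrier_N2: "carrier N2 = carrier (C3 \<times>\<times> C3) \<times> carrier C3"
  by (simp add: semidirect_def)

lemma mult_N2:
  assumes "m' \<in> carrier C3" "b' \<in> carrier C3"
  shows "((b, m), n) \<otimes>\<^bsub>N2\<^esub> ((b', m'), n')
    = (((b + (b' - n * m')) mod 3, (m + m') mod 3), (n + n') mod 3)"
  using assms by (simp add: semidirect_def act2_def C3_simps mod_simps)

lemma act3_hom: "act3 \<in> hom C3 (AutoGroup (N2 \<times>\<times> C3))"
proof (rule hom_C3_AutoGroupI)
  fix k l :: int assume k: "k \<in> carrier C3"
  show "act3 k \<in> hom (N2 \<times>\<times> C3) (N2 \<times>\<times> C3)"
    by (auto simp: hom_def act3_def mult_N2 carrier_N2 C3_simps intro!: mod3_eqI; simp add: algebra_simps)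
qed (auto simp: act3_def carrier_N2 C3_simps intro!: mod3_eqI; simp add: algebra_simps)+

lemma H_iso_semidirect: "H \<cong> semidirect (N2 \<times>\<times> C3) C3 act3"
proof -
  let ?S = "semidirect (N2 \<times>\<times> C3) C3 act3"
  let ?f = "\<lambda>(b, c, g, h, k). ((((int b, int g), int h), int c), int k)"
  have carrier: "carrier ?S = ((({0..<3} \<times> {0..<3}) \<times> {0..<3}) \<times> {0..<3}) \<times> {0..<3}"
    by (simp add: semidirect_def carrier_C3)
  have "?f \<in> iso H ?S"
  proof (rule isoI)
    show "?f \<in> hom H ?S"
    proof (rule homI)
      fix x y assume "x \<in> carrier H" "y \<in> carrier H"
      moreover obtain b c g h k where x: "x = (b, c, g, h, k)" by (cases x)
      moreover obtain b' c' g' h' k' where y: "y = (b', c', g', h', k')" by (cases y)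
      ultimately have le: "b \<le> 2" "c \<le> 2" "g \<le> 2" "h \<le> 2" "k \<le> 2"
        and le': "b' \<le> 2" "c' \<le> 2" "g' \<le> 2" "h' \<le> 2" "k' \<le> 2" by auto
      have "?f x \<otimes>\<^bsub>?S\<^esub> ?f y = (((((int b, int g), int h), int c) \<otimes>\<^bsub>N2 \<times>\<times> C3\<^esub>
          act3 (int k) (((int b', int g'), int h'), int c')), (int k + int k') mod 3)"
        by (simp add: semidirect_def x y mult_C3)
      also have "\<dots> = ?f (hmul x y)"
        using le le'
        by (auto simp: act3_def x y carrier_N2 mult_N2 C3_simps intro!: mod3_eqI; simp add: algebra_simps)
      finally show "?f (x \<otimes>\<^bsub>H\<^esub> y) = ?f x \<otimes>\<^bsub>?S\<^esub> ?f y"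
        using le le' by (simp add: x y)
    qed (auto simp: carrier)
    have "inj_on ?f H_set" by (auto simp: inj_on_def)
    moreover have "?f ` H_set = carrier ?S"
    proof
      show "carrier ?S \<subseteq> ?f ` H_set"
      proof (clarsimp simp: carrier)
        fix b m n c k :: int
        assume "0 \<le> b" "b < 3" "0 \<le> m" "m < 3" "0 \<le> n" "n < 3" "0 \<le> c" "c < 3" "0 \<le> k" "k < 3"
        then show "((((b, m), n), c), k) \<in> ?f ` H_set"
          by (intro image_eqI[of _ _ "(nat b, nat c, nat m, nat n, nat k)"]) auto
      qed
    qed (auto simp: carrier)
    ultimately show "bij_betw ?f (carrier H) (carrier ?S)" by (simp add: bij_betw_def)
  qed
  then show ?thesis by (auto simp: is_iso_def)
qed

section \<open>The groups of order 27 and 243\<close>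

lemma epi_Mod_kernel_iso:
  assumes "group G" "group K" "\<psi> \<in> epi G K"
  shows "G Mod kernel G K \<psi> \<cong> K"
proof -
  interpret group_hom G K \<psi>
    using assms by (simp add: group_hom_def group_hom_axioms_def epi_def)
  show ?thesis using FactGroup_iso assms(3) by (simp add: epi_def)
qed

text \<open>
  The conjugates \<open>b\<close>, \<open>b\<^sub>1 = aba\<inverse>\<close>, \<open>b\<^sub>2 = a\<inverse>ba\<close> satisfy \<open>b\<^sub>1b\<^sub>2b = b\<^sub>2b\<^sub>1b = 1\<close>, hence commute, and
  this makes \<open>b\<inverse>aba\<inverse> = b\<inverse>b\<^sub>1\<close> central.
\<close>

lemma (in group) commutator_central_of_exponent_3:
  assumes cl [simp]: "a \<in> carrier G" "b \<in> carrier G"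
    and a3: "a [^] (3::nat) = \<one>" and b3: "b [^] (3::nat) = \<one>"
    and ab: "(a \<otimes> b) [^] (3::nat) = \<one>" and ab': "(inv a \<otimes> b) [^] (3::nat) = \<one>"
  defines "v \<equiv> inv b \<otimes> a \<otimes> b \<otimes> inv a"
  shows "v \<otimes> b = b \<otimes> v" "v \<otimes> a = a \<otimes> v"
proof -
  have aa: "a \<otimes> (a \<otimes> a) = \<one>" and bb: "b \<otimes> (b \<otimes> b) = \<one>"
    using a3 b3 by (simp_all add: numeral_3_eq_3 m_assoc)
  have inva: "inv a = a \<otimes> a" and invb: "inv b = b \<otimes> b"
    using aa bb by (auto intro!: inv_equality simp: m_assoc)
  have aad: "a \<otimes> (a \<otimes> (a \<otimes> d)) = d" and bbd: "b \<otimes> (b \<otimes> (b \<otimes> d)) = d" if "d \<in> carrier G" for d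
    using aa bb that by (metis cl l_one m_assoc m_closed)+
  define b1 where "b1 = a \<otimes> (b \<otimes> (a \<otimes> a))"
  define b2 where "b2 = a \<otimes> (a \<otimes> (b \<otimes> a))"
  have [simp]: "b1 \<in> carrier G" "b2 \<in> carrier G" by (simp_all add: b1_def b2_def)
  have 1: "b1 \<otimes> (b2 \<otimes> b) = \<one>"
    using ab by (simp add: b1_def b2_def numeral_3_eq_3 m_assoc aad)
  have 2: "b2 \<otimes> (b1 \<otimes> b) = \<one>"
    using ab' by (simp add: b1_def b2_def inva numeral_3_eq_3 m_assoc aad)
  have b1c: "b1 \<otimes> (b1 \<otimes> b1) = \<one>"
    by (simp add: b1_def m_assoc aad bbd aa)
  have 3: "b \<otimes> b1 = inv b2"
  proof -
    have "b1 \<otimes> b2 = inv b" using 1 by (metis inv_equality m_assoc cl(2) m_closed \<open>b1 \<in> carrier G\<close> \<open>b2 \<in> carrier G\<close>)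
    then have "b \<otimes> (b1 \<otimes> b2) = \<one>" by simp
    then have "(b \<otimes> b1) \<otimes> b2 = \<one>" by (simp add: m_assoc)
    then show ?thesis by (metis inv_equality cl(2) m_closed \<open>b1 \<in> carrier G\<close> \<open>b2 \<in> carrier G\<close>)
  qed
  have 4: "b1 \<otimes> b = inv b2"
    using 2 by (metis inv_equality inv_inv inv_closed cl(2) m_closed \<open>b1 \<in> carrier G\<close> \<open>b2 \<in> carrier G\<close>)
  have com: "b1 \<otimes> b = b \<otimes> b1" using 3 4 by simp
  have comd: "b1 \<otimes> (b \<otimes> d) = b \<otimes> (b1 \<otimes> d)" if "d \<in> carrier G" for d
    using com that by (metis cl(2) m_assoc \<open>b1 \<in> carrier G\<close>)
  have v: "v = b \<otimes> (b \<otimes> b1)" by (simp add: v_def b1_def inva invb m_assoc)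
  show "v \<otimes> b = b \<otimes> v"
    by (simp add: v m_assoc com)
  have "b2 = inv (b \<otimes> b1)" using 3 by simp
  also have "\<dots> = b1 \<otimes> (b1 \<otimes> (b \<otimes> b))"
  proof (rule inv_equality)
    show "b1 \<otimes> (b1 \<otimes> (b \<otimes> b)) \<otimes> (b \<otimes> b1) = \<one>"
      using b1c by (simp add: m_assoc bbd)
  qed simp_all
  finally have b2: "b2 = b \<otimes> (b \<otimes> (b1 \<otimes> b1))" by (simp add: com comd)
  have "a \<otimes> v = b1 \<otimes> (b1 \<otimes> (b2 \<otimes> a))"
    by (simp add: v b1_def b2_def m_assoc aad aa)
  also have "\<dots> = v \<otimes> a"
    using b1c by (simp add: b2 v m_assoc comd) (metis b1c l_one m_assoc cl m_closed \<open>b1 \<in> carrier G\<close>)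
  finally show "v \<otimes> a = a \<otimes> v" by simp
qed

lemma H_pow: "a \<in> H_set \<Longrightarrow> a [^]\<^bsub>H\<^esub> (3::nat) = hmul a (hmul a a)"
  by (simp add: numeral_3_eq_3 hmul_one hmul_assoc hmul_closed)

lemma center_normal: "center H \<lhd> H"
proof (rule H.normal_invI)
  show "subgroup (center H) H" unfolding center_H by (rule subgroup_hbox)
  fix x h assume "x \<in> carrier H" "h \<in> center H"
  moreover from this have "x \<otimes>\<^bsub>H\<^esub> h = h \<otimes>\<^bsub>H\<^esub> x" "h \<in> carrier H" by (auto simp: center_def)
  ultimately show "x \<otimes>\<^bsub>H\<^esub> h \<otimes>\<^bsub>H\<^esub> inv\<^bsub>H\<^esub> x \<in> center H"
    by (metis H.inv_closed H.m_assoc H.r_inv H.r_one)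
qed

text \<open>If \<open>v = x\<inverse>yxy\<inverse>\<close> commutes with \<open>x\<close> and \<open>y\<close>, then the homomorphism given by \<open>x\<close> and \<open>y\<close> kills the center of \<open>H\<close>.\<close>

lemma (in group) hom_from_H_mod_center:
  fixes x y
  defines "v \<equiv> inv x \<otimes> y \<otimes> x \<otimes> inv y"
  assumes cl: "x \<in> carrier G" "y \<in> carrier G"
    and 3: "x [^] (3::nat) = \<one>" "y [^] (3::nat) = \<one>"
    and v: "v \<otimes> x = x \<otimes> v" "v \<otimes> y = y \<otimes> v"
  shows "\<exists>\<Phi> \<in> hom H G. \<Phi> eta1 = x \<and> \<Phi> eta3 = y \<and> (\<forall>h \<in> center H. \<Phi> h = \<one>)"
proof -
  have vc: "v \<in> carrier G" using cl by (simp add: v_def)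
  have \<alpha>: "v \<otimes> x \<otimes> inv v \<otimes> inv x = \<one>" using v(1) cl vc by (simp add: m_assoc)
  have \<beta>: "y \<otimes> v \<otimes> inv y \<otimes> inv v = \<one>" using v(2)[symmetric] cl vc by (simp add: m_assoc)
  have "\<exists>\<Phi> \<in> hom H G. \<Phi> eta1 = x \<and> \<Phi> eta3 = y \<and> \<Phi> z12 = \<one> \<and> \<Phi> z23 = \<one>"
    using hom_from_H[OF cl 3] cl unfolding v_def[symmetric] \<alpha> \<beta> by simp
  then obtain \<Phi> where \<Phi>: "\<Phi> \<in> hom H G" "\<Phi> eta1 = x" "\<Phi> eta3 = y" "\<Phi> z12 = \<one>" "\<Phi> z23 = \<one>" by blast
  interpret \<Phi>: group_hom H G \<Phi>
    using \<Phi>(1) by (simp add: group_hom_def group_hom_axioms_def group_H is_group)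
  have "center H \<subseteq> kernel H G \<Phi>"
  proof
    fix h assume h: "h \<in> center H"
    obtain b c g e k where d: "h = (b, c, g, e, k)" by (cases h)
    show "h \<in> kernel H G \<Phi>"
      using h \<Phi> unfolding d center_H
      by (intro generate_normal_form[OF \<Phi>.subgroup_kernel]) (auto simp: kernel_def)
  qed
  then show ?thesis using \<Phi> by (auto simp: kernel_def)
qed

lemma in_center_coset:
  assumes "a \<in> H_set" "b \<in> H_set" "hmul a (hinv b) \<in> center H"
  shows "a \<in> center H #>\<^bsub>H\<^esub> b"
  using subgroup.rcos_module_rev[OF normal_imp_subgroup[OF center_normal] group_H, of b a] assms
  by (simp add: hinv_closed)

lemma generate_H_superset:
  assumes "eta1 \<in> generate H (range \<phi>)" "eta3 \<in> generate H (range \<phi>)" "range \<phi> \<subseteq> H_set"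
  shows "generate H (range \<phi>) = carrier H"
proof
  have "subgroup (generate H (range \<phi>)) H" using assms by (intro H.generate_is_subgroup) simp
  then show "carrier H \<subseteq> generate H (range \<phi>)"
    unfolding generate_H[symmetric] using assms by (intro H.generate_subgroup_incl) auto
  show "generate H (range \<phi>) \<subseteq> carrier H" using assms H.generate_incl by simp
qed

lemma group_G39: "group G39"
  unfolding G39_def by (rule group_presented_group)

lemma G39_pair:
  defines "v \<equiv> inv\<^bsub>G39\<^esub> G39_b \<otimes>\<^bsub>G39\<^esub> G39_a \<otimes>\<^bsub>G39\<^esub> G39_b \<otimes>\<^bsub>G39\<^esub> inv\<^bsub>G39\<^esub> G39_a"
  shows "G39_a \<in> carrier G39" "G39_b \<in> carrier G39"
    "G39_a [^]\<^bsub>G39\<^esub> (3::nat) = \<one>\<^bsub>G39\<^esub>" "G39_b [^]\<^bsub>G39\<^esub> (3::nat) = \<one>\<^bsub>G39\<^esub>"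
    "v \<otimes>\<^bsub>G39\<^esub> G39_b = G39_b \<otimes>\<^bsub>G39\<^esub> v" "v \<otimes>\<^bsub>G39\<^esub> G39_a = G39_a \<otimes>\<^bsub>G39\<^esub> v"
proof -
  let ?P = "presented_group G39_rels"
  interpret P: group ?P by (rule group_presented_group)
  let ?g = "\<lambda>c. word_class G39_rels (gen c)"
  have cl: "\<And>c. ?g c \<in> carrier ?P" by simp
  note ev = P.word_eval_simps[of ?g, OF cl]
  have rels: "?g GenA [^]\<^bsub>?P\<^esub> (3::nat) = \<one>\<^bsub>?P\<^esub>" "?g GenB [^]\<^bsub>?P\<^esub> (3::nat) = \<one>\<^bsub>?P\<^esub>"
    "(?g GenA \<otimes>\<^bsub>?P\<^esub> ?g GenB) [^]\<^bsub>?P\<^esub> (3::nat) = \<one>\<^bsub>?P\<^esub>"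
    "(inv\<^bsub>?P\<^esub> ?g GenA \<otimes>\<^bsub>?P\<^esub> ?g GenB) [^]\<^bsub>?P\<^esub> (3::nat) = \<one>\<^bsub>?P\<^esub>"
    using presented_rel[of "wpow (gen GenA) 3" "[]" G39_rels] presented_rel[of "wpow (gen GenB) 3" "[]" G39_rels]
      presented_rel[of "wpow (gen GenA @ gen GenB) 3" "[]" G39_rels]
      presented_rel[of "wpow (winv (gen GenA) @ gen GenB) 3" "[]" G39_rels]
    by (simp_all only: ev word_eval_Nil) (simp_all add: G39_rels_def Let_def)
  show "G39_a \<in> carrier G39" "G39_b \<in> carrier G39"
    "G39_a [^]\<^bsub>G39\<^esub> (3::nat) = \<one>\<^bsub>G39\<^esub>" "G39_b [^]\<^bsub>G39\<^esub> (3::nat) = \<one>\<^bsub>G39\<^esub>"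
    "v \<otimes>\<^bsub>G39\<^esub> G39_b = G39_b \<otimes>\<^bsub>G39\<^esub> v" "v \<otimes>\<^bsub>G39\<^esub> G39_a = G39_a \<otimes>\<^bsub>G39\<^esub> v"
    unfolding v_def G39_def G39_a_def G39_b_def
    using rels cl P.commutator_central_of_exponent_3[OF cl cl rels] by blast+
qed

text \<open>The kernel of the covering map is the center, since the relations of \<open>G39\<close> hold in \<open>H\<close> modulo the center.\<close>

lemma G39_covering:
  "\<exists>\<pi> \<in> epi H G39. \<pi> eta1 = G39_b \<and> \<pi> eta3 = G39_a \<and> kernel H G39 \<pi> = center H"
proof -
  obtain \<pi> where \<pi>: "\<pi> \<in> hom H G39" "\<pi> eta1 = G39_b" "\<pi> eta3 = G39_a"
    "\<And>h. h \<in> center H \<Longrightarrow> \<pi> h = \<one>\<^bsub>G39\<^esub>"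
    using group.hom_from_H_mod_center[OF group_G39 G39_pair(2,1,4,3,5,6)] by blast
  define \<phi> where "\<phi> = (\<lambda>c. case c of GenA \<Rightarrow> eta3 | GenB \<Rightarrow> eta1)"
  have \<phi>: "\<phi> GenA = eta3" "\<phi> GenB = eta1" by (simp_all add: \<phi>_def)
  have \<phi>cl: "\<phi> c \<in> carrier H" for c by (cases c) (simp_all add: \<phi>)
  note evH = H.word_eval_simps[of \<phi>, OF \<phi>cl]
  have R: "word_eval H \<phi> u \<in> center H #>\<^bsub>H\<^esub> word_eval H \<phi> v" if "(u, v) \<in> G39_rels" for u v
  proof -
    have v: "v = []" using that by (auto simp: G39_rels_def Let_def)
    have "center H #>\<^bsub>H\<^esub> word_eval H \<phi> v = center H"
      using H.coset_mult_one[of "center H"] center_normal normal_imp_subgroup subgroup.subset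
      by (simp add: v center_H hbox_subset)
    moreover have "word_eval H \<phi> u \<in> center H"
      using that unfolding center_H G39_rels_def Let_def
      by (simp only: insert_iff empty_iff prod.inject simp_thms, elim disjE conjE)
        (simp_all only: evH \<phi> H_pow generators_in_H_set mult_H inv_H hmul_closed hinv_closed,
         simp_all add: eta1_def eta3_def res3_def)
    ultimately show ?thesis by simp
  qed
  have g: "generate H (range \<phi>) = carrier H"
    using \<phi>[symmetric] \<phi>cl by (intro generate_H_superset) (auto intro!: generate.incl)
  have "\<pi> (\<phi> c) = word_class G39_rels (gen c)" for c by (cases c) (simp_all add: \<phi> \<pi> G39_a_def G39_b_def)
  note q = presented_as_quotient[of "center H" H \<phi>, OF center_normal \<phi>cl g R \<pi>(1,4)[unfolded G39_def] this]
  then show ?thesis using \<pi> unfolding G39_def by blast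
qed

lemma G39_iso_Mod: "H Mod center H \<cong> G39"
  using G39_covering epi_Mod_kernel_iso[OF group_H group_G39] by fastforce

lemma order_G39: "order G39 = 27"
proof -
  have "card (center H) = 9" by (simp add: center_H hbox_def card_cartesian_product)
  moreover have "card (rcosets\<^bsub>H\<^esub> center H) * card (center H) = order H"
    using H.lagrange[OF normal_imp_subgroup[OF center_normal]] by simp
  ultimately have "card (rcosets\<^bsub>H\<^esub> center H) = 27" by (simp add: order_H)
  then have "order (H Mod center H) = 27" by (simp add: order_def FactGroup_def)
  then show ?thesis using G39_iso_Mod iso_same_card by (fastforce simp: order_def)
qed

text \<open>
  In the power-conjugate presentations, \<open>F1\<inverse>F2F1 = F2F3\<close>. So the pair for the universal property
  is \<open>x = F2\<close> and \<open>y = F1\<inverse>\<close>, with \<open>x\<inverse>yxy\<inverse> = F3\<close>.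
\<close>

lemma SmallGroup_27_3_iso_Mod: "H Mod center H \<cong> SmallGroup_27_3"
proof -
  define R where "R = {(wpow (gen f) 3, []) | f. True} \<union>
     {(wconj (winv (gen pc3.F1)) (gen pc3.F2), gen pc3.F2 @ gen pc3.F3),
      (wconj (winv (gen pc3.F1)) (gen pc3.F3), gen pc3.F3),
      (wconj (winv (gen pc3.F2)) (gen pc3.F3), gen pc3.F3)}"
  let ?P = "presented_group R"
  interpret P: group ?P by (rule group_presented_group)
  let ?g = "\<lambda>c. word_class R (gen c)"
  have cl: "\<And>c. ?g c \<in> carrier ?P" by simp
  note ev = P.word_eval_simps[of ?g, OF cl]
  have pow: "?g c [^]\<^bsub>?P\<^esub> (3::nat) = \<one>\<^bsub>?P\<^esub>" for c
    using presented_rel[of "wpow (gen c) 3" "[]" R] by (simp only: ev word_eval_Nil) (auto simp: R_def)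
  have conj: "inv\<^bsub>?P\<^esub> ?g pc3.F1 \<otimes>\<^bsub>?P\<^esub> ?g pc3.F2 \<otimes>\<^bsub>?P\<^esub> ?g pc3.F1 = ?g pc3.F2 \<otimes>\<^bsub>?P\<^esub> ?g pc3.F3"
    "inv\<^bsub>?P\<^esub> ?g pc3.F1 \<otimes>\<^bsub>?P\<^esub> ?g pc3.F3 \<otimes>\<^bsub>?P\<^esub> ?g pc3.F1 = ?g pc3.F3"
    "inv\<^bsub>?P\<^esub> ?g pc3.F2 \<otimes>\<^bsub>?P\<^esub> ?g pc3.F3 \<otimes>\<^bsub>?P\<^esub> ?g pc3.F2 = ?g pc3.F3"
    using presented_rel[of "wconj (winv (gen pc3.F1)) (gen pc3.F2)" "gen pc3.F2 @ gen pc3.F3" R]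
      presented_rel[of "wconj (winv (gen pc3.F1)) (gen pc3.F3)" "gen pc3.F3" R]
      presented_rel[of "wconj (winv (gen pc3.F2)) (gen pc3.F3)" "gen pc3.F3" R]
    by (simp_all only: ev P.inv_inv cl) (simp_all add: R_def)
  have ci: "inv\<^bsub>?P\<^esub> ?g pc3.F1 [^]\<^bsub>?P\<^esub> (3::nat) = \<one>\<^bsub>?P\<^esub>"
    using pow[of pc3.F1] P.nat_pow_inv[OF cl] by (metis P.inv_one)
  have v: "inv\<^bsub>?P\<^esub> ?g pc3.F2 \<otimes>\<^bsub>?P\<^esub> inv\<^bsub>?P\<^esub> ?g pc3.F1 \<otimes>\<^bsub>?P\<^esub> ?g pc3.F2 \<otimes>\<^bsub>?P\<^esub> inv\<^bsub>?P\<^esub> (inv\<^bsub>?P\<^esub> ?g pc3.F1) = ?g pc3.F3"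
    using conj(1) cl by (simp add: P.m_assoc) (simp add: P.m_assoc[symmetric])
  have com: "?g pc3.F3 \<otimes>\<^bsub>?P\<^esub> ?g pc3.F2 = ?g pc3.F2 \<otimes>\<^bsub>?P\<^esub> ?g pc3.F3"
    "?g pc3.F3 \<otimes>\<^bsub>?P\<^esub> inv\<^bsub>?P\<^esub> ?g pc3.F1 = inv\<^bsub>?P\<^esub> ?g pc3.F1 \<otimes>\<^bsub>?P\<^esub> ?g pc3.F3"
    using conj(2,3) cl by (metis P.inv_solve_left P.m_assoc P.m_closed P.inv_closed P.inv_solve_right)+
  obtain \<pi> where \<pi>: "\<pi> \<in> hom H ?P" "\<pi> eta1 = ?g pc3.F2" "\<pi> eta3 = inv\<^bsub>?P\<^esub> ?g pc3.F1"
    "\<And>h. h \<in> center H \<Longrightarrow> \<pi> h = \<one>\<^bsub>?P\<^esub>"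
    using P.hom_from_H_mod_center[OF cl[of pc3.F2] P.inv_closed[OF cl[of pc3.F1]], unfolded v, OF pow ci com] by blast
  interpret \<pi>: group_hom H ?P \<pi>
    using \<pi>(1) by (simp add: group_hom_def group_hom_axioms_def group_H P.is_group)
  define \<phi> where "\<phi> = (\<lambda>c. case c of pc3.F1 \<Rightarrow> inv\<^bsub>H\<^esub> eta3 | pc3.F2 \<Rightarrow> eta1
    | pc3.F3 \<Rightarrow> inv\<^bsub>H\<^esub> eta1 \<otimes>\<^bsub>H\<^esub> eta3 \<otimes>\<^bsub>H\<^esub> eta1 \<otimes>\<^bsub>H\<^esub> inv\<^bsub>H\<^esub> eta3)"
  have \<phi>: "\<phi> pc3.F1 = (0, 0, 0, 0, 2)" "\<phi> pc3.F2 = eta1" "\<phi> pc3.F3 = (1, 0, 0, 2, 0)"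
    by (simp_all add: \<phi>_def hmul_closed hinv_closed) (simp_all add: eta1_def eta3_def res3_def)
  have \<phi>cl: "\<phi> c \<in> carrier H" for c by (cases c) (simp_all add: \<phi>)
  note evH = H.word_eval_simps[of \<phi>, OF \<phi>cl]
  have R: "word_eval H \<phi> u \<in> center H #>\<^bsub>H\<^esub> word_eval H \<phi> v" if "(u, v) \<in> R" for u v
  proof (rule in_center_coset)
    show "word_eval H \<phi> u \<in> H_set" "word_eval H \<phi> v \<in> H_set"
      using H.word_eval_closed[of \<phi>] \<phi>cl by simp_all
    have cube: "hmul (word_eval H \<phi> (wpow (gen c) 3)) (hinv (word_eval H \<phi> [])) \<in> center H" for c
      by (cases c; simp only: evH \<phi> H_pow generators_in_H_set word_eval_Nil one_H in_H_set;
          simp add: center_H H_pow eta1_def res3_def)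
    show "hmul (word_eval H \<phi> u) (hinv (word_eval H \<phi> v)) \<in> center H"
      using that unfolding R_def
      apply (elim UnE)
       apply (use cube in blast)
      apply (simp only: insert_iff empty_iff prod.inject simp_thms)
      apply (elim disjE conjE)
      apply (simp_all only: evH \<phi>)
      apply (simp_all add: hmul_closed hinv_closed center_H)
      apply (simp_all add: eta1_def eta3_def res3_def)
      done
  qed
  have g: "generate H (range \<phi>) = carrier H"
  proof (rule generate_H_superset)
    show "eta1 \<in> generate H (range \<phi>)" using \<phi>(2) by (metis generate.incl rangeI)
    have "inv\<^bsub>H\<^esub> (\<phi> pc3.F1) \<in> generate H (range \<phi>)" by (intro generate.inv) simp
    then show "eta3 \<in> generate H (range \<phi>)" by (simp add: \<phi> eta3_def res3_def)
  qed (use \<phi>cl in auto)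
  have e: "eta1 \<in> carrier H" "eta3 \<in> carrier H" by simp_all
  have "\<pi> (\<phi> c) = word_class R (gen c)" for c
    using v e by (cases c) (simp_all add: \<phi>_def \<pi> del: inv_H mult_H carrier_H)
  note q = presented_as_quotient[of "center H" H \<phi>, OF center_normal \<phi>cl g R \<pi>(1,4) this]
  show ?thesis
    using epi_Mod_kernel_iso[OF group_H P.is_group q(1)] q(2) unfolding SmallGroup_27_3_def R_def by simp
qed

text \<open>
  Here \<open>[F3, F2] = F5\<close> and \<open>[F1\<inverse>, F3] = F4\<close> are central, and they are the images of \<open>z\<^sub>1\<^sub>2\<close> and
  \<open>z\<^sub>2\<^sub>3\<close>. All relations hold in \<open>H\<close> exactly, so the kernel is trivial.
\<close>

lemma SmallGroup_243_3_iso: "H \<cong> SmallGroup_243_3"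
proof -
  define R where "R = {(wpow (gen f) 3, []) | f. True} \<union>
     {(wconj (winv (gen F1)) (gen F2), gen F2 @ gen F3),
      (wconj (winv (gen F1)) (gen F3), gen F3 @ gen F4),
      (wconj (winv (gen F1)) (gen F4), gen F4),
      (wconj (winv (gen F1)) (gen F5), gen F5),
      (wconj (winv (gen F2)) (gen F3), gen F3 @ gen F5),
      (wconj (winv (gen F2)) (gen F4), gen F4),
      (wconj (winv (gen F2)) (gen F5), gen F5),
      (wconj (winv (gen F3)) (gen F4), gen F4),
      (wconj (winv (gen F3)) (gen F5), gen F5),
      (wconj (winv (gen F4)) (gen F5), gen F5)}"
  let ?P = "presented_group R"
  interpret P: group ?P by (rule group_presented_group)
  let ?g = "\<lambda>c. word_class R (gen c)"
  have cl: "\<And>c. ?g c \<in> carrier ?P" by simp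
  note ev = P.word_eval_simps[of ?g, OF cl]
  have pow: "?g c [^]\<^bsub>?P\<^esub> (3::nat) = \<one>\<^bsub>?P\<^esub>" for c
    using presented_rel[of "wpow (gen c) 3" "[]" R] by (simp only: ev word_eval_Nil) (auto simp: R_def)
  have conj: "?g d \<otimes>\<^bsub>?P\<^esub> ?g c = ?g c \<otimes>\<^bsub>?P\<^esub> word_eval ?P ?g w"
    if "(wconj (winv (gen c)) (gen d), w) \<in> R" for c d w
  proof -
    have "inv\<^bsub>?P\<^esub> ?g c \<otimes>\<^bsub>?P\<^esub> ?g d \<otimes>\<^bsub>?P\<^esub> ?g c = word_eval ?P ?g w"
      using presented_rel[OF that] by (simp only: ev P.inv_inv cl)
    then show ?thesis
      using cl P.word_eval_closed[of ?g w, OF cl] by (metis P.inv_solve_left P.m_assoc P.m_closed P.inv_closed)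
  qed
  have c21: "?g F2 \<otimes>\<^bsub>?P\<^esub> ?g F1 = ?g F1 \<otimes>\<^bsub>?P\<^esub> (?g F2 \<otimes>\<^bsub>?P\<^esub> ?g F3)"
    and c31: "?g F3 \<otimes>\<^bsub>?P\<^esub> ?g F1 = ?g F1 \<otimes>\<^bsub>?P\<^esub> (?g F3 \<otimes>\<^bsub>?P\<^esub> ?g F4)"
    and c32: "?g F3 \<otimes>\<^bsub>?P\<^esub> ?g F2 = ?g F2 \<otimes>\<^bsub>?P\<^esub> (?g F3 \<otimes>\<^bsub>?P\<^esub> ?g F5)"
    and c41: "?g F4 \<otimes>\<^bsub>?P\<^esub> ?g F1 = ?g F1 \<otimes>\<^bsub>?P\<^esub> ?g F4" and c42: "?g F4 \<otimes>\<^bsub>?P\<^esub> ?g F2 = ?g F2 \<otimes>\<^bsub>?P\<^esub> ?g F4"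
    and c43: "?g F4 \<otimes>\<^bsub>?P\<^esub> ?g F3 = ?g F3 \<otimes>\<^bsub>?P\<^esub> ?g F4" and c51: "?g F5 \<otimes>\<^bsub>?P\<^esub> ?g F1 = ?g F1 \<otimes>\<^bsub>?P\<^esub> ?g F5"
    and c52: "?g F5 \<otimes>\<^bsub>?P\<^esub> ?g F2 = ?g F2 \<otimes>\<^bsub>?P\<^esub> ?g F5" and c53: "?g F5 \<otimes>\<^bsub>?P\<^esub> ?g F3 = ?g F3 \<otimes>\<^bsub>?P\<^esub> ?g F5"
    using conj[of F1 F2 "gen F2 @ gen F3"] conj[of F1 F3 "gen F3 @ gen F4"] conj[of F2 F3 "gen F3 @ gen F5"]
      conj[of F1 F4 "gen F4"] conj[of F2 F4 "gen F4"] conj[of F3 F4 "gen F4"]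
      conj[of F1 F5 "gen F5"] conj[of F2 F5 "gen F5"] conj[of F3 F5 "gen F5"]
    by (simp_all only: ev) (simp_all add: R_def)
  have ci: "inv\<^bsub>?P\<^esub> ?g F1 [^]\<^bsub>?P\<^esub> (3::nat) = \<one>\<^bsub>?P\<^esub>"
    using pow[of F1] P.nat_pow_inv[OF cl] by (metis P.inv_one)
  have v: "inv\<^bsub>?P\<^esub> ?g F2 \<otimes>\<^bsub>?P\<^esub> inv\<^bsub>?P\<^esub> ?g F1 \<otimes>\<^bsub>?P\<^esub> ?g F2 \<otimes>\<^bsub>?P\<^esub> inv\<^bsub>?P\<^esub> (inv\<^bsub>?P\<^esub> ?g F1) = ?g F3"
    using c21 by (simp add: P.m_assoc) (simp add: P.m_assoc[symmetric])
  have \<alpha>: "?g F3 \<otimes>\<^bsub>?P\<^esub> ?g F2 \<otimes>\<^bsub>?P\<^esub> inv\<^bsub>?P\<^esub> ?g F3 \<otimes>\<^bsub>?P\<^esub> inv\<^bsub>?P\<^esub> ?g F2 = ?g F5"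
    unfolding c32 c53[symmetric]
    by (simp add: P.m_assoc, simp add: P.m_assoc[symmetric] c52[symmetric], simp add: P.m_assoc)
  have \<beta>: "inv\<^bsub>?P\<^esub> ?g F1 \<otimes>\<^bsub>?P\<^esub> ?g F3 \<otimes>\<^bsub>?P\<^esub> inv\<^bsub>?P\<^esub> (inv\<^bsub>?P\<^esub> ?g F1) \<otimes>\<^bsub>?P\<^esub> inv\<^bsub>?P\<^esub> ?g F3 = ?g F4"
  proof -
    have "inv\<^bsub>?P\<^esub> ?g F1 \<otimes>\<^bsub>?P\<^esub> ?g F3 \<otimes>\<^bsub>?P\<^esub> inv\<^bsub>?P\<^esub> (inv\<^bsub>?P\<^esub> ?g F1) \<otimes>\<^bsub>?P\<^esub> inv\<^bsub>?P\<^esub> ?g F3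
      = inv\<^bsub>?P\<^esub> ?g F1 \<otimes>\<^bsub>?P\<^esub> (?g F3 \<otimes>\<^bsub>?P\<^esub> ?g F1) \<otimes>\<^bsub>?P\<^esub> inv\<^bsub>?P\<^esub> ?g F3"
      by (simp add: P.m_assoc)
    also have "\<dots> = ?g F4"
      unfolding c31 c43[symmetric] by (simp add: P.m_assoc) (simp add: P.m_assoc[symmetric])
    finally show ?thesis .
  qed
  have com: "inv\<^bsub>?P\<^esub> ?g F1 \<otimes>\<^bsub>?P\<^esub> ?g F5 = ?g F5 \<otimes>\<^bsub>?P\<^esub> inv\<^bsub>?P\<^esub> ?g F1"
    "inv\<^bsub>?P\<^esub> ?g F1 \<otimes>\<^bsub>?P\<^esub> ?g F4 = ?g F4 \<otimes>\<^bsub>?P\<^esub> inv\<^bsub>?P\<^esub> ?g F1"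
    using P.commute_inv[OF c51 cl cl] P.commute_inv[OF c41 cl cl] by simp_all
  obtain \<pi> where \<pi>: "\<pi> \<in> hom H ?P" "\<pi> eta1 = ?g F2" "\<pi> eta3 = inv\<^bsub>?P\<^esub> ?g F1" "\<pi> z12 = ?g F5" "\<pi> z23 = ?g F4"
    using P.hom_from_H[OF cl[of F2] P.inv_closed[OF cl[of F1]], unfolded v, unfolded \<alpha> \<beta>,
        OF pow ci c52[symmetric] com(1) c42[symmetric] com(2)] by blast
  interpret \<pi>: group_hom H ?P \<pi>
    using \<pi>(1) by (simp add: group_hom_def group_hom_axioms_def group_H P.is_group)
  define \<phi> where "\<phi> = (\<lambda>c. case c of F1 \<Rightarrow> inv\<^bsub>H\<^esub> eta3 | F2 \<Rightarrow> eta1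
    | F3 \<Rightarrow> inv\<^bsub>H\<^esub> eta1 \<otimes>\<^bsub>H\<^esub> eta3 \<otimes>\<^bsub>H\<^esub> eta1 \<otimes>\<^bsub>H\<^esub> inv\<^bsub>H\<^esub> eta3 | F4 \<Rightarrow> z23 | F5 \<Rightarrow> z12)"
  have \<phi>: "\<phi> F1 = (0, 0, 0, 0, 2)" "\<phi> F2 = eta1" "\<phi> F3 = (1, 0, 0, 2, 0)" "\<phi> F4 = z23" "\<phi> F5 = z12"
    by (simp_all add: \<phi>_def hmul_closed hinv_closed) (simp_all add: eta1_def eta3_def res3_def)
  have \<phi>cl: "\<phi> c \<in> carrier H" for c by (cases c) (simp_all add: \<phi>)
  note evH = H.word_eval_simps[of \<phi>, OF \<phi>cl]
  have R: "word_eval H \<phi> u \<in> {\<one>\<^bsub>H\<^esub>} #>\<^bsub>H\<^esub> word_eval H \<phi> v" if "(u, v) \<in> R" for u v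
  proof -
    have cube: "word_eval H \<phi> (wpow (gen c) 3) = word_eval H \<phi> []" for c
      by (cases c; simp only: evH \<phi> H_pow generators_in_H_set word_eval_Nil one_H in_H_set;
          simp add: H_pow eta1_def z12_def z23_def res3_def)
    have "word_eval H \<phi> u = word_eval H \<phi> v"
      using that unfolding R_def
      apply (elim UnE)
       apply (use cube in blast)
      apply (simp only: insert_iff empty_iff prod.inject simp_thms)
      apply (elim disjE conjE)
      apply (simp_all only: evH \<phi>)
      apply (simp_all add: hmul_closed hinv_closed)
      apply (simp_all add: eta1_def eta3_def z12_def z23_def res3_def)
      done
    moreover have "word_eval H \<phi> v \<in> carrier H" using H.word_eval_closed[of \<phi>] \<phi>cl by simp
    ultimately show ?thesis by (simp add: r_coset_def hmul_one)
  qed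
  have g: "generate H (range \<phi>) = carrier H"
  proof (rule generate_H_superset)
    show "eta1 \<in> generate H (range \<phi>)" using \<phi>(2) by (metis generate.incl rangeI)
    have "inv\<^bsub>H\<^esub> (\<phi> F1) \<in> generate H (range \<phi>)" by (intro generate.inv) simp
    then show "eta3 \<in> generate H (range \<phi>)" by (simp add: \<phi> eta3_def res3_def)
  qed (use \<phi>cl in auto)
  have e: "eta1 \<in> carrier H" "eta3 \<in> carrier H" by simp_all
  have "\<pi> (\<phi> c) = word_class R (gen c)" for c
    using v e by (cases c) (simp_all add: \<phi>_def \<pi> del: inv_H mult_H carrier_H)
  moreover have "\<pi> h = \<one>\<^bsub>?P\<^esub>" if "h \<in> {\<one>\<^bsub>H\<^esub>}" for h
    using that \<pi>.hom_one by simp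
  ultimately have "\<pi> \<in> epi H ?P" "kernel H ?P \<pi> = {\<one>\<^bsub>H\<^esub>}"
    using presented_as_quotient[of "{\<one>\<^bsub>H\<^esub>}" H \<phi> R \<pi>, OF H.one_is_normal \<phi>cl g R \<pi>(1)] by blast+
  then have "\<pi> \<in> iso H ?P"
    using iso_kernel_image[OF group_H P.is_group] by (simp add: epi_def)
  then show ?thesis unfolding SmallGroup_243_3_def R_def is_iso_def by blast
qed

section \<open>The Schur multiplier of a centrally covered group\<close>

text \<open>The group of characters with values in \<open>\<complex>\<^sup>\<times>\<close>, as extensional functions.\<close>

definition char_group :: "('a, 'm) monoid_scheme \<Rightarrow> ('a \<Rightarrow> complex) monoid"
  where "char_group A =
    \<lparr> carrier = {\<chi> \<in> carrier A \<rightarrow>\<^sub>E (- {0}). \<forall>x \<in> carrier A. \<forall>y \<in> carrier A. \<chi> (x \<otimes>\<^bsub>A\<^esub> y) = \<chi> x * \<chi> y},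
      monoid.mult = (\<lambda>\<chi> \<chi>'. \<lambda>x \<in> carrier A. \<chi> x * \<chi>' x),
      one = (\<lambda>x \<in> carrier A. 1) \<rparr>"

lemma group_char_group:
  assumes "group A"
  shows "group (char_group A)"
proof -
  interpret A: group A by fact
  show ?thesis
  proof (rule groupI)
    fix \<chi> assume "\<chi> \<in> carrier (char_group A)"
    then show "\<exists>\<chi>'\<in>carrier (char_group A). \<chi>' \<otimes>\<^bsub>char_group A\<^esub> \<chi> = \<one>\<^bsub>char_group A\<^esub>"
      by (intro bexI[of _ "\<lambda>x \<in> carrier A. 1 / \<chi> x"])
        (auto simp: char_group_def PiE_iff intro!: restrict_ext)
  qed (auto simp: char_group_def PiE_iff restrict_def extensional_def fun_eq_iff mult_ac)
qed

lemma cocycles2_mem: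
  "f \<in> carrier (cocycles2 G) \<longleftrightarrow> f \<in> extensional (carrier G \<times> carrier G)
    \<and> (\<forall>x \<in> carrier G. \<forall>y \<in> carrier G. f (x, y) \<noteq> 0)
    \<and> (\<forall>x \<in> carrier G. \<forall>y \<in> carrier G. \<forall>z \<in> carrier G.
          f (x, y) * f (x \<otimes>\<^bsub>G\<^esub> y, z) = f (y, z) * f (x, y \<otimes>\<^bsub>G\<^esub> z))"
  by (auto simp: cocycles2_def PiE_iff)

lemma group_cocycles2:
  assumes "group G"
  shows "group (cocycles2 G)"
proof -
  interpret G: group G by fact
  have m: "f \<otimes>\<^bsub>cocycles2 G\<^esub> g = (\<lambda>p \<in> carrier G \<times> carrier G. f p * g p)" for f g
    by (simp add: cocycles2_def)
  have o: "\<one>\<^bsub>cocycles2 G\<^esub> = (\<lambda>p \<in> carrier G \<times> carrier G. 1)"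
    by (simp add: cocycles2_def)
  have prod4: "a * e * (b * d) = a' * e' * (b' * d')" if "a * b = a' * b'" "e * d = e' * d'"
    for a b d e a' b' d' e' :: complex
  proof -
    have "a * e * (b * d) = (a * b) * (e * d)" by (simp add: mult_ac)
    also have "\<dots> = a' * e' * (b' * d')" unfolding that by (simp add: mult_ac)
    finally show ?thesis .
  qed
  show ?thesis
  proof (rule groupI)
    fix f g assume "f \<in> carrier (cocycles2 G)" "g \<in> carrier (cocycles2 G)"
    note fg = this[unfolded cocycles2_mem]
    show "f \<otimes>\<^bsub>cocycles2 G\<^esub> g \<in> carrier (cocycles2 G)"
      unfolding cocycles2_mem m
    proof (intro conjI ballI)
      let ?fg = "\<lambda>p \<in> carrier G \<times> carrier G. f p * g p"
      fix x y assume xy: "x \<in> carrier G" "y \<in> carrier G"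
      then show "?fg (x, y) \<noteq> 0" using fg by simp
      fix z assume z: "z \<in> carrier G"
      have "f (x, y) * f (x \<otimes>\<^bsub>G\<^esub> y, z) = f (y, z) * f (x, y \<otimes>\<^bsub>G\<^esub> z)"
        "g (x, y) * g (x \<otimes>\<^bsub>G\<^esub> y, z) = g (y, z) * g (x, y \<otimes>\<^bsub>G\<^esub> z)"
        using fg xy z by blast+
      from prod4[OF this]
      show "?fg (x, y) * ?fg (x \<otimes>\<^bsub>G\<^esub> y, z) = ?fg (y, z) * ?fg (x, y \<otimes>\<^bsub>G\<^esub> z)"
        using xy z by simp
    qed simp
  next
    fix f assume f: "f \<in> carrier (cocycles2 G)"
    then show "\<exists>g\<in>carrier (cocycles2 G). g \<otimes>\<^bsub>cocycles2 G\<^esub> f = \<one>\<^bsub>cocycles2 G\<^esub>"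
      by (intro bexI[of _ "\<lambda>p \<in> carrier G \<times> carrier G. 1 / f p"])
        (auto simp: m o cocycles2_mem intro!: restrict_ext)
    show "\<one>\<^bsub>cocycles2 G\<^esub> \<otimes>\<^bsub>cocycles2 G\<^esub> f = f"
      using f by (auto simp: m o cocycles2_mem extensional_def)
  qed (auto simp: m o cocycles2_mem mult_ac intro!: restrict_ext)
qed

lemma (in group) character_trivial_on_derived:
  fixes r :: "'a \<Rightarrow> complex"
  assumes nz: "\<And>h. h \<in> carrier G \<Longrightarrow> r h \<noteq> 0"
    and mult: "\<And>h k. h \<in> carrier G \<Longrightarrow> k \<in> carrier G \<Longrightarrow> r (h \<otimes> k) = r h * r k"
    and h: "h \<in> derived G (carrier G)"
  shows "r h = 1"
proof -
  have one: "r \<one> = 1" using mult[of \<one> \<one>] nz[of \<one>] by simp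
  have inv: "r (inv h) = 1 / r h" if "h \<in> carrier G" for h
    using mult[of h "inv h"] nz[of h] that one by (simp add: field_simps)
  have "subgroup {h \<in> carrier G. r h = 1} G"
    by unfold_locales (auto simp: one inv mult)
  moreover have "derived_set G (carrier G) \<subseteq> {h \<in> carrier G. r h = 1}"
    using nz by (auto simp: mult inv)
  ultimately have "derived G (carrier G) \<subseteq> {h \<in> carrier G. r h = 1}"
    unfolding derived_def by (rule generate_subgroup_incl[rotated])
  then show ?thesis using h by blast
qed

text \<open>
  Let \<open>\<pi>\<close> map \<open>L\<close> onto \<open>G\<close> with kernel \<open>A\<close> in \<open>Z(L) \<inter> [L,L]\<close>, and let every cocycle of \<open>G\<close>
  become a coboundary \<open>\<partial>c\<close> on \<open>L\<close>. As characters of \<open>L\<close> are trivial on \<open>A\<close>, the cocycle determines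
  \<open>c\<close> on \<open>A\<close>, and \<open>c\<close> is there a character up to the factor \<open>c(1)\<close>. The resulting map from
  cocycles to characters of \<open>A\<close> is onto, with the coboundaries as kernel.
\<close>

theorem schur_multiplier_iso_char_group:
  fixes L :: "('a, 'm) monoid_scheme" and G :: "('b, 'n) monoid_scheme"
  assumes L: "group L" and G: "group G" and \<pi>: "\<pi> \<in> epi L G"
    and A: "kernel L G \<pi> \<subseteq> center L \<inter> derived L (carrier L)"
    and cob: "\<And>f. f \<in> carrier (cocycles2 G) \<Longrightarrow>
      \<exists>c. (\<forall>h \<in> carrier L. c h \<noteq> 0) \<and>
        (\<forall>h \<in> carrier L. \<forall>k \<in> carrier L. f (\<pi> h, \<pi> k) = c h * c k / c (h \<otimes>\<^bsub>L\<^esub> k))"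
  shows "group (schur_multiplier G)"
    and "schur_multiplier G \<cong> char_group (subgrp L (kernel L G \<pi>))"
proof -
  let ?A = "kernel L G \<pi>"
  interpret L: group L by fact
  interpret G: group G by fact
  interpret \<pi>: group_hom L G \<pi>
    using \<pi> L G by (simp add: group_hom_def group_hom_axioms_def epi_def)
  interpret Z: group "cocycles2 G" by (rule group_cocycles2[OF G])
  have A_grp: "group (subgrp L ?A)"
    unfolding subgrp_def by (rule L.subgroup_imp_group[OF \<pi>.subgroup_kernel])
  have A_simps: "carrier (subgrp L ?A) = ?A" "x \<otimes>\<^bsub>subgrp L ?A\<^esub> y = x \<otimes>\<^bsub>L\<^esub> y" for x y
    by (simp_all add: subgrp_def)
  have A_sub: "a \<in> carrier L" "\<pi> a = \<one>\<^bsub>G\<^esub>" if "a \<in> ?A" for a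
    using that by (auto simp: kernel_def)
  have A_one: "\<one>\<^bsub>L\<^esub> \<in> ?A" using \<pi>.subgroup_kernel subgroup.one_closed by blast
  have central: "a \<otimes>\<^bsub>L\<^esub> h = h \<otimes>\<^bsub>L\<^esub> a" if "a \<in> ?A" "h \<in> carrier L" for a h
    using that A by (auto simp: center_def)
  \<comment> \<open>The pullback of \<open>f\<close> along \<open>\<pi>\<close> is the coboundary of \<open>c\<close>.\<close>
  define trivializes where "trivializes f c \<longleftrightarrow> (\<forall>h \<in> carrier L. c h \<noteq> (0::complex)) \<and>
        (\<forall>h \<in> carrier L. \<forall>k \<in> carrier L. f (\<pi> h, \<pi> k) = c h * c k / c (h \<otimes>\<^bsub>L\<^esub> k))" for f c
  \<comment> \<open>Two such \<open>c\<close> differ by a character of \<open>L\<close>, which is trivial on \<open>A\<close>.\<close>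
  have unique: "c a = d a" if "trivializes f c" "trivializes f d" "a \<in> ?A" for f c d a
  proof -
    have "(\<lambda>h. c h / d h) a = 1"
    proof (rule L.character_trivial_on_derived)
      show "c h / d h \<noteq> 0" if "h \<in> carrier L" for h
        using that \<open>trivializes f c\<close> \<open>trivializes f d\<close> by (auto simp: trivializes_def)
      show "c (h \<otimes>\<^bsub>L\<^esub> k) / d (h \<otimes>\<^bsub>L\<^esub> k) = c h / d h * (c k / d k)"
        if "h \<in> carrier L" "k \<in> carrier L" for h k
      proof -
        have "c h * c k / c (h \<otimes>\<^bsub>L\<^esub> k) = d h * d k / d (h \<otimes>\<^bsub>L\<^esub> k)"
          using that \<open>trivializes f c\<close> \<open>trivializes f d\<close> unfolding trivializes_def by metis
        moreover have "c h \<noteq> 0" "c k \<noteq> 0" "c (h \<otimes>\<^bsub>L\<^esub> k) \<noteq> 0" "d h \<noteq> 0" "d k \<noteq> 0" "d (h \<otimes>\<^bsub>L\<^esub> k) \<noteq> 0"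
          using that \<open>trivializes f c\<close> \<open>trivializes f d\<close> by (auto simp: trivializes_def)
        ultimately show ?thesis by (simp add: field_simps)
      qed
      show "a \<in> derived L (carrier L)" using A that(3) by blast
    qed
    moreover have "d a \<noteq> 0" using that A_sub by (auto simp: trivializes_def)
    ultimately show ?thesis by simp
  qed
  define cf where "cf f = (SOME c. trivializes f c)" for f
  have cf: "trivializes f (cf f)" if "f \<in> carrier (cocycles2 G)" for f
  proof -
    have "\<exists>c. trivializes f c" using cob[OF that] by (simp only: trivializes_def)
    then show ?thesis unfolding cf_def by (rule someI_ex)
  qed
  define T where "T f = (\<lambda>a \<in> ?A. cf f a / cf f \<one>\<^bsub>L\<^esub>)" for f
  have T: "T f = (\<lambda>a \<in> ?A. c a / c \<one>\<^bsub>L\<^esub>)" if "f \<in> carrier (cocycles2 G)" "trivializes f c" for f c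
    unfolding T_def using unique[OF cf[OF that(1)] that(2)] A_one by (auto intro!: restrict_ext)
  have bmult: "c (a \<otimes>\<^bsub>L\<^esub> h) * c \<one>\<^bsub>L\<^esub> = c a * c h"
    if "f \<in> carrier (cocycles2 G)" "trivializes f c" "a \<in> ?A" "h \<in> carrier L" for f c a h
  proof -
    have nz: "c a \<noteq> 0" "c h \<noteq> 0" "c (a \<otimes>\<^bsub>L\<^esub> h) \<noteq> 0" "c \<one>\<^bsub>L\<^esub> \<noteq> 0" "f (\<one>\<^bsub>G\<^esub>, \<pi> h) \<noteq> 0"
      using that A_sub \<pi>.hom_closed by (auto simp: trivializes_def cocycles2_mem)
    have "f (\<one>\<^bsub>G\<^esub>, \<one>\<^bsub>G\<^esub>) * f (\<one>\<^bsub>G\<^esub> \<otimes>\<^bsub>G\<^esub> \<one>\<^bsub>G\<^esub>, \<pi> h) = f (\<one>\<^bsub>G\<^esub>, \<pi> h) * f (\<one>\<^bsub>G\<^esub>, \<one>\<^bsub>G\<^esub> \<otimes>\<^bsub>G\<^esub> \<pi> h)"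
      using that(1,4) \<pi>.hom_closed unfolding cocycles2_mem by blast
    then have "f (\<one>\<^bsub>G\<^esub>, \<pi> h) = f (\<one>\<^bsub>G\<^esub>, \<one>\<^bsub>G\<^esub>)"
      using nz that(4) by simp
    moreover have "f (\<pi> a, \<pi> h) = c a * c h / c (a \<otimes>\<^bsub>L\<^esub> h)"
      "f (\<pi> \<one>\<^bsub>L\<^esub>, \<pi> \<one>\<^bsub>L\<^esub>) = c \<one>\<^bsub>L\<^esub> * c \<one>\<^bsub>L\<^esub> / c (\<one>\<^bsub>L\<^esub> \<otimes>\<^bsub>L\<^esub> \<one>\<^bsub>L\<^esub>)"
      using that A_sub unfolding trivializes_def by blast+
    ultimately show ?thesis using nz A_sub[OF that(3)] by (simp add: field_simps)
  qed
  have T_hom: "T \<in> hom (cocycles2 G) (char_group (subgrp L ?A))"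
  proof (rule homI)
    fix f assume f: "f \<in> carrier (cocycles2 G)"
    have nz: "cf f h \<noteq> 0" if "h \<in> carrier L" for h using cf[OF f] that by (auto simp: trivializes_def)
    have "T f (a \<otimes>\<^bsub>L\<^esub> b) = T f a * T f b" if "a \<in> ?A" "b \<in> ?A" for a b
      using bmult[OF f cf[OF f] that(1)] A_sub(1)[OF that(2)] nz that subgroup.m_closed[OF \<pi>.subgroup_kernel]
      by (simp add: T_def field_simps)
    then show "T f \<in> carrier (char_group (subgrp L ?A))"
      using nz A_sub by (auto simp: char_group_def A_simps T_def)
  next
    fix f g assume fg: "f \<in> carrier (cocycles2 G)" "g \<in> carrier (cocycles2 G)"
    have "trivializes (f \<otimes>\<^bsub>cocycles2 G\<^esub> g) (\<lambda>h. cf f h * cf g h)"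
      using cf[OF fg(1)] cf[OF fg(2)] by (simp add: trivializes_def cocycles2_def)
    from T[OF Z.m_closed[OF fg] this] show "T (f \<otimes>\<^bsub>cocycles2 G\<^esub> g) = T f \<otimes>\<^bsub>char_group (subgrp L ?A)\<^esub> T g"
      by (auto simp: T_def char_group_def A_simps intro!: restrict_ext)
  qed
  interpret T: group_hom "cocycles2 G" "char_group (subgrp L ?A)" T
    using T_hom group_char_group[OF A_grp] Z.is_group by (simp add: group_hom_def group_hom_axioms_def)
  \<comment> \<open>A section of \<open>\<pi>\<close>.\<close>
  define s where "s x = (SOME h. h \<in> carrier L \<and> \<pi> h = x)" for x
  have s: "s x \<in> carrier L" "\<pi> (s x) = x" if "x \<in> carrier G" for x
  proof -
    have "x \<in> \<pi> ` carrier L" using that \<pi> by (simp add: epi_def)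
    then have "\<exists>h. h \<in> carrier L \<and> \<pi> h = x" by blast
    then have "s x \<in> carrier L \<and> \<pi> (s x) = x" unfolding s_def by (rule someI_ex)
    then show "s x \<in> carrier L" "\<pi> (s x) = x" by simp_all
  qed
  have fibre: "h \<otimes>\<^bsub>L\<^esub> inv\<^bsub>L\<^esub> s (\<pi> h) \<in> ?A" "h = (h \<otimes>\<^bsub>L\<^esub> inv\<^bsub>L\<^esub> s (\<pi> h)) \<otimes>\<^bsub>L\<^esub> s (\<pi> h)"
    if "h \<in> carrier L" for h
    using that s[of "\<pi> h"] by (auto simp: kernel_def L.m_assoc)
  \<comment> \<open>If \<open>c\<close> is constant on \<open>A\<close>, then it is constant on the fibres of \<open>\<pi>\<close> and descends to \<open>G\<close>.\<close>
  have cobd: "f \<in> coboundaries2 G" if f: "f \<in> carrier (cocycles2 G)" and Tf: "T f = \<one>\<^bsub>char_group (subgrp L ?A)\<^esub>" for f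
  proof -
    let ?c = "cf f" and ?d = "\<lambda>x. cf f (s x)"
    have c: "trivializes f ?c" by (rule cf[OF f])
    have nz: "?c h \<noteq> 0" if "h \<in> carrier L" for h using c that by (auto simp: trivializes_def)
    have "?c a = ?c \<one>\<^bsub>L\<^esub>" if "a \<in> ?A" for a
      using fun_cong[OF Tf, of a] that nz by (simp add: T_def char_group_def A_simps)
    then have fib: "?c h = ?d (\<pi> h)" if "h \<in> carrier L" for h
      using bmult[OF f c fibre(1)[OF that], of "s (\<pi> h)"] fibre[OF that] that s[of "\<pi> h"] nz
      by simp
    have fd: "f (\<pi> h, \<pi> k) = ?d (\<pi> h) * ?d (\<pi> k) / ?d (\<pi> h \<otimes>\<^bsub>G\<^esub> \<pi> k)"
      if "h \<in> carrier L" "k \<in> carrier L" for h k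
    proof -
      have "f (\<pi> h, \<pi> k) = ?c h * ?c k / ?c (h \<otimes>\<^bsub>L\<^esub> k)"
        using c that unfolding trivializes_def by blast
      then show ?thesis
        unfolding fib[OF that(1)] fib[OF that(2)] fib[OF L.m_closed[OF that]] \<pi>.hom_mult[OF that] .
    qed
    then have "f (x, y) = ?d x * ?d y / ?d (x \<otimes>\<^bsub>G\<^esub> y)" if "x \<in> carrier G" "y \<in> carrier G" for x y
      using fd[of "s x" "s y"] s that by simp
    then have "f = (\<lambda>(x, y) \<in> carrier G \<times> carrier G. ?d x * ?d y / ?d (x \<otimes>\<^bsub>G\<^esub> y))"
      using f by (auto simp: cocycles2_mem extensional_def fun_eq_iff)
    moreover have "\<forall>x \<in> carrier G. ?d x \<noteq> 0" using nz s(1) by simp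
    ultimately show ?thesis unfolding coboundaries2_def by (intro CollectI exI[of _ ?d] conjI)
  qed
  have cobd': "f \<in> carrier (cocycles2 G) \<and> T f = \<one>\<^bsub>char_group (subgrp L ?A)\<^esub>" if fB: "f \<in> coboundaries2 G" for f
  proof -
    from fB obtain d where f: "f = (\<lambda>(x, y) \<in> carrier G \<times> carrier G. d x * d y / d (x \<otimes>\<^bsub>G\<^esub> y))"
      and d: "\<forall>x \<in> carrier G. d x \<noteq> 0"
      unfolding coboundaries2_def by (elim CollectE exE conjE)
    have Z: "f \<in> carrier (cocycles2 G)"
      using d by (auto simp: cocycles2_mem f G.m_assoc)
    moreover have "trivializes f (\<lambda>h. d (\<pi> h))"
      using d \<pi>.hom_closed by (auto simp: trivializes_def f)
    ultimately show ?thesis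
      using T[OF Z] d A_sub by (auto simp: char_group_def A_simps intro!: restrict_ext)
  qed
  have kernel: "kernel (cocycles2 G) (char_group (subgrp L ?A)) T = coboundaries2 G"
    using cobd cobd' by (auto simp: kernel_def)
  have "\<exists>f \<in> carrier (cocycles2 G). T f = \<chi>" if \<chi>: "\<chi> \<in> carrier (char_group (subgrp L ?A))" for \<chi>
  proof -
    have \<chi>_mult: "\<chi> (a \<otimes>\<^bsub>L\<^esub> b) = \<chi> a * \<chi> b" if "a \<in> ?A" "b \<in> ?A" for a b
      using \<chi> that by (simp add: char_group_def A_simps)
    have \<chi>_nz: "\<chi> a \<noteq> 0" if "a \<in> ?A" for a
      using \<chi> that by (auto simp: char_group_def A_simps)
    \<comment> \<open>Extend \<open>\<chi>\<close> to a function on \<open>L\<close> by means of the section. Since \<open>A\<close> is central, its coboundary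
        descends to \<open>G\<close>.\<close>
    define c where "c h = \<chi> (h \<otimes>\<^bsub>L\<^esub> inv\<^bsub>L\<^esub> s (\<pi> h))" for h
    have c_nz: "c h \<noteq> 0" if "h \<in> carrier L" for h using \<chi>_nz fibre(1)[OF that] by (simp add: c_def)
    have c_mult: "c (a \<otimes>\<^bsub>L\<^esub> h) = \<chi> a * c h" if "a \<in> ?A" "h \<in> carrier L" for a h
    proof -
      have "\<pi> (a \<otimes>\<^bsub>L\<^esub> h) = \<pi> h" using that A_sub by simp
      moreover have "a \<otimes>\<^bsub>L\<^esub> h \<otimes>\<^bsub>L\<^esub> inv\<^bsub>L\<^esub> s (\<pi> h) = a \<otimes>\<^bsub>L\<^esub> (h \<otimes>\<^bsub>L\<^esub> inv\<^bsub>L\<^esub> s (\<pi> h))"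
        using that A_sub s[of "\<pi> h"] by (simp add: L.m_assoc)
      ultimately show ?thesis using \<chi>_mult[OF that(1) fibre(1)[OF that(2)]] by (simp add: c_def)
    qed
    let ?f = "\<lambda>(x, y) \<in> carrier G \<times> carrier G. c (s x) * c (s y) / c (s x \<otimes>\<^bsub>L\<^esub> s y)"
    have b: "?f (\<pi> h, \<pi> k) = c h * c k / c (h \<otimes>\<^bsub>L\<^esub> k)" if "h \<in> carrier L" "k \<in> carrier L" for h k
    proof -
      let ?a = "h \<otimes>\<^bsub>L\<^esub> inv\<^bsub>L\<^esub> s (\<pi> h)" and ?b = "k \<otimes>\<^bsub>L\<^esub> inv\<^bsub>L\<^esub> s (\<pi> k)"
      let ?x = "s (\<pi> h)" and ?y = "s (\<pi> k)"
      have cl: "?a \<in> ?A" "?b \<in> ?A" "?a \<in> carrier L" "?b \<in> carrier L" "?x \<in> carrier L" "?y \<in> carrier L"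
        using fibre(1) that A_sub(1) s by auto
      have "h \<otimes>\<^bsub>L\<^esub> k = (?a \<otimes>\<^bsub>L\<^esub> ?x) \<otimes>\<^bsub>L\<^esub> (?b \<otimes>\<^bsub>L\<^esub> ?y)" using fibre(2) that by metis
      also have "\<dots> = ?a \<otimes>\<^bsub>L\<^esub> (?b \<otimes>\<^bsub>L\<^esub> (?x \<otimes>\<^bsub>L\<^esub> ?y))"
        using central[OF cl(2) cl(5)] cl by (metis L.m_assoc L.m_closed)
      finally have "c (h \<otimes>\<^bsub>L\<^esub> k) = \<chi> ?a * (\<chi> ?b * c (?x \<otimes>\<^bsub>L\<^esub> ?y))"
        using c_mult cl by simp
      moreover have "c h = \<chi> ?a * c ?x" "c k = \<chi> ?b * c ?y"
        using c_mult cl fibre(2) that by metis+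
      ultimately show ?thesis
        using that \<chi>_nz cl by simp
    qed
    have "?f \<in> carrier (cocycles2 G)"
      unfolding cocycles2_mem
    proof (intro conjI ballI)
      fix x y assume xy: "x \<in> carrier G" "y \<in> carrier G"
      then show "?f (x, y) \<noteq> 0" using c_nz s by simp
      fix z assume "z \<in> carrier G"
      then show "?f (x, y) * ?f (x \<otimes>\<^bsub>G\<^esub> y, z) = ?f (y, z) * ?f (x, y \<otimes>\<^bsub>G\<^esub> z)"
        using b[of "s x" "s y"] b[of "s x \<otimes>\<^bsub>L\<^esub> s y" "s z"] b[of "s y" "s z"] b[of "s x" "s y \<otimes>\<^bsub>L\<^esub> s z"]
          xy s c_nz by (simp add: L.m_assoc)
    qed (auto simp: extensional_def)
    moreover have "trivializes ?f c" using b c_nz by (simp add: trivializes_def)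
    moreover have "c a / c \<one>\<^bsub>L\<^esub> = \<chi> a" if "a \<in> ?A" for a
      using c_mult[OF that L.one_closed] c_nz[of "\<one>\<^bsub>L\<^esub>"] A_sub(1)[OF that] by simp
    moreover have "\<chi> \<in> extensional ?A" using \<chi> by (simp add: char_group_def A_simps PiE_iff)
    ultimately show ?thesis
      using T[of ?f c] by (intro bexI[of _ ?f]) (auto simp: extensional_def)
  qed
  then have "T ` carrier (cocycles2 G) = carrier (char_group (subgrp L ?A))"
    using T.hom_closed by blast
  from T.FactGroup_iso[OF this] show "schur_multiplier G \<cong> char_group (subgrp L ?A)"
    by (simp add: schur_multiplier_def kernel)
  show "group (schur_multiplier G)"
    using normal.factorgroup_is_group[OF T.normal_kernel] by (simp add: schur_multiplier_def kernel)
qed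

section \<open>The Schur multiplier of the group G39\<close>

text \<open>
  The central extension of \<open>G\<close> by \<open>\<complex>\<^sup>\<times>\<close> with the given cocycle. As cocycles need not be normalized,
  the unit has the first component \<open>1 / f(1, 1)\<close>.
\<close>

definition cocycle_ext :: "('a, 'm) monoid_scheme \<Rightarrow> ('a \<times> 'a \<Rightarrow> complex) \<Rightarrow> (complex \<times> 'a) monoid"
  where "cocycle_ext G f =
    \<lparr> carrier = (- {0}) \<times> carrier G,
      monoid.mult = (\<lambda>(s, x) (t, y). (s * t * f (x, y), x \<otimes>\<^bsub>G\<^esub> y)),
      one = (1 / f (\<one>\<^bsub>G\<^esub>, \<one>\<^bsub>G\<^esub>), \<one>\<^bsub>G\<^esub>) \<rparr>"

lemma (in group) cocycle_one:
  assumes f: "f \<in> carrier (cocycles2 G)" and x: "x \<in> carrier G"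
  shows "f (\<one>, x) = f (\<one>, \<one>)" "f (x, \<one>) = f (\<one>, \<one>)"
proof -
  have c: "f (a, b) * f (a \<otimes> b, d) = f (b, d) * f (a, b \<otimes> d)"
    if "a \<in> carrier G" "b \<in> carrier G" "d \<in> carrier G" for a b d
    using f that unfolding cocycles2_mem by blast
  have nz: "f (a, b) \<noteq> 0" if "a \<in> carrier G" "b \<in> carrier G" for a b
    using f that unfolding cocycles2_mem by blast
  show "f (\<one>, x) = f (\<one>, \<one>)" using c[of \<one> \<one> x] nz[of \<one> x] x by simp
  show "f (x, \<one>) = f (\<one>, \<one>)" using c[of x \<one> \<one>] nz[of x \<one>] x by simp
qed

lemma cocycle_ext_simps:
  "carrier (cocycle_ext G f) = (- {0}) \<times> carrier G"
  "(s, x) \<otimes>\<^bsub>cocycle_ext G f\<^esub> (t, y) = (s * t * f (x, y), x \<otimes>\<^bsub>G\<^esub> y)"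
  "\<one>\<^bsub>cocycle_ext G f\<^esub> = (1 / f (\<one>\<^bsub>G\<^esub>, \<one>\<^bsub>G\<^esub>), \<one>\<^bsub>G\<^esub>)"
  by (simp_all add: cocycle_ext_def)

lemma (in group) group_cocycle_ext:
  assumes f: "f \<in> carrier (cocycles2 G)"
  shows "group (cocycle_ext G f)"
proof (rule groupI)
  have nz: "f (a, b) \<noteq> 0" if "a \<in> carrier G" "b \<in> carrier G" for a b
    using f that unfolding cocycles2_mem by blast
  fix p assume p: "p \<in> carrier (cocycle_ext G f)"
  then obtain s x where sx: "p = (s, x)" "s \<noteq> 0" "x \<in> carrier G" by (auto simp: cocycle_ext_simps)
  show "\<one>\<^bsub>cocycle_ext G f\<^esub> \<otimes>\<^bsub>cocycle_ext G f\<^esub> p = p"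
    using sx nz[of \<one> \<one>] cocycle_one(1)[OF f sx(3)] by (simp add: cocycle_ext_simps)
  show "\<exists>q\<in>carrier (cocycle_ext G f). q \<otimes>\<^bsub>cocycle_ext G f\<^esub> p = \<one>\<^bsub>cocycle_ext G f\<^esub>"
  proof
    let ?q = "(1 / (s * f (inv x, x) * f (\<one>, \<one>)), inv x)"
    have "f (inv x, x) \<noteq> 0" "f (\<one>, \<one>) \<noteq> 0" using nz sx(3) by simp_all
    then show "?q \<in> carrier (cocycle_ext G f)" "?q \<otimes>\<^bsub>cocycle_ext G f\<^esub> p = \<one>\<^bsub>cocycle_ext G f\<^esub>"
      using sx by (simp_all add: cocycle_ext_simps)
  qed
  fix q assume "q \<in> carrier (cocycle_ext G f)"
  then obtain t y where ty: "q = (t, y)" "t \<noteq> 0" "y \<in> carrier G" by (auto simp: cocycle_ext_simps)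
  show "p \<otimes>\<^bsub>cocycle_ext G f\<^esub> q \<in> carrier (cocycle_ext G f)"
    using sx ty nz by (simp add: cocycle_ext_simps)
  fix r assume "r \<in> carrier (cocycle_ext G f)"
  then obtain u z where uz: "r = (u, z)" "u \<noteq> 0" "z \<in> carrier G" by (auto simp: cocycle_ext_simps)
  have "f (x, y) * f (x \<otimes> y, z) = f (y, z) * f (x, y \<otimes> z)"
    using f sx ty uz unfolding cocycles2_mem by blast
  then have "s * t * f (x, y) * u * f (x \<otimes> y, z) = s * (t * u * f (y, z)) * f (x, y \<otimes> z)"
    by (simp add: mult_ac)
  then show "p \<otimes>\<^bsub>cocycle_ext G f\<^esub> q \<otimes>\<^bsub>cocycle_ext G f\<^esub> r = p \<otimes>\<^bsub>cocycle_ext G f\<^esub> (q \<otimes>\<^bsub>cocycle_ext G f\<^esub> r)"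
    using sx ty uz by (simp add: cocycle_ext_simps m_assoc)
qed (use f in \<open>auto simp: cocycle_ext_simps cocycles2_mem\<close>)

lemma exists_complex_cube_root: "\<exists>s. s ^ 3 = (w :: complex)"
proof
  show "(rcis (root 3 (cmod w)) (Arg w / 3)) ^ 3 = w"
    by (simp add: DeMoivre2 rcis_cmod_Arg)
qed

text \<open>
  Every cocycle of a group with a pair of elements as in \<open>hom_from_H_mod_center\<close> becomes a
  coboundary on \<open>H\<close>: the pair lifts to elements of order dividing 3 of the central extension, since \<open>\<complex>\<^sup>\<times>\<close>
  has cube roots, and the universal property of \<open>H\<close> lifts the homomorphism.
\<close>

lemma (in group) cocycle_coboundary_on_H:
  fixes x y
  defines "v \<equiv> inv x \<otimes> y \<otimes> x \<otimes> inv y"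
  assumes cl: "x \<in> carrier G" "y \<in> carrier G"
    and 3: "x [^] (3::nat) = \<one>" "y [^] (3::nat) = \<one>"
    and v: "v \<otimes> x = x \<otimes> v" "v \<otimes> y = y \<otimes> v"
    and \<pi>: "\<pi> \<in> hom H G" "\<pi> eta1 = x" "\<pi> eta3 = y"
    and f: "f \<in> carrier (cocycles2 G)"
  shows "\<exists>c. (\<forall>h \<in> carrier H. c h \<noteq> 0) \<and>
    (\<forall>h \<in> carrier H. \<forall>k \<in> carrier H. f (\<pi> h, \<pi> k) = c h * c k / c (h \<otimes>\<^bsub>H\<^esub> k))"
proof -
  let ?E = "cocycle_ext G f"
  interpret E: group ?E by (rule group_cocycle_ext[OF f])
  have nz: "f (a, b) \<noteq> 0" if "a \<in> carrier G" "b \<in> carrier G" for a b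
    using f that unfolding cocycles2_mem by blast
  interpret p: group_hom ?E G snd
    by unfold_locales (auto simp: hom_def cocycle_ext_simps)
  have lift: "\<exists>x' \<in> carrier ?E. snd x' = a \<and> x' [^]\<^bsub>?E\<^esub> (3::nat) = \<one>\<^bsub>?E\<^esub>"
    if a: "a \<in> carrier G" "a [^] (3::nat) = \<one>" for a
  proof -
    obtain s where s: "s ^ 3 = 1 / (f (\<one>, \<one>) * f (a, a) * f (a \<otimes> a, a))"
      using exists_complex_cube_root by blast
    have d: "f (\<one>, \<one>) \<noteq> 0" "f (a, a) \<noteq> 0" "f (a \<otimes> a, a) \<noteq> 0" using nz a by simp_all
    then have "s \<noteq> 0" using s by auto
    have "(s, a) [^]\<^bsub>?E\<^esub> (3::nat) = (s, a) \<otimes>\<^bsub>?E\<^esub> (s, a) \<otimes>\<^bsub>?E\<^esub> (s, a)"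
      using \<open>s \<noteq> 0\<close> a by (simp add: numeral_3_eq_3 cocycle_ext_simps(1))
    also have "\<dots> = (s ^ 3 * f (a, a) * f (a \<otimes> a, a), a \<otimes> a \<otimes> a)"
      by (simp add: cocycle_ext_simps power3_eq_cube mult_ac)
    also have "\<dots> = \<one>\<^bsub>?E\<^esub>"
    proof -
      have "a \<otimes> a \<otimes> a = \<one>" using a by (simp add: numeral_3_eq_3)
      then show ?thesis using d by (simp add: s cocycle_ext_simps)
    qed
    finally show ?thesis
      using \<open>s \<noteq> 0\<close> a by (intro bexI[of _ "(s, a)"]) (simp_all add: cocycle_ext_simps)
  qed
  obtain x' where x': "x' \<in> carrier ?E" "snd x' = x" "x' [^]\<^bsub>?E\<^esub> (3::nat) = \<one>\<^bsub>?E\<^esub>"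
    using lift[OF cl(1) 3(1)] by blast
  obtain y' where y': "y' \<in> carrier ?E" "snd y' = y" "y' [^]\<^bsub>?E\<^esub> (3::nat) = \<one>\<^bsub>?E\<^esub>"
    using lift[OF cl(2) 3(2)] by blast
  have central: "q \<otimes>\<^bsub>?E\<^esub> z = z \<otimes>\<^bsub>?E\<^esub> q" if "z \<in> carrier ?E" "snd z = \<one>" "q \<in> carrier ?E" for z q
  proof -
    have "snd q \<in> carrier G" using that(3) by (auto simp: cocycle_ext_simps)
    from cocycle_one[OF f this] show ?thesis
      using that by (cases z; cases q) (simp add: cocycle_ext_simps)
  qed
  let ?v' = "inv\<^bsub>?E\<^esub> x' \<otimes>\<^bsub>?E\<^esub> y' \<otimes>\<^bsub>?E\<^esub> x' \<otimes>\<^bsub>?E\<^esub> inv\<^bsub>?E\<^esub> y'"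
  let ?\<alpha> = "?v' \<otimes>\<^bsub>?E\<^esub> x' \<otimes>\<^bsub>?E\<^esub> inv\<^bsub>?E\<^esub> ?v' \<otimes>\<^bsub>?E\<^esub> inv\<^bsub>?E\<^esub> x'"
  let ?\<beta> = "y' \<otimes>\<^bsub>?E\<^esub> ?v' \<otimes>\<^bsub>?E\<^esub> inv\<^bsub>?E\<^esub> y' \<otimes>\<^bsub>?E\<^esub> inv\<^bsub>?E\<^esub> ?v'"
  have vc: "v \<in> carrier G" using cl by (simp add: v_def)
  have v': "?v' \<in> carrier ?E" "snd ?v' = v"
    using x' y' by (simp_all add: v_def)
  have \<alpha>: "?\<alpha> \<in> carrier ?E" "snd ?\<alpha> = \<one>"
  proof -
    have "snd ?\<alpha> = v \<otimes> x \<otimes> inv v \<otimes> inv x"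
      using x' y' by (simp add: v_def)
    then show "snd ?\<alpha> = \<one>" using v(1) cl vc by (simp add: m_assoc)
  qed (use x' y' in simp)
  have \<beta>: "?\<beta> \<in> carrier ?E" "snd ?\<beta> = \<one>"
  proof -
    have "snd ?\<beta> = y \<otimes> v \<otimes> inv y \<otimes> inv v"
      using x' y' by (simp add: v_def)
    then show "snd ?\<beta> = \<one>" using v(2)[symmetric] cl vc by (simp add: m_assoc)
  qed (use x' y' in simp)
  obtain \<Phi> where \<Phi>: "\<Phi> \<in> hom H ?E" "\<Phi> eta1 = x'" "\<Phi> eta3 = y'"
    using E.hom_from_H[OF x'(1) y'(1) x'(3) y'(3)] central[OF \<alpha>] central[OF \<beta>] x'(1) y'(1) by blast
  have proj: "snd (\<Phi> h) = \<pi> h" if "h \<in> H_set" for h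
  proof -
    have "snd \<circ> \<Phi> \<in> hom H G" using \<Phi>(1) p.homh by (rule Group.hom_compose)
    from hom_H_eqI[OF is_group this \<pi>(1) _ _ that] show ?thesis using \<Phi> \<pi> x' y' by simp
  qed
  have \<Phi>cl: "\<Phi> h \<in> carrier ?E" if "h \<in> H_set" for h
    using hom_in_carrier[OF \<Phi>(1)] that by simp
  have fnz: "fst (\<Phi> h) \<noteq> 0" if "h \<in> H_set" for h
    using \<Phi>cl[OF that] by (auto simp: cocycle_ext_simps)
  have "fst (\<Phi> (hmul h k)) = fst (\<Phi> h) * fst (\<Phi> k) * f (\<pi> h, \<pi> k)" if "h \<in> H_set" "k \<in> H_set" for h k
  proof -
    have "\<Phi> (hmul h k) = \<Phi> h \<otimes>\<^bsub>?E\<^esub> \<Phi> k" using hom_mult[OF \<Phi>(1), of h k] that by simp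
    also have "\<dots> = (fst (\<Phi> h), \<pi> h) \<otimes>\<^bsub>?E\<^esub> (fst (\<Phi> k), \<pi> k)"
      using proj that by (metis prod.collapse)
    finally show ?thesis by (simp add: cocycle_ext_simps)
  qed
  then show ?thesis
    using fnz hmul_closed by (intro exI[of _ "\<lambda>h. 1 / fst (\<Phi> h)"]) (simp add: field_simps)
qed

text \<open>The center of \<open>H\<close> is identified with its character group by means of a primitive cube root of unity.\<close>

lemma center_iso_char_group: "subgrp H (center H) \<cong> char_group (subgrp H (center H))"
proof -
  let ?A = "subgrp H (center H)"
  define \<omega> where "\<omega> = Complex (- 1 / 2) (sqrt 3 / 2)"
  have \<omega>3: "\<omega> ^ 3 = 1" by (simp add: \<omega>_def complex_eq_iff power3_eq_cube)
  have \<omega>s: "1 + \<omega> + \<omega> ^ 2 = 0" by (simp add: \<omega>_def complex_eq_iff power2_eq_square)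
  have \<omega>1: "\<omega> \<noteq> 1" "\<omega> \<noteq> 0" by (simp_all add: \<omega>_def complex_eq_iff)
  have \<omega>2: "\<omega> ^ 2 \<noteq> 1" "\<omega> ^ 2 \<noteq> \<omega>" using \<omega>1 \<omega>3 by (auto simp: power2_eq_square power3_eq_cube)
  have roots: "\<exists>n \<le> 2. z = \<omega> ^ n" if "z ^ 3 = 1" for z
  proof -
    have "(z - 1) * (z - \<omega>) * (z - \<omega> ^ 2)
      = z ^ 3 - (1 + \<omega> + \<omega> ^ 2) * z ^ 2 + \<omega> * (1 + \<omega> + \<omega> ^ 2) * z - \<omega> ^ 3"
      by (simp add: algebra_simps power2_eq_square power3_eq_cube)
    also have "\<dots> = 0" using that \<omega>3 \<omega>s by simp
    finally have "z = \<omega> ^ 0 \<or> z = \<omega> ^ 1 \<or> z = \<omega> ^ 2" by simp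
    then show ?thesis by (metis zero_le one_le_numeral order_refl)
  qed
  have \<omega>_mod: "\<omega> ^ res3 (int n) = \<omega> ^ n" for n
  proof -
    have "\<omega> ^ n = \<omega> ^ (3 * (n div 3) + n mod 3)" by simp
    also have "\<dots> = \<omega> ^ (n mod 3)" by (simp only: power_add power_mult \<omega>3) simp
    finally show ?thesis by (simp add: res3_def nat_mod_distrib)
  qed
  have \<omega>_inj: "m = n" if "\<omega> ^ m = \<omega> ^ n" "m \<le> 2" "n \<le> 2" for m n
  proof -
    have "m = 0 \<or> m = 1 \<or> m = 2" "n = 0 \<or> n = 1 \<or> n = 2" using that by auto
    then show ?thesis using that(1) \<omega>1 \<omega>2 by (elim disjE) auto
  qed
  \<comment> \<open>The pairing of the center with itself; only the first two coordinates can be nonzero there.\<close>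
  define P where "P = (\<lambda>(b, c, g :: nat, h :: nat, k :: nat) (b', c', g' :: nat, h' :: nat, k' :: nat). \<omega> ^ (b * b' + c * c'))"
  define \<Omega> where "\<Omega> e = (\<lambda>e' \<in> center H. P e e')" for e
  have mem: "e \<in> center H \<longleftrightarrow> (\<exists>b c. e = (b, c, 0, 0, 0) \<and> b \<le> 2 \<and> c \<le> 2)" for e
    by (cases e) (auto simp: center_H)
  have mult: "(b, c, 0, 0, 0) \<otimes>\<^bsub>H\<^esub> (b', c', 0, 0, 0) = (res3 (int (b + b')), res3 (int (c + c')), 0, 0, 0)"
    if "b \<le> 2" "c \<le> 2" "b' \<le> 2" "c' \<le> 2" for b c b' c'
    using that by simp
  have \<omega>_mod_mult: "\<omega> ^ (res3 (int n) * m) = \<omega> ^ (n * m)" "\<omega> ^ (m * res3 (int n)) = \<omega> ^ (m * n)" for m n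
    using \<omega>_mod[of n] by (simp_all add: power_mult mult.commute[of m])
  have P_mult: "P (e \<otimes>\<^bsub>H\<^esub> e') d = P e d * P e' d" "P d (e \<otimes>\<^bsub>H\<^esub> e') = P d e * P d e'"
    if "e \<in> center H" "e' \<in> center H" for e e' d
  proof -
    obtain b c where e: "e = (b, c, 0, 0, 0)" "b \<le> 2" "c \<le> 2" using \<open>e \<in> center H\<close> mem by blast
    obtain b' c' where e': "e' = (b', c', 0, 0, 0)" "b' \<le> 2" "c' \<le> 2" using \<open>e' \<in> center H\<close> mem by blast
    obtain i j g h k where d: "d = (i, j, g, h, k)" by (cases d)
    have "e \<otimes>\<^bsub>H\<^esub> e' = (res3 (int (b + b')), res3 (int (c + c')), 0, 0, 0)"
      unfolding e(1) e'(1) using mult e e' by blast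
    then show "P (e \<otimes>\<^bsub>H\<^esub> e') d = P e d * P e' d" "P d (e \<otimes>\<^bsub>H\<^esub> e') = P d e * P d e'"
      by (simp_all only: P_def e(1) e'(1) d prod.case power_add \<omega>_mod_mult)
        (simp_all add: distrib_left distrib_right power_add)
  qed
  have sub: "subgroup (center H) H" using center_normal normal_imp_subgroup by blast
  have A_simps: "carrier ?A = center H" "x \<otimes>\<^bsub>?A\<^esub> y = x \<otimes>\<^bsub>H\<^esub> y" for x y by (simp_all add: subgrp_def)
  have P_nz: "P e d \<noteq> 0" for e d using \<omega>1 by (cases e; cases d) (simp add: P_def)
  have zz: "z12 \<in> center H" "z23 \<in> center H" by (simp_all add: center_H z12_def z23_def)
  have "\<Omega> \<in> iso ?A (char_group ?A)"
  proof (rule isoI)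
    show "\<Omega> \<in> hom ?A (char_group ?A)"
    proof (rule homI)
      show "\<Omega> e \<in> carrier (char_group ?A)" for e
        using P_mult P_nz subgroup.m_closed[OF sub] by (auto simp: char_group_def A_simps \<Omega>_def simp del: mult_H)
      show "\<Omega> (e \<otimes>\<^bsub>?A\<^esub> e') = \<Omega> e \<otimes>\<^bsub>char_group ?A\<^esub> \<Omega> e'" if "e \<in> carrier ?A" "e' \<in> carrier ?A" for e e'
        using P_mult(1) that by (auto simp: char_group_def A_simps \<Omega>_def intro!: restrict_ext simp del: mult_H)
    qed
    have "inj_on \<Omega> (center H)"
    proof (rule inj_onI)
      fix e e' assume ee: "e \<in> center H" "e' \<in> center H" "\<Omega> e = \<Omega> e'"
      then have "P e z12 = P e' z12" "P e z23 = P e' z23"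
        using zz by (metis \<Omega>_def restrict_apply')+
      then show "e = e'" using ee(1,2) \<omega>_inj by (auto simp: mem P_def z12_def z23_def)
    qed
    moreover have "carrier (char_group ?A) \<subseteq> \<Omega> ` center H"
    proof
      fix \<chi> assume \<chi>: "\<chi> \<in> carrier (char_group ?A)"
      have m: "\<chi> (e \<otimes>\<^bsub>H\<^esub> e') = \<chi> e * \<chi> e'" if "e \<in> center H" "e' \<in> center H" for e e'
        using \<chi> that by (simp add: char_group_def A_simps)
      have nz: "\<chi> e \<noteq> 0" if "e \<in> center H" for e
        using \<chi> that by (auto simp: char_group_def A_simps)
      have one: "(0, 0, 0, 0, 0) \<in> center H" by (simp add: center_H)
      have \<chi>1: "\<chi> (0, 0, 0, 0, 0) = 1" using m[OF one one] nz[OF one] by (simp add: center_H)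
      have p12: "\<chi> (res3 (int n), 0, 0, 0, 0) = \<chi> z12 ^ n" for n
      proof (induction n)
        case (Suc n)
        have "(res3 (int (Suc n)), 0, 0, 0, 0) = (res3 (int n), 0, 0, 0, 0) \<otimes>\<^bsub>H\<^esub> z12"
          by (simp add: z12_def) (simp add: res3_def mod_simps add.commute)
        then show ?case using m[of "(res3 (int n), 0, 0, 0, 0)" z12] Suc zz by (simp add: center_H del: mult_H)
      qed (simp add: \<chi>1)
      have p23: "\<chi> (0, res3 (int n), 0, 0, 0) = \<chi> z23 ^ n" for n
      proof (induction n)
        case (Suc n)
        have "(0, res3 (int (Suc n)), 0, 0, 0) = (0, res3 (int n), 0, 0, 0) \<otimes>\<^bsub>H\<^esub> z23"
          by (simp add: z23_def) (simp add: res3_def mod_simps add.commute)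
        then show ?case using m[of "(0, res3 (int n), 0, 0, 0)" z23] Suc zz by (simp add: center_H del: mult_H)
      qed (simp add: \<chi>1)
      have "\<chi> z12 ^ 3 = 1" "\<chi> z23 ^ 3 = 1"
        using p12[of 3] p23[of 3] \<chi>1 by (simp_all add: res3_def)
      then obtain b c where bc: "b \<le> 2" "c \<le> 2" "\<chi> z12 = \<omega> ^ b" "\<chi> z23 = \<omega> ^ c" using roots by metis
      have "\<chi> e = P (b, c, 0, 0, 0) e" if "e \<in> center H" for e
      proof -
        obtain b' c' where e: "e = (b', c', 0, 0, 0)" "b' \<le> 2" "c' \<le> 2" using \<open>e \<in> center H\<close> mem by blast
        have "e = (res3 (int b'), 0, 0, 0, 0) \<otimes>\<^bsub>H\<^esub> (0, res3 (int c'), 0, 0, 0)" using e by simp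
        then have "\<chi> e = \<chi> (res3 (int b'), 0, 0, 0, 0) * \<chi> (0, res3 (int c'), 0, 0, 0)"
          using m by (simp add: center_H del: mult_H)
        then show ?thesis by (simp add: p12 p23 bc e(1) P_def power_mult power_add)
      qed
      then have "\<chi> = \<Omega> (b, c, 0, 0, 0)"
        using \<chi> by (auto simp: \<Omega>_def char_group_def A_simps PiE_iff extensional_def fun_eq_iff)
      then show "\<chi> \<in> \<Omega> ` center H" using bc by (auto simp: center_H)
    qed
    ultimately show "bij_betw \<Omega> (carrier ?A) (carrier (char_group ?A))"
      using \<open>\<Omega> \<in> hom _ _\<close> by (auto simp: bij_betw_def A_simps hom_def)
  qed
  then show ?thesis by (auto simp: is_iso_def)
qed

lemma schur_multiplier_G39:
  assumes "\<pi> \<in> epi H G39" "\<pi> eta1 = G39_b" "\<pi> eta3 = G39_a" "kernel H G39 \<pi> = center H"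
  shows "subgrp H (center H) \<cong> schur_multiplier G39"
proof -
  have \<pi>: "\<pi> \<in> hom H G39" using assms(1) by (simp add: epi_def)
  have sub: "kernel H G39 \<pi> \<subseteq> center H \<inter> derived H (carrier H)"
    unfolding assms(4) derived_H center_H by (auto simp: hbox_def)
  note cob = group.cocycle_coboundary_on_H[OF group_G39 G39_pair(2,1,4,3,5,6) \<pi> assms(2,3)]
  have "group (schur_multiplier G39)"
    by (rule schur_multiplier_iso_char_group(1)[OF group_H group_G39 assms(1) sub cob])
  moreover have "schur_multiplier G39 \<cong> char_group (subgrp H (center H))"
    using schur_multiplier_iso_char_group(2)[OF group_H group_G39 assms(1) sub cob]
    unfolding assms(4) .
  ultimately show ?thesis
    using center_iso_char_group group.iso_sym iso_trans by blast
qed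

section \<open>The structure of H\<close>

theorem theorem6p2:
  shows
   "((\<forall>h \<in> H_set. \<forall>h' \<in> H_set. \<exists>!q. is_H_product h h' q)
   \<and> group H \<and> order H = 243)
   \<and> internal_direct H (center H) sub_Z12 sub_Z23
   \<and> internal_direct H (derived H (carrier H)) (sub_Z12 <#>\<^bsub>H\<^esub> sub_Z23) sub_Y2
   \<and> (internal_direct H (sub_Z12 <#>\<^bsub>H\<^esub> sub_Y1) sub_Z12 sub_Y1
     \<and> internal_semidirect H (sub_Z12 <#>\<^bsub>H\<^esub> sub_Y1 <#>\<^bsub>H\<^esub> sub_Y2) (sub_Z12 <#>\<^bsub>H\<^esub> sub_Y1) sub_Y2
     \<and> internal_direct H (sub_Z12 <#>\<^bsub>H\<^esub> sub_Y1 <#>\<^bsub>H\<^esub> sub_Y2 <#>\<^bsub>H\<^esub> sub_Z23) (sub_Z12 <#>\<^bsub>H\<^esub> sub_Y1 <#>\<^bsub>H\<^esub> sub_Y2) sub_Z23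
     \<and> internal_semidirect H (carrier H) (sub_Z12 <#>\<^bsub>H\<^esub> sub_Y1 <#>\<^bsub>H\<^esub> sub_Y2 <#>\<^bsub>H\<^esub> sub_Z23) sub_Y3)
   \<and> (\<forall>Y \<in> {sub_Z12, sub_Z23, sub_Y1, sub_Y2, sub_Y3}. subgrp H Y \<cong> C3)
   \<and> (\<exists>\<theta> \<in> hom C3 (AutoGroup (C3 \<times>\<times> C3)).
       \<exists>\<psi> \<in> hom C3 (AutoGroup (semidirect (C3 \<times>\<times> C3) C3 \<theta> \<times>\<times> C3)).
         H \<cong> semidirect (semidirect (C3 \<times>\<times> C3) C3 \<theta> \<times>\<times> C3) C3 \<psi>)
   \<and> (group G39 \<and> order G39 = 27 \<and> G39 \<cong> SmallGroup_27_3)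
   \<and> representation_group H G39
   \<and> (\<exists>\<pi> \<in> epi H G39.
         \<pi> eta1 = G39_b
       \<and> \<pi> eta2 = G39_b \<otimes>\<^bsub>G39\<^esub> G39_a \<otimes>\<^bsub>G39\<^esub> inv\<^bsub>G39\<^esub> G39_b \<otimes>\<^bsub>G39\<^esub> inv\<^bsub>G39\<^esub> G39_a
       \<and> \<pi> eta3 = G39_a \<and> \<pi> z12 = \<one>\<^bsub>G39\<^esub> \<and> \<pi> z23 = \<one>\<^bsub>G39\<^esub>
       \<and> kernel H G39 \<pi> \<subseteq> center H \<inter> derived H (carrier H)
       \<and> subgrp H (kernel H G39 \<pi>) \<cong> schur_multiplier G39)
   \<and> H \<cong> SmallGroup_243_3"
proof -
  obtain \<pi> where \<pi>: "\<pi> \<in> epi H G39" "\<pi> eta1 = G39_b" "\<pi> eta3 = G39_a" "kernel H G39 \<pi> = center H"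
    using G39_covering by blast
  interpret \<pi>: group_hom H G39 \<pi>
    using \<pi>(1) by (simp add: group_hom_def group_hom_axioms_def group_H group_G39 epi_def)
  have e: "eta1 \<in> carrier H" "eta3 \<in> carrier H" by simp_all
  have eta2: "\<pi> eta2 = G39_b \<otimes>\<^bsub>G39\<^esub> G39_a \<otimes>\<^bsub>G39\<^esub> inv\<^bsub>G39\<^esub> G39_b \<otimes>\<^bsub>G39\<^esub> inv\<^bsub>G39\<^esub> G39_a"
    unfolding commutator_values(1)[symmetric] using e
    by (simp add: \<pi> del: inv_H mult_H carrier_H)
  have zero: "\<pi> z12 = \<one>\<^bsub>G39\<^esub>" "\<pi> z23 = \<one>\<^bsub>G39\<^esub>"
  proof -
    have "z12 \<in> kernel H G39 \<pi>" "z23 \<in> kernel H G39 \<pi>"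
      by (simp_all add: \<pi>(4) center_H z12_def z23_def)
    then show "\<pi> z12 = \<one>\<^bsub>G39\<^esub>" "\<pi> z23 = \<one>\<^bsub>G39\<^esub>" by (simp_all add: kernel_def)
  qed
  have sub: "center H \<subseteq> center H \<inter> derived H (carrier H)"
    unfolding derived_H center_H by (auto simp: hbox_def)
  note schur = schur_multiplier_G39[OF \<pi>]
  have fin: "finite (carrier G39)"
  proof -
    have "carrier G39 = \<pi> ` H_set" using \<pi>(1) by (simp add: epi_def)
    then show ?thesis using finite_H_set by simp
  qed
  have rep: "representation_group H G39"
    unfolding representation_group_def
    using group_G39 fin group_H center_normal normal_imp_subgroup sub schur G39_iso_Mod by blast
  have SG27: "G39 \<cong> SmallGroup_27_3"
    using G39_iso_Mod SmallGroup_27_3_iso_Mod group.iso_sym iso_trans normal.factorgroup_is_group[OF center_normal]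
    by blast
  have prod: "\<forall>h \<in> H_set. \<forall>h' \<in> H_set. \<exists>!q. is_H_product h h' q"
    by (simp add: is_H_product_iff)
  have ker: "kernel H G39 \<pi> \<subseteq> center H \<inter> derived H (carrier H)"
    "subgrp H (kernel H G39 \<pi>) \<cong> schur_multiplier G39"
    unfolding \<pi>(4) by (fact sub schur)+
  show ?thesis
    apply (intro conjI)
                  apply (fact prod group_H order_H H_internal_products)+
    apply (use subgrp_iso_C3 in blast)
    apply (rule bexI[OF _ act2_hom], rule bexI[OF _ act3_hom], fact H_iso_semidirect)
    apply (fact group_G39 order_G39 SG27 rep)+
    apply (rule bexI[OF _ \<pi>(1)], intro conjI)
    apply (fact \<pi> eta2 zero ker SmallGroup_243_3_iso)+
    done
qed

end
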